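(* Let $Q\colon\mathbb R^{3\times 3}\to\mathbb R$ be the quadratic form $$Q(\xi)=\xi_{11}^2+\xi_{22}^2+\xi_{33}^2-2\xi_{11}\xi_{22}-2\xi_{22}\xi_{33}-2\xi_{33}\xi_{11}+\xi_{12}^2+\xi_{23}^2+\xi_{31}^2 .$$ Let $\Omega\subset\mathbb R^3$ be a bounded $C^1$ domain with outward unit normal $n$, let $v_0,v_1,v_2,v_3\colon\mathbb R\to\mathbb R$ be $C^1$ functions, and define $\underline u=(\underline u_1,\underline u_2,\underline u_3)\colon\mathbb R^3\to\mathbb R^3$ by $$\underline u_1=v_0-v_1+v_2+v_3,\qquad \underline u_2=v_0+v_1-v_2+v_3,\qquad \underline u_3=v_0+v_1+v_2-v_3,$$ where $v_0,v_1,v_2,v_3$ are evaluated at $x_1+x_2+x_3$, $-x_1+x_2+x_3$, $x_1-x_2+x_3$, $x_1+x_2-x_3$ respectively. Define the matrix field $$\underline J=\begin{bmatrix} -v_0'-v_1'-v_2'-v_3' & v_0'-v_1'-v_2'+v_3' & 0 \\ 0 & -v_0'-v_1'-v_2'-v_3' & v_0'+v_1'-v_2'-v_3' \\ v_0'-v_1'+v_2'-v_3' & 0 & -v_0'-v_1'-v_2'-v_3' \end{bmatrix},$$ with the derivatives $v_0',v_1',v_2',v_3'$ evaluated at the same respective arguments. Then for every $u\in W^{1,2}(\Omega;\mathbb R^3)$ with $u=\underline u$ on $\partial\Omega$ (in the sense of traces), $$\int_\Omega Q(\nabla u(x))\,dx\ \ge\ \int_{\partial\Omega}\underline u\cdot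 \underline J n\,dS ,$$ and this inequality is sharp: equality holds when $\nabla u=\nabla\underline u$ in $\Omega$.
   Context: The gradient of $u\colon\Omega\to\mathbb R^3$ is the $3\times3$ matrix field $(\nabla u)_{ij}=\partial u_i/\partial x_j$. $dS$ is surface measure on $\partial\Omega$. *)

theory Defs
  imports "HOL-Analysis.Analysis"
begin

section \<open>Functions of class \<open>C\<^sup>k\<close>, bounded \<open>C\<^sup>1\<close> domains, normal and surface measure\<close>

primrec C_k :: "nat \<Rightarrow> ('a::euclidean_space \<Rightarrow> 'b::real_normed_vector) \<Rightarrow> bool" where
  "C_k 0 f \<longleftrightarrow> continuous_on UNIV f"
| "C_k (Suc k) f \<longleftrightarrow> (\<forall>x. f differentiable (at x)) \<and>
     (\<forall>h. C_k k (\<lambda>x. frechet_derivative f (at x) h))"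

text \<open>In the open set \<open>V\<close>, after the orthogonal change of coordinates \<open>T\<close>, the set \<open>\<Omega>\<close> is
  the part of space strictly above the graph of the \<open>C\<^sup>1\<close> function \<open>\<gamma>\<close>; hence
  \<open>frontier \<Omega> \<inter> V\<close> is the part of the graph that lies in \<open>V\<close>. An orthogonal \<open>T\<close> covers any
  relabelling and reorientation of the coordinate axes.\<close>

definition graph_chart ::
    "(real^3) set \<Rightarrow> (real^3 \<Rightarrow> real^3) \<Rightarrow> (real \<times> real \<Rightarrow> real) \<Rightarrow> (real^3) set \<Rightarrow> bool" where
  "graph_chart \<Omega> T \<gamma> V \<longleftrightarrow> orthogonal_transformation T \<and> C_k 1 \<gamma> \<and> open V \<and>
     \<Omega> \<inter> V = T ` {y. \<gamma> (y$1, y$2) < y$3} \<inter> V"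

definition bounded_C1_domain :: "(real^3) set \<Rightarrow> bool" where
  "bounded_C1_domain \<Omega> \<longleftrightarrow> \<Omega> \<noteq> {} \<and> open \<Omega> \<and> connected \<Omega> \<and> bounded \<Omega> \<and>
     (\<forall>x \<in> frontier \<Omega>. \<exists>T \<gamma> V. graph_chart \<Omega> T \<gamma> V \<and> x \<in> V)"

definition graph_point :: "(real^3 \<Rightarrow> real^3) \<Rightarrow> (real \<times> real \<Rightarrow> real) \<Rightarrow> real \<times> real \<Rightarrow> real^3" where
  "graph_point T \<gamma> p = T (vector [fst p, snd p, \<gamma> p])"

definition area_density :: "(real \<times> real \<Rightarrow> real) \<Rightarrow> real \<times> real \<Rightarrow> real" where
  "area_density \<gamma> p = sqrt (1 + (frechet_derivative \<gamma> (at p) (1, 0))\<^sup>2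
                              + (frechet_derivative \<gamma> (at p) (0, 1))\<^sup>2)"

text \<open>As \<open>\<Omega>\<close> lies above the graph, the outward normal points downwards (before applying \<open>T\<close>).\<close>

definition outward_unit_normal :: "(real^3) set \<Rightarrow> (real^3 \<Rightarrow> real^3) \<Rightarrow> bool" where
  "outward_unit_normal \<Omega> n \<longleftrightarrow>
     (\<forall>T \<gamma> V p. graph_chart \<Omega> T \<gamma> V \<and> graph_point T \<gamma> p \<in> V \<longrightarrow>
        n (graph_point T \<gamma> p) =
          T (vector [frechet_derivative \<gamma> (at p) (1, 0), frechet_derivative \<gamma> (at p) (0, 1), - 1])
            /\<^sub>R area_density \<gamma> p)"

text \<open>\<open>S\<close> is the surface measure of \<open>frontier \<Omega>\<close>: a Borel measure on \<open>frontier \<Omega>\<close> given in every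
  local graph representation by the classical area formula. Since for a \<open>C\<^sup>1\<close> domain the charts
  cover \<open>frontier \<Omega>\<close>, this determines \<open>S\<close>.\<close>

definition surface_measure :: "(real^3) set \<Rightarrow> (real^3) measure \<Rightarrow> bool" where
  "surface_measure \<Omega> S \<longleftrightarrow>
     space S = frontier \<Omega> \<and> sets S = sets (restrict_space borel (frontier \<Omega>)) \<and>
     (\<forall>T \<gamma> V A. graph_chart \<Omega> T \<gamma> V \<and> A \<in> sets S \<and> A \<subseteq> V \<longrightarrow>
        emeasure S A =
          (\<integral>\<^sup>+p. ennreal (area_density \<gamma> p) * indicator {p. graph_point T \<gamma> p \<in> A} p \<partial>lborel))"

section \<open>The Sobolev space \<open>W\<^sup>1\<^sup>,\<^sup>2\<close> and traces\<close>

definition L2 :: "'a measure \<Rightarrow> ('a \<Rightarrow> 'b::euclidean_space) \<Rightarrow> bool" where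
  "L2 M f \<longleftrightarrow> f \<in> borel_measurable M \<and> integrable M (\<lambda>x. (norm (f x))\<^sup>2)"

definition L2_tendsto ::
    "'a measure \<Rightarrow> (nat \<Rightarrow> 'a \<Rightarrow> 'b::euclidean_space) \<Rightarrow> ('a \<Rightarrow> 'b) \<Rightarrow> bool" where
  "L2_tendsto M f g \<longleftrightarrow> (\<forall>k. L2 M (f k)) \<and> L2 M g \<and>
     (\<lambda>k. \<integral>x. (norm (f k x - g x))\<^sup>2 \<partial>M) \<longlonglongrightarrow> 0"

definition test_function :: "(real^3) set \<Rightarrow> (real^3 \<Rightarrow> real) \<Rightarrow> bool" where
  "test_function \<Omega> \<phi> \<longleftrightarrow> (\<forall>k. C_k k \<phi>) \<and>
     compact (closure {x. \<phi> x \<noteq> 0}) \<and> closure {x. \<phi> x \<noteq> 0} \<subseteq> \<Omega>"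

text \<open>\<open>u \<in> W\<^sup>1\<^sup>,\<^sup>2(\<Omega>; \<real>\<^sup>3)\<close>, with weak gradient \<open>G\<close> (unique up to null sets),
  where \<open>G $ i $ j\<close> is the weak derivative of \<open>u\<^sub>i\<close> in direction \<open>j\<close>.\<close>

definition sobolev_W12 :: "(real^3) set \<Rightarrow> (real^3 \<Rightarrow> real^3) \<Rightarrow> (real^3 \<Rightarrow> real^3^3) \<Rightarrow> bool" where
  "sobolev_W12 \<Omega> u G \<longleftrightarrow> L2 (lebesgue_on \<Omega>) u \<and> L2 (lebesgue_on \<Omega>) G \<and>
     (\<forall>\<phi> i j. test_function \<Omega> \<phi> \<longrightarrow>
        (\<integral>x. u x $ i * frechet_derivative \<phi> (at x) (axis j 1) \<partial>lebesgue_on \<Omega>) =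
        - (\<integral>x. G x $ i $ j * \<phi> x \<partial>lebesgue_on \<Omega>))"

text \<open>The trace operator is the continuous extension of the restriction map
  \<open>\<phi> \<mapsto> \<phi>|\<^bsub>\<partial>\<Omega>\<^esub>\<close> from \<open>C\<^sup>1\<close> functions to \<open>W\<^sup>1\<^sup>,\<^sup>2(\<Omega>) \<rightarrow> L\<^sup>2(\<partial>\<Omega>, S)\<close>: the function \<open>u\<close>
  (with weak gradient \<open>G\<close>) has trace \<open>g\<close> iff some \<open>C\<^sup>1\<close> functions converge to \<open>u\<close>
  in \<open>W\<^sup>1\<^sup>,\<^sup>2(\<Omega>)\<close> while their boundary values converge to \<open>g\<close> in \<open>L\<^sup>2(\<partial>\<Omega>, S)\<close>.\<close>

definition has_trace :: "(real^3) set \<Rightarrow> (real^3) measure \<Rightarrow>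
    (real^3 \<Rightarrow> real^3) \<Rightarrow> (real^3 \<Rightarrow> real^3^3) \<Rightarrow> (real^3 \<Rightarrow> real^3) \<Rightarrow> bool" where
  "has_trace \<Omega> S u G g \<longleftrightarrow>
     (\<exists>\<phi> :: nat \<Rightarrow> real^3 \<Rightarrow> real^3. (\<forall>k. C_k 1 (\<phi> k)) \<and>
        L2_tendsto (lebesgue_on \<Omega>) \<phi> u \<and>
        L2_tendsto (lebesgue_on \<Omega>) (\<lambda>k x. jacobian (\<phi> k) (at x)) G \<and>
        L2_tendsto S \<phi> g)"

section \<open>The quadratic form and the special fields\<close>

definition Q :: "real^3^3 \<Rightarrow> real" where
  "Q \<xi> = (\<xi>$1$1)\<^sup>2 + (\<xi>$2$2)\<^sup>2 + (\<xi>$3$3)\<^sup>2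
        - 2 * \<xi>$1$1 * \<xi>$2$2 - 2 * \<xi>$2$2 * \<xi>$3$3 - 2 * \<xi>$3$3 * \<xi>$1$1
        + (\<xi>$1$2)\<^sup>2 + (\<xi>$2$3)\<^sup>2 + (\<xi>$3$1)\<^sup>2"

definition u_special :: "(real \<Rightarrow> real) \<Rightarrow> (real \<Rightarrow> real) \<Rightarrow> (real \<Rightarrow> real) \<Rightarrow> (real \<Rightarrow> real) \<Rightarrow>
    real^3 \<Rightarrow> real^3" where
  "u_special v0 v1 v2 v3 x =
     (let a0 = v0 (x$1 + x$2 + x$3); a1 = v1 (- x$1 + x$2 + x$3);
          a2 = v2 (x$1 - x$2 + x$3); a3 = v3 (x$1 + x$2 - x$3)
      in vector [a0 - a1 + a2 + a3, a0 + a1 - a2 + a3, a0 + a1 + a2 - a3])"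

definition J_special :: "(real \<Rightarrow> real) \<Rightarrow> (real \<Rightarrow> real) \<Rightarrow> (real \<Rightarrow> real) \<Rightarrow> (real \<Rightarrow> real) \<Rightarrow>
    real^3 \<Rightarrow> real^3^3" where
  "J_special v0 v1 v2 v3 x =
     (let d0 = deriv v0 (x$1 + x$2 + x$3); d1 = deriv v1 (- x$1 + x$2 + x$3);
          d2 = deriv v2 (x$1 - x$2 + x$3); d3 = deriv v3 (x$1 + x$2 - x$3)
      in vector [vector [- d0 - d1 - d2 - d3, d0 - d1 - d2 + d3, 0],
                 vector [0, - d0 - d1 - d2 - d3, d0 + d1 - d2 - d3],
                 vector [d0 - d1 + d2 - d3, 0, - d0 - d1 - d2 - d3]])"

end

(* Let u0 be the special field and G = grad u0 + H the gradient of a competitor.  J is half the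
   derivative of Q at grad u0, so Q(G) = J:grad u0 + 2 J:H + Q(H).  Each wave v_l(a_l . x)
   contributes to J a term v_l'(a_l . x) M_l with constant M_l satisfying M_l a_l = 0, so J is
   divergence free and the integral of J:G depends only on the trace of u.  It remains to see that
   the integral of Q(H) is nonnegative when the trace vanishes.  The form Q is nonnegative
   on rank-one matrices, and integration by parts shows that the Fourier coefficients of H have
   rank one.  Averaging Q(H^(k)) over Gaussian frequencies k gives the pairing of H with
   its Gaussian smoothing, which tends to the integral of Q(H). *)

theory Submission
  imports Defs "HOL-Probability.Characteristic_Functions"
begin

subsection \<open>Functions of class \<open>C\<^sup>1\<close> with a gradient field\<close>

text \<open>\<open>Q\<close> is -3 at the identity, so no pointwise bound on Q(H) can work; it is
  nonnegative on rank-one matrices, and gradients become rank one only frequency by frequency. The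
  waves sit at zeros of \<open>Q\<close> on this cone. The four directions a_l have entries 1 and
  -1, the wave v_l(a_l . x) has gradient v_l' a_l \<otimes> a_l, and Q(a_l \<otimes> a_l) = 3 - 6 +
  3 = 0. As the map from b to Q(b \<otimes> a_l) is nonnegative and vanishes at b = a_l, its
  derivative vanishes there too; this is M_l a_l = 0. The other obstacle is regularity. The v_l' are
  merely continuous, so \<open>J\<close> cannot be differentiated; the boundary is only C1, so
  straightening it must not cost a derivative; and a trace is known only through C1 approximations.
  Every statement about u is therefore obtained from the divergence theorem for products of C1
  functions and a limit in L2. The functions cos(k . x) and sin(k . x) are admissible multipliers,
  so a vanishing trace yields the rank-one structure directly from integrals over the bounded
  set.\<close>

definition C1_gradient :: "('a::euclidean_space \<Rightarrow> real) \<Rightarrow> ('a \<Rightarrow> 'a) \<Rightarrow> bool" where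
  "C1_gradient f g \<longleftrightarrow> (\<forall>x. (f has_derivative (\<lambda>h. g x \<bullet> h)) (at x)) \<and> continuous_on UNIV g"

lemma C1_gradient_has_derivative:
  "C1_gradient f g \<Longrightarrow> (f has_derivative (\<lambda>h. g x \<bullet> h)) (at x within A)"
  by (simp add: C1_gradient_def has_derivative_at_withinI)

lemma C1_gradient_continuous:
  assumes "C1_gradient f g"
  shows "continuous_on A f" "continuous_on A g"
proof -
  show "continuous_on A f"
    using C1_gradient_has_derivative[OF assms] by (intro has_derivative_continuous_on) auto
  show "continuous_on A g"
    using assms continuous_on_subset unfolding C1_gradient_def by auto
qed

lemma C1_gradient_mult:
  assumes "C1_gradient f f'" "C1_gradient g g'"
  shows "C1_gradient (\<lambda>x. f x * g x) (\<lambda>x. f x *\<^sub>R g' x + g x *\<^sub>R f' x)"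
  unfolding C1_gradient_def
proof (intro conjI allI)
  show "continuous_on UNIV (\<lambda>x. f x *\<^sub>R g' x + g x *\<^sub>R f' x)"
    by (intro continuous_intros C1_gradient_continuous[OF assms(1)] C1_gradient_continuous[OF assms(2)])
  fix x
  show "((\<lambda>x. f x * g x) has_derivative (\<lambda>h. (f x *\<^sub>R g' x + g x *\<^sub>R f' x) \<bullet> h)) (at x)"
    by (rule has_derivative_eq_rhs[OF has_derivative_mult
          [OF C1_gradient_has_derivative[OF assms(1)] C1_gradient_has_derivative[OF assms(2)]]])
       (simp add: fun_eq_iff inner_simps)
qed

lemma C1_gradient_diff:
  assumes "C1_gradient f f'" "C1_gradient g g'"
  shows "C1_gradient (\<lambda>x. f x - g x) (\<lambda>x. f' x - g' x)"
  using assms unfolding C1_gradient_def inner_diff_left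
  by (auto intro!: continuous_intros has_derivative_diff)

lemma C1_gradient_add:
  assumes "C1_gradient f f'" "C1_gradient g g'"
  shows "C1_gradient (\<lambda>x. f x + g x) (\<lambda>x. f' x + g' x)"
  using assms unfolding C1_gradient_def inner_add_left
  by (auto intro!: continuous_intros has_derivative_add)

lemma C1_gradient_const: "C1_gradient (\<lambda>x. c) (\<lambda>x. 0)"
  by (simp add: C1_gradient_def inner_zero_left[abs_def])

lemma C1_gradient_inner: "C1_gradient (\<lambda>x. a \<bullet> x) (\<lambda>x. a)"
  unfolding C1_gradient_def by (auto intro!: derivative_eq_intros)

lemma C1_gradient_compose:
  assumes f: "C1_gradient f f'" and h: "\<And>t. (h has_real_derivative h' t) (at t)"
    and h': "continuous_on UNIV h'"
  shows "C1_gradient (\<lambda>x. h (f x)) (\<lambda>x. h' (f x) *\<^sub>R f' x)"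
  unfolding C1_gradient_def
proof (intro conjI allI)
  show "continuous_on UNIV (\<lambda>x. h' (f x) *\<^sub>R f' x)"
    by (intro continuous_intros C1_gradient_continuous[OF f] continuous_on_compose2[OF h']) auto
  fix x
  have "(h has_derivative (*) (h' (f x))) (at (f x))"
    using h by (simp add: has_field_derivative_def)
  from has_derivative_compose[OF C1_gradient_has_derivative[OF f] this]
  show "((\<lambda>x. h (f x)) has_derivative (\<lambda>ha. (h' (f x) *\<^sub>R f' x) \<bullet> ha)) (at x)"
    by simp
qed

lemma C1_gradient_linear_compose:
  fixes T :: "'a::euclidean_space \<Rightarrow> 'a"
  assumes f: "C1_gradient f g" and T: "linear T"
  shows "C1_gradient (\<lambda>x. f (T x)) (\<lambda>x. adjoint T (g (T x)))"
proof -
  have cT: "continuous_on UNIV T" "(T has_derivative T) (at x)" for x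
    using T by (simp_all add: linear_continuous_on linear_conv_bounded_linear bounded_linear_imp_has_derivative)
  have cA: "continuous_on UNIV (adjoint T)"
    using adjoint_linear[OF T] linear_continuous_on linear_conv_bounded_linear by blast
  show ?thesis
    unfolding C1_gradient_def
  proof (intro conjI allI)
    show "continuous_on UNIV (\<lambda>x. adjoint T (g (T x)))"
      by (intro continuous_on_compose2[OF cA] continuous_on_compose2[OF C1_gradient_continuous(2)[OF f]] cT(1)) auto
    fix x
    show "((\<lambda>x. f (T x)) has_derivative (\<lambda>h. adjoint T (g (T x)) \<bullet> h)) (at x)"
      using has_derivative_compose[OF cT(2) C1_gradient_has_derivative[OF f]] 
      by (simp add: adjoint_works[OF T] adjoint_adjoint inner_commute T)
  qed
qed

lemma C_k_1_iff: "C_k 1 f \<longleftrightarrow> (\<forall>x. f differentiable (at x)) \<and>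
     (\<forall>h. continuous_on UNIV (\<lambda>x. frechet_derivative f (at x) h))"
  by simp

lemma C1_gradient_of_C_k:
  fixes f :: "'a::euclidean_space \<Rightarrow> real"
  assumes "C_k 1 f"
  shows "C1_gradient f (\<lambda>x. \<Sum>b\<in>Basis. frechet_derivative f (at x) b *\<^sub>R b)"
  unfolding C1_gradient_def
proof (intro conjI allI)
  show "continuous_on UNIV (\<lambda>x. \<Sum>b\<in>Basis. frechet_derivative f (at x) b *\<^sub>R b)"
    using assms unfolding C_k_1_iff by (intro continuous_intros) auto
  fix x
  have d: "(f has_derivative frechet_derivative f (at x)) (at x)"
    using assms unfolding C_k_1_iff by (simp add: frechet_derivative_works)
  moreover have "frechet_derivative f (at x) = (\<lambda>h. (\<Sum>b\<in>Basis. frechet_derivative f (at x) b *\<^sub>R b) \<bullet> h)"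
  proof
    fix h
    interpret bounded_linear "frechet_derivative f (at x)" using d by (rule has_derivative_bounded_linear)
    have "frechet_derivative f (at x) h = frechet_derivative f (at x) (\<Sum>b\<in>Basis. (h \<bullet> b) *\<^sub>R b)"
      by (simp add: euclidean_representation)
    then show "frechet_derivative f (at x) h = (\<Sum>b\<in>Basis. frechet_derivative f (at x) b *\<^sub>R b) \<bullet> h"
      by (simp add: sum scaleR inner_sum_right inner_commute[of _ h] mult.commute)
  qed
  ultimately show "(f has_derivative (\<lambda>h. (\<Sum>b\<in>Basis. frechet_derivative f (at x) b *\<^sub>R b) \<bullet> h)) (at x)"
    by simp
qed

lemma C1_gradient_component:
  fixes \<phi> :: "real^3 \<Rightarrow> real^3"
  assumes "C_k 1 \<phi>"
  shows "C1_gradient (\<lambda>x. \<phi> x $ i) (\<lambda>x. jacobian \<phi> (at x) $ i)"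
  unfolding C1_gradient_def
proof (intro conjI allI)
  have c: "continuous_on UNIV (\<lambda>x. frechet_derivative \<phi> (at x) h)" for h
    using assms unfolding C_k_1_iff by auto
  have "continuous_on UNIV (\<lambda>x. \<chi> j. frechet_derivative \<phi> (at x) (axis j 1) $ i)"
    by (intro continuous_intros c)
  then show "continuous_on UNIV (\<lambda>x. jacobian \<phi> (at x) $ i)"
    by (simp add: jacobian_def matrix_def cong: continuous_on_cong)
  fix x
  have "(\<phi> has_derivative (*v) (jacobian \<phi> (at x))) (at x)"
    using assms jacobian_works unfolding C_k_1_iff by blast
  then have "((\<lambda>x. \<phi> x $ i) has_derivative (\<lambda>h. (jacobian \<phi> (at x) *v h) $ i)) (at x)"
    by (rule bounded_linear.has_derivative[OF bounded_linear_vec_nth])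
  then show "((\<lambda>x. \<phi> x $ i) has_derivative (\<bullet>) (jacobian \<phi> (at x) $ i)) (at x)"
    by (simp add: matrix_vector_mult_def inner_vec_def[abs_def])
qed

subsection \<open>Lebesgue measure on \<open>\<real>\<^sup>3\<close>\<close>

text \<open>The nesting makes the first two coordinates one factor, so that Fubini splits space into
  the parameter plane of a graph and the vertical lines over it.\<close>

definition tri :: "(real \<times> real) \<times> real \<Rightarrow> real^3" where
  "tri y = vector [fst (fst y), snd (fst y), snd y]"

lemma tri_nth [simp]: "tri y $ 1 = fst (fst y)" "tri y $ 2 = snd (fst y)" "tri y $ 3 = snd y"
  by (simp_all add: tri_def vector_3)

lemma continuous_on_vector3 [continuous_intros]:
  fixes f g h :: "'a::topological_space \<Rightarrow> 'b::real_normed_vector"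
  assumes "continuous_on A f" "continuous_on A g" "continuous_on A h"
  shows "continuous_on A (\<lambda>x. vector [f x, g x, h x] :: 'b^3)"
proof -
  have *: "(\<lambda>x. vector [f x, g x, h x] :: 'b^3) = (\<lambda>x. \<chi> i. if i = 1 then f x else if i = 2 then g x else h x)"
    by (auto simp: fun_eq_iff vec_eq_iff forall_3 vector_3)
  have "continuous_on A (\<lambda>x. if i = (1::3) then f x else if i = 2 then g x else h x)" for i
    using assms by (cases "i = 1"; cases "i = 2") auto
  then show ?thesis
    by (subst *) (rule continuous_on_vec_lambda)
qed

lemma continuous_on_tri: "continuous_on A tri"
  unfolding tri_def by (intro continuous_intros)

lemma measurable_tri [measurable]: "tri \<in> borel_measurable borel"
  by (rule borel_measurable_continuous_onI[OF continuous_on_tri])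

lemma box_tri: "tri -` box l u = box ((l$1, l$2), l$3) ((u$1, u$2), u$3)"
  by (auto simp: mem_box_cart forall_3 mem_box Basis_prod_def)

text \<open>The preimage of a box under \<open>tri\<close> is a box with the same side lengths, and
  boxes determine Lebesgue measure. This opens integrals over \<open>real^3\<close> to
  Fubini.\<close>

lemma lborel_tri: "(lborel :: (real^3) measure) = distr lborel borel tri"
proof (rule lborel_eqI)
  fix l u :: "real^3"
  assume le: "\<And>b. b \<in> Basis \<Longrightarrow> l \<bullet> b \<le> u \<bullet> b"
  have le': "l $ i \<le> u $ i" for i
    using le[of "axis i 1"] by (simp add: inner_axis axis_in_Basis_iff)
  have B1: "(Basis :: ((real \<times> real) \<times> real) set) = {((1, 0), 0), ((0, 1), 0), ((0, 0), 1)}"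
    by (simp add: Basis_prod_def zero_prod_def insert_commute)
  have B2: "(\<Prod>b\<in>Basis. f b) = f (axis 1 1) * f (axis 2 1) * f (axis 3 1)" for f :: "real^3 \<Rightarrow> real"
  proof -
    have B: "(Basis :: (real^3) set) = (\<lambda>i. axis i 1) ` UNIV"
      by (auto simp: Basis_vec_def)
    have "(\<Prod>b\<in>Basis. f b) = (\<Prod>i\<in>UNIV. f (axis i 1))"
      unfolding B by (subst prod.reindex) (auto intro!: injI simp: axis_eq_axis)
    also have "\<dots> = f (axis 1 1) * f (axis 2 1) * f (axis 3 1)"
      unfolding UNIV_3 by simp
    finally show ?thesis .
  qed
  have "emeasure (distr lborel borel tri) (box l u) = emeasure lborel (box ((l$1, l$2), l$3) ((u$1, u$2), u$3))"
    by (subst emeasure_distr) (simp_all add: box_tri)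
  also have "\<dots> = ennreal (\<Prod>b\<in>Basis. (((u$1, u$2), u$3) - ((l$1, l$2), l$3)) \<bullet> b)"
    by (rule emeasure_lborel_box) (use le' in \<open>auto simp: B1\<close>)
  also have "(\<Prod>b\<in>Basis. (((u$1, u$2), u$3) - ((l$1, l$2), l$3)) \<bullet> b) = (u$1 - l$1) * (u$2 - l$2) * (u$3 - l$3)"
    by (simp add: B1)
  also have "\<dots> = (\<Prod>b\<in>Basis. (u - l) \<bullet> b)"
    by (simp add: B2 inner_axis)
  finally show "emeasure (distr lborel borel tri) (box l u) = (\<Prod>b\<in>Basis. (u - l) \<bullet> b)" .
qed simp

lemma lborel_orthogonal:
  fixes T :: "real^3 \<Rightarrow> real^3"
  assumes T: "orthogonal_transformation T"
  shows "distr lborel borel T = lborel"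
proof (rule lborel_eqI[symmetric])
  have lT: "linear T" and iT: "orthogonal_transformation (inv T)" and bT: "bij T"
    using T by (auto simp: orthogonal_transformation_linear orthogonal_transformation_inv orthogonal_transformation_bij)
  have [measurable]: "T \<in> borel_measurable borel"
    using lT by (intro borel_measurable_continuous_onI linear_continuous_on) (simp add: linear_conv_bounded_linear)
  fix l u :: "real^3"
  assume le: "\<And>b. b \<in> Basis \<Longrightarrow> l \<bullet> b \<le> u \<bullet> b"
  have "emeasure (distr lborel borel T) (box l u) = emeasure lborel (T -` box l u)"
    by (subst emeasure_distr) auto
  also have "T -` box l u = inv T ` box l u"
    using bT by (simp add: bij_vimage_eq_inv_image)
  also have "emeasure lborel \<dots> = emeasure lebesgue (inv T ` box l u)"
  proof -
    have "T -` box l u \<inter> space borel \<in> sets borel" by (rule measurable_sets[of T borel borel]) auto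
    then have "inv T ` box l u \<in> sets borel"
      using bT by (simp add: bij_vimage_eq_inv_image)
    then show ?thesis by simp
  qed
  also have "\<dots> = emeasure lebesgue (box l u)"
    using measurable_orthogonal_image[OF iT, of "box l u"] measure_orthogonal_image[OF iT, of "box l u"]
    by (metis emeasure_eq_measure2 lmeasurable_box)
  also have "\<dots> = (\<Prod>b\<in>Basis. (u - l) \<bullet> b)"
    using le by (simp add: emeasure_lborel_box_eq)
  finally show "emeasure (distr lborel borel T) (box l u) = (\<Prod>b\<in>Basis. (u - l) \<bullet> b)" .
qed simp

section \<open>Integrals of derivatives with bounded support, up to the region above a graph\<close>

lemma C1_gradient_eq_0:
  assumes "C1_gradient f g" "open U" "x \<in> U" "\<And>y. y \<in> U \<Longrightarrow> f y = 0"
  shows "g x = 0"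
proof -
  have "(f has_derivative (\<lambda>h. 0)) (at x)"
    by (rule has_derivative_transform_within_open[OF _ assms(2,3), of "\<lambda>_. 0"]) (use assms(4) in auto)
  with C1_gradient_has_derivative[OF assms(1)] have "(\<lambda>h. g x \<bullet> h) = (\<lambda>h. 0)"
    by (rule has_derivative_unique)
  then show ?thesis
    by (metis inner_eq_zero_iff)
qed

lemma integral_derivative_compact_support:
  fixes F f :: "real \<Rightarrow> real"
  assumes F: "\<And>t. (F has_real_derivative f t) (at t)" and f: "continuous_on UNIV f"
    and R: "\<And>t. R < \<bar>t\<bar> \<Longrightarrow> F t = 0" "\<And>t. R < \<bar>t\<bar> \<Longrightarrow> f t = 0"
  shows "(\<integral>t. f t \<partial>lborel) = 0"
    and "(\<integral>t. indicator {a<..} t * f t \<partial>lborel) = - F a"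
proof -
  \<comment> \<open>\<open>b\<close> lies beyond the support on both sides and to the right of
    \<open>a\<close>, so \<open>F\<close> vanishes at \<open>b\<close> and \<open>- b\<close>, and
    the integral over \<open>{a..b}\<close> is \<open>- F a\<close>.\<close>
  define b where "b = \<bar>R\<bar> + \<bar>a\<bar> + 1"
  have F0: "F b = 0" "F (-b) = 0" and f0: "f t = 0" if "\<bar>t\<bar> \<ge> b" for t
    using R(1)[of b] R(1)[of "-b"] R(2)[of t] that by (auto simp: b_def)
  have f0': "f t = 0" if "t < -b \<or> b < t" for t
    using that by (intro f0) (auto simp: b_def)
  have cf: "continuous_on A f" for A by (rule continuous_on_subset[OF f]) simp
  have 1: "(\<integral>t. indicator {c..b} t *\<^sub>R f t \<partial>lborel) = F b - F c" if "c \<le> b" for c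
    using that F cf
    by (intro integral_FTC_Icc) (auto simp: has_real_derivative_iff_has_vector_derivative[symmetric] 
         intro: has_field_derivative_at_within)
  have "(\<integral>t. f t \<partial>lborel) = (\<integral>t. indicator {-b..b} t *\<^sub>R f t \<partial>lborel)"
    by (intro Bochner_Integration.integral_cong refl) (use f0' in \<open>force simp: indicator_def\<close>)
  also have "\<dots> = 0" using 1[of "-b"] F0[of b] by (auto simp: b_def)
  finally show "(\<integral>t. f t \<partial>lborel) = 0" .
  have [measurable]: "f \<in> borel_measurable borel"
    by (rule borel_measurable_continuous_onI[OF f])
  have "(\<integral>t. indicator {a<..} t * f t \<partial>lborel) = (\<integral>t. indicator {a..b} t *\<^sub>R f t \<partial>lborel)"
  proof (intro integral_cong_AE)
    show "AE x in lborel. indicator {a<..} x * f x = indicator {a..b} x *\<^sub>R f x"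
      using AE_lborel_singleton[of a] by eventually_elim (use f0' in \<open>force simp: indicator_def\<close>)
  qed auto
  also have "\<dots> = - F a" using 1[of a] F0[of b] by (auto simp: b_def)
  finally show "(\<integral>t. indicator {a<..} t * f t \<partial>lborel) = - F a" .
qed

lemma integrable_continuous_bounded_support:
  fixes k :: "'a::euclidean_space \<Rightarrow> real"
  assumes k: "continuous_on UNIV k" and R: "\<And>x. R < norm x \<Longrightarrow> k x = 0" and A: "A \<in> sets borel"
  shows "integrable lborel (\<lambda>x. indicator A x * k x)"
proof -
  have "integrable lborel (\<lambda>x. indicator (cball 0 R) x *\<^sub>R k x)"
    by (rule borel_integrable_compact) (auto intro: continuous_on_subset[OF k])
  then have "integrable lborel (\<lambda>x. indicator A x *\<^sub>R (indicator (cball 0 R) x *\<^sub>R k x))"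
    by (rule integrable_mult_indicator[rotated]) (use A in simp)
  moreover have "(\<lambda>x. indicator A x *\<^sub>R (indicator (cball 0 R) x *\<^sub>R k x)) = (\<lambda>x. indicator A x * k x)"
    using R by (auto simp: indicator_def fun_eq_iff)
  ultimately show ?thesis by simp
qed

lemmas integrable_continuous_bounded_support' =
  integrable_continuous_bounded_support[where A = UNIV, simplified]

text \<open>Each partial derivative is integrated first along its own direction, where the
  one-dimensional result gives 0; a general \<open>d\<close> follows by linearity.\<close>

lemma integral_gradient_plane:
  fixes h :: "real \<times> real \<Rightarrow> real"
  assumes h: "C1_gradient h h'" and R: "\<And>p. R < norm p \<Longrightarrow> h p = 0"
  shows "(\<integral>p. h' p \<bullet> d \<partial>lborel) = 0"
proof -
  have h'0: "h' p = 0" if "R < norm p" for p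
    by (rule C1_gradient_eq_0[OF h, of "{p. R < norm p}"])
       (use that R in \<open>auto intro: open_Collect_less continuous_intros\<close>)
  have c: "continuous_on A h'" for A by (rule C1_gradient_continuous[OF h])
  have i: "integrable (lborel \<Otimes>\<^sub>M lborel) (\<lambda>p. h' p \<bullet> e)" for e
    unfolding lborel_prod
    by (rule integrable_continuous_bounded_support'[of _ R]) (auto intro!: continuous_intros c simp: h'0)
  have n1: "\<bar>x\<bar> \<le> norm (x, y)" and n2: "\<bar>y\<bar> \<le> norm (x, y)" for x y :: real
    using norm_fst_le[of x y] norm_snd_le[of y x] by auto
  have d1: "((\<lambda>x. h (x, y)) has_real_derivative h' (x, y) \<bullet> (1, 0)) (at x)" for x y
    using has_derivative_compose[OF _ C1_gradient_has_derivative[OF h], of "\<lambda>x. (x, y)" "\<lambda>t. (t, 0)" x UNIV]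
    by (simp add: has_field_derivative_def inner_prod_def has_derivative_Pair has_derivative_ident mult_commute_abs)
  have d2: "((\<lambda>y. h (x, y)) has_real_derivative h' (x, y) \<bullet> (0, 1)) (at y)" for x y
    using has_derivative_compose[OF _ C1_gradient_has_derivative[OF h], of "\<lambda>y. (x, y)" "\<lambda>t. (0, t)" y UNIV]
    by (simp add: has_field_derivative_def inner_prod_def has_derivative_Pair has_derivative_ident mult_commute_abs)
  have "(\<integral>p. h' p \<bullet> (0, 1) \<partial>lborel) = (\<integral>x. (\<integral>y. h' (x, y) \<bullet> (0, 1) \<partial>lborel) \<partial>lborel)"
    using lborel_pair.integral_fst'[OF i] by (simp add: lborel_prod)
  also have "(\<lambda>x. (\<integral>y. h' (x, y) \<bullet> (0, 1) \<partial>lborel)) = (\<lambda>x. 0)"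
  proof
    fix x show "(\<integral>y. h' (x, y) \<bullet> (0, 1) \<partial>lborel) = 0"
      by (rule integral_derivative_compact_support(1)[OF d2, where R = R])
         (auto intro!: continuous_intros continuous_on_compose2[OF c[of UNIV]] simp: h'0 R less_le_trans[OF _ n2])
  qed
  finally have z2: "(\<integral>p. h' p \<bullet> (0, 1) \<partial>lborel) = 0" by simp
  have "(\<integral>p. h' p \<bullet> (1, 0) \<partial>lborel) = (\<integral>y. (\<integral>x. h' (x, y) \<bullet> (1, 0) \<partial>lborel) \<partial>lborel)"
    using lborel_pair.integral_snd[of "\<lambda>x y. h' (x, y) \<bullet> (1, 0)"] i[of "(1,0)"] by (simp add: lborel_prod case_prod_beta')
  also have "(\<lambda>y. (\<integral>x. h' (x, y) \<bullet> (1, 0) \<partial>lborel)) = (\<lambda>x. 0)"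
  proof
    fix y show "(\<integral>x. h' (x, y) \<bullet> (1, 0) \<partial>lborel) = 0"
      by (rule integral_derivative_compact_support(1)[OF d1, where R = R])
         (auto intro!: continuous_intros continuous_on_compose2[OF c[of UNIV]] simp: h'0 R less_le_trans[OF _ n1])
  qed
  finally have z1: "(\<integral>p. h' p \<bullet> (1, 0) \<partial>lborel) = 0" by simp
  have "(\<integral>p. h' p \<bullet> d \<partial>lborel) = (\<integral>p. fst d * (h' p \<bullet> (1, 0)) + snd d * (h' p \<bullet> (0, 1)) \<partial>lborel)"
    by (intro Bochner_Integration.integral_cong) (auto simp: inner_prod_def)
  also have "\<dots> = 0"
    using i[of "(0,1)"] i[of "(1,0)"] by (simp add: z1 z2 lborel_prod)
  finally show ?thesis .
qed

lemma norm_le_tri: "norm y \<le> 3 * norm (tri y)"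
proof -
  have "norm y \<le> norm (fst y) + norm (snd y)" by (metis norm_Pair_le prod.collapse)
  also have "norm (fst y) \<le> norm (fst (fst y)) + norm (snd (fst y))" by (metis norm_Pair_le prod.collapse)
  finally show ?thesis
    using component_le_norm_cart[of "tri y" 1] component_le_norm_cart[of "tri y" 2] component_le_norm_cart[of "tri y" 3]
    by simp
qed

lemma bounded_linear_tri: "bounded_linear tri"
  by (auto simp: linear_conv_bounded_linear[symmetric] linear_iff vec_eq_iff forall_3)

lemma inner_tri: "a \<bullet> tri y = a$1 * fst (fst y) + a$2 * snd (fst y) + a$3 * snd y"
  by (simp add: inner_vec_def sum_3)

text \<open>The shear \<open>(p, t) \<mapsto> (p, \<gamma> p + t)\<close> maps the half-space \<open>t > 0\<close> onto the region above
  the graph and preserves volume, so \<open>\<gamma>\<close> need only be \<open>C\<^sup>1\<close>.\<close>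

lemma divergence_above_graph:
  fixes f :: "real^3 \<Rightarrow> real"
  assumes f: "C1_gradient f g" and R: "\<And>y. R < norm y \<Longrightarrow> f y = 0" and \<gamma>: "C1_gradient \<gamma> \<gamma>'"
  shows "(\<integral>y. indicator {y. \<gamma> (y$1, y$2) < y$3} y * (g y \<bullet> e) \<partial>lborel) =
         (\<integral>p. f (tri (p, \<gamma> p)) * (tri (\<gamma>' p, -1) \<bullet> e) \<partial>lborel)"
proof -
  have g0: "g y = 0" if "R < norm y" for y
    by (rule C1_gradient_eq_0[OF f, of "{y. R < norm y}"])
       (use that R in \<open>auto intro: open_Collect_less continuous_intros\<close>)
  have cg: "continuous_on A g" and cf: "continuous_on A f" for A by (rule C1_gradient_continuous[OF f])+
  have c\<gamma>: "continuous_on A \<gamma>" and c\<gamma>': "continuous_on A \<gamma>'" for A by (rule C1_gradient_continuous[OF \<gamma>])+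
  obtain C where C: "\<And>p. norm p \<le> 3 * R \<Longrightarrow> \<bar>\<gamma> p\<bar> \<le> C"
  proof -
    have "bounded (\<gamma> ` cball 0 (3 * R))"
      by (intro compact_imp_bounded compact_continuous_image c\<gamma>) auto
    then obtain C where "\<forall>x\<in>cball 0 (3 * R). \<bar>\<gamma> x\<bar> \<le> C" by (auto simp: bounded_iff)
    then show ?thesis by (intro that[of C]) simp
  qed
  define a where "a = (\<lambda>(p, t). g (tri (p, \<gamma> p + t)))"
  define c where "c p = tri (\<gamma>' p, -1) \<bullet> e" for p
  \<comment> \<open>If the sheared point has norm at most \<open>R\<close>, then
    \<open>norm_le_tri\<close> bounds \<open>norm p\<close> and \<open>norm (\<gamma> p + t)\<close>
    by \<open>3 * R\<close>; hence \<open>norm t\<close> is at most \<open>3 * R + C\<close> and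
    \<open>norm (p, t)\<close> at most \<open>6 * R + C\<close>.\<close>
  define R2 where "R2 = 6 * R + C"
  have big: "R < norm (tri (p, \<gamma> p + t))" if "R2 < norm (p, t)" for p t
  proof (rule ccontr)
    assume "\<not> ?thesis"
    then have "norm (p, \<gamma> p + t) \<le> 3 * R" using norm_le_tri[of "(p, \<gamma> p + t)"] by auto
    then have "norm p \<le> 3 * R" "norm (\<gamma> p + t) \<le> 3 * R"
      using norm_fst_le[of p "\<gamma> p + t"] norm_snd_le[of "\<gamma> p + t" p] by auto
    then show False using C[of p] that norm_Pair_le[of p t] by (auto simp: R2_def)
  qed
  have a0: "a y = 0" if "R2 < norm y" for y
    using g0[OF big] that by (cases y) (auto simp: a_def)
  have ca: "continuous_on A a" for A
    unfolding a_def case_prod_beta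
    by (intro continuous_on_compose2[OF cg[of UNIV]] continuous_on_compose2[OF continuous_on_tri[of UNIV]]
        continuous_intros continuous_on_compose2[OF c\<gamma>[of UNIV]]) auto
  have cc: "continuous_on A c" for A
    unfolding c_def
    by (intro continuous_on_compose2[OF continuous_on_tri[of UNIV]] continuous_intros c\<gamma>') auto
  \<comment> \<open>\<open>e\<close> is split into the tangent vector of the graph over
    \<open>(e$1, e$2)\<close> and a vertical remainder with factor \<open>- c p\<close>. For fixed
    \<open>t\<close>, \<open>b\<close> is a directional derivative in \<open>p\<close> of
    \<open>f\<close> along the graph raised by \<open>t\<close>, so it integrates to 0 over the
    plane; the vertical part integrates in \<open>t\<close> to the value of \<open>f\<close> on the
    graph.\<close>
  define b where "b = (\<lambda>(p, t). a (p, t) \<bullet> tri ((e$1, e$2), \<gamma>' p \<bullet> (e$1, e$2)))"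
  have ae: "a (p, t) \<bullet> e = b (p, t) - c p * (a (p, t) \<bullet> tri (0, 1))" for p t
    by (simp add: b_def c_def inner_tri inner_commute[of _ e] inner_prod_def) (simp add: inner_vec_def sum_3 algebra_simps)
  have cb: "continuous_on A b" for A
    unfolding b_def case_prod_beta
    by (intro continuous_intros ca continuous_on_compose2[OF continuous_on_tri[of UNIV]]
        continuous_on_compose2[OF c\<gamma>'[of UNIV]]) (auto intro: ca)
  have b0: "b y = 0" if "R2 < norm y" for y
    using a0[OF that] by (cases y) (auto simp: b_def)
  have half [measurable]: "{y :: (real\<times>real)\<times>real. 0 < snd y} \<in> sets borel"
    by (intro borel_open open_Collect_less continuous_intros)
  have epi: "{y :: real^3. \<gamma> (y$1, y$2) < y$3} \<in> sets borel"
    by (intro borel_open open_Collect_less continuous_intros continuous_on_compose2[OF c\<gamma>[of UNIV]]) auto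
  have epi': "{y. \<gamma> (fst y) < snd y} \<in> sets borel"
    by (intro borel_open open_Collect_less continuous_intros continuous_on_compose2[OF c\<gamma>[of UNIV]]) auto
  have ib: "integrable (lborel \<Otimes>\<^sub>M lborel) (\<lambda>y. indicator {y. 0 < snd y} y * b y)"
    unfolding lborel_prod by (rule integrable_continuous_bounded_support[OF cb b0 half])
  have i3: "integrable (lborel \<Otimes>\<^sub>M lborel) (\<lambda>y. indicator {y. 0 < snd y} y * (c (fst y) * (a y \<bullet> tri (0, 1))))"
    unfolding lborel_prod
    by (rule integrable_continuous_bounded_support[of _ R2])
       (auto intro!: continuous_intros ca continuous_on_compose2[OF cc[of UNIV]] simp: a0 half)
  have [measurable]: "g \<in> borel_measurable borel" by (rule borel_measurable_continuous_onI[OF cg])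
  note epi[measurable] epi'[measurable]
  have ig: "integrable (lborel \<Otimes>\<^sub>M lborel) (\<lambda>y. indicator {y. \<gamma> (fst y) < snd y} y * (g (tri y) \<bullet> e))"
    unfolding lborel_prod
  proof (rule integrable_continuous_bounded_support[of _ "3 * R"])
    fix y :: "(real \<times> real) \<times> real" assume "3 * R < norm y"
    then show "g (tri y) \<bullet> e = 0" using g0[of "tri y"] norm_le_tri[of y] by simp
  qed (auto intro!: continuous_intros continuous_on_compose2[OF cg[of UNIV]] continuous_on_tri epi')
  have "(\<integral>y. indicator {y. \<gamma> (y$1, y$2) < y$3} y * (g y \<bullet> e) \<partial>lborel) =
        (\<integral>y. indicator {y. \<gamma> (fst y) < snd y} y * (g (tri y) \<bullet> e) \<partial>lborel)"
    by (subst lborel_tri, subst integral_distr) (simp_all, simp add: indicator_def)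
  also have "\<dots> = (\<integral>p. (\<integral>t. indicator {\<gamma> p<..} t * (g (tri (p, t)) \<bullet> e) \<partial>lborel) \<partial>lborel)"
    using lborel_pair.integral_fst'[OF ig] by (simp add: lborel_prod indicator_def)
  also have "\<dots> = (\<integral>p. (\<integral>t. indicator {0<..} t * (a (p, t) \<bullet> e) \<partial>lborel) \<partial>lborel)"
  proof (rule Bochner_Integration.integral_cong[OF refl])
    fix p
    show "(\<integral>t. indicator {\<gamma> p<..} t * (g (tri (p, t)) \<bullet> e) \<partial>lborel) = (\<integral>t. indicator {0<..} t * (a (p, t) \<bullet> e) \<partial>lborel)"
      by (subst lborel_integral_real_affine[of 1 _ "\<gamma> p"]) (auto simp: a_def indicator_def)
  qed
  also have "\<dots> = (\<integral>y. indicator {y. 0 < snd y} y * b y - indicator {y. 0 < snd y} y * (c (fst y) * (a y \<bullet> tri (0, 1))) \<partial>(lborel \<Otimes>\<^sub>M lborel))"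
    using lborel_pair.integral_fst'[OF Bochner_Integration.integrable_diff[OF ib i3]]
    by (simp add: ae indicator_def right_diff_distrib)
  also have "\<dots> = (\<integral>y. indicator {y. 0 < snd y} y * b y \<partial>(lborel \<Otimes>\<^sub>M lborel)) -
      (\<integral>y. indicator {y. 0 < snd y} y * (c (fst y) * (a y \<bullet> tri (0, 1))) \<partial>(lborel \<Otimes>\<^sub>M lborel))"
    by (rule Bochner_Integration.integral_diff[OF ib i3])
  also have "(\<integral>y. indicator {y. 0 < snd y} y * b y \<partial>(lborel \<Otimes>\<^sub>M lborel)) =
      (\<integral>t. (\<integral>p. indicator {0<..} t * b (p, t) \<partial>lborel) \<partial>lborel)"
    using lborel_pair.integral_snd[of "\<lambda>p t. indicator {y. 0 < snd y} (p, t) * b (p, t)"] ib 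
    by (simp add: case_prod_beta' indicator_def)
  also have "\<dots> = 0"
  proof -
    have "(\<integral>p. b (p, t) \<partial>lborel) = 0" for t
    proof -
      define h' where "h' p = ((a (p,t) $ 1 + a (p,t) $ 3 * fst (\<gamma>' p)), (a (p,t) $ 2 + a (p,t) $ 3 * snd (\<gamma>' p)))" for p
      have bh: "b (p, t) = h' p \<bullet> (e$1, e$2)" for p
        by (simp add: b_def h'_def inner_tri inner_prod_def algebra_simps)
      have "C1_gradient (\<lambda>p. f (tri (p, \<gamma> p + t))) h'"
        unfolding C1_gradient_def
      proof (intro conjI allI)
        show "continuous_on UNIV h'"
          unfolding h'_def by (intro continuous_intros continuous_on_compose2[OF ca[of UNIV]] c\<gamma>') auto
        fix p
        have "((\<lambda>p. tri (p, \<gamma> p + t)) has_derivative (\<lambda>h. tri (h, \<gamma>' p \<bullet> h + 0))) (at p)"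
          by (intro bounded_linear.has_derivative[OF bounded_linear_tri] has_derivative_Pair
              has_derivative_ident has_derivative_add C1_gradient_has_derivative[OF \<gamma>] has_derivative_const)
        from has_derivative_compose[OF this C1_gradient_has_derivative[OF f]]
        have "((\<lambda>p. f (tri (p, \<gamma> p + t))) has_derivative (\<lambda>h. g (tri (p, \<gamma> p + t)) \<bullet> tri (h, \<gamma>' p \<bullet> h + 0))) (at p)" .
        also have "(\<lambda>h. g (tri (p, \<gamma> p + t)) \<bullet> tri (h, \<gamma>' p \<bullet> h + 0)) = (\<bullet>) (h' p)"
          by (auto simp: fun_eq_iff h'_def inner_tri a_def inner_prod_def algebra_simps)
        finally show "((\<lambda>p. f (tri (p, \<gamma> p + t))) has_derivative (\<bullet>) (h' p)) (at p)" .
      qed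
      then have "(\<integral>p. h' p \<bullet> (e$1, e$2) \<partial>lborel) = 0"
      proof (rule integral_gradient_plane)
        fix p :: "real \<times> real" assume "R2 < norm p"
        then show "f (tri (p, \<gamma> p + t)) = 0"
          using norm_fst_le[of p t] by (intro R big) auto
      qed
      then show ?thesis by (simp add: bh)
    qed
    then show ?thesis by simp
  qed
  also have "(\<integral>y. indicator {y. 0 < snd y} y * (c (fst y) * (a y \<bullet> tri (0, 1))) \<partial>(lborel \<Otimes>\<^sub>M lborel)) =
    (\<integral>p. (\<integral>t. indicator {0<..} t * (c p * (a (p, t) \<bullet> tri (0, 1))) \<partial>lborel) \<partial>lborel)"
    using lborel_pair.integral_fst'[OF i3] by (simp add: indicator_def)
  also have "\<dots> = (\<integral>p. c p * (- f (tri (p, \<gamma> p + 0))) \<partial>lborel)"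
  proof (rule Bochner_Integration.integral_cong[OF refl])
    fix p
    have "((\<lambda>t. f (tri (p, \<gamma> p + t))) has_real_derivative (a (p, t) \<bullet> tri (0, 1))) (at t)" for t
    proof -
      have "((\<lambda>t. tri (p, \<gamma> p + t)) has_derivative (\<lambda>h. tri (0, 0 + h))) (at t)"
        by (intro bounded_linear.has_derivative[OF bounded_linear_tri] has_derivative_Pair
            has_derivative_ident has_derivative_add has_derivative_const)
      from has_derivative_compose[OF this C1_gradient_has_derivative[OF f]]
      show ?thesis by (simp add: has_field_derivative_def a_def inner_tri[abs_def])
    qed
    then have "(\<integral>t. indicator {0<..} t * (a (p, t) \<bullet> tri (0, 1)) \<partial>lborel) = - f (tri (p, \<gamma> p + 0))"
    proof (rule integral_derivative_compact_support(2)[where R = R2])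
      show "continuous_on UNIV (\<lambda>t. a (p, t) \<bullet> tri (0, 1))"
        by (intro continuous_intros continuous_on_compose2[OF ca[of UNIV]]) auto
      fix t assume *: "R2 < \<bar>t\<bar>"
      also have "\<dots> \<le> norm (p, t)" using norm_snd_le[of t p] by simp
      finally show "f (tri (p, \<gamma> p + t)) = 0" "a (p, t) \<bullet> tri (0, 1) = 0" by (auto simp: R big a0)
    qed
    moreover have "(\<lambda>t. indicator {0<..} t * (c p * (a (p, t) \<bullet> tri (0, 1)))) =
        (\<lambda>t. c p * (indicator {0<..} t * (a (p, t) \<bullet> tri (0, 1))))"
      by (simp add: fun_eq_iff)
    ultimately show "(\<integral>t. indicator {0<..} t * (c p * (a (p, t) \<bullet> tri (0, 1))) \<partial>lborel) = c p * (- f (tri (p, \<gamma> p + 0)))"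
      by simp
  qed
  finally show ?thesis by (simp add: c_def mult.commute)
qed

subsection \<open>Boundary charts\<close>

definition gradient2 :: "(real \<times> real \<Rightarrow> real) \<Rightarrow> real \<times> real \<Rightarrow> real \<times> real" where
  "gradient2 \<gamma> p = (frechet_derivative \<gamma> (at p) (1, 0), frechet_derivative \<gamma> (at p) (0, 1))"

lemma C1_gradient_gradient2:
  assumes "C_k 1 \<gamma>"
  shows "C1_gradient \<gamma> (gradient2 \<gamma>)"
proof -
  have B: "(Basis :: (real \<times> real) set) = {(1, 0), (0, 1)}"
    by (simp add: Basis_prod_def zero_prod_def insert_commute)
  have "gradient2 \<gamma> = (\<lambda>x. \<Sum>b\<in>Basis. frechet_derivative \<gamma> (at x) b *\<^sub>R b)"
    unfolding B by (simp add: gradient2_def fun_eq_iff)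
  then show ?thesis using C1_gradient_of_C_k[OF assms] by simp
qed

lemma graph_point_tri: "graph_point T \<gamma> p = T (tri (p, \<gamma> p))"
  by (simp add: graph_point_def tri_def)

lemma area_density_gradient2:
  "area_density \<gamma> p = sqrt (1 + (fst (gradient2 \<gamma> p))\<^sup>2 + (snd (gradient2 \<gamma> p))\<^sup>2)"
  by (simp add: area_density_def gradient2_def)

lemma area_density_pos: "area_density \<gamma> p > 0"
  by (simp add: area_density_gradient2 add_pos_nonneg)

locale C1_boundary_chart =
  fixes \<Omega> :: "(real^3) set" and T :: "real^3 \<Rightarrow> real^3" and \<gamma> :: "real \<times> real \<Rightarrow> real"
    and V :: "(real^3) set"
  assumes chart: "graph_chart \<Omega> T \<gamma> V" and \<Omega>: "open \<Omega>"
begin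

lemma V: "open V" and T: "orthogonal_transformation T" and linear_T: "linear T" and bij_T: "bij T"
  and orthogonal_inv: "orthogonal_transformation (inv T)"
  and \<Omega>_V: "\<Omega> \<inter> V = T ` {y. \<gamma> (y$1, y$2) < y$3} \<inter> V"
  and \<gamma>: "C1_gradient \<gamma> (gradient2 \<gamma>)"
  using chart unfolding graph_chart_def
  by (auto simp: orthogonal_transformation_linear orthogonal_transformation_inv orthogonal_transformation_bij
      intro!: C1_gradient_gradient2 simp del: C_k.simps)

lemma T_inv [simp]: "T (inv T x) = x" "inv T (T y) = y"
  using bij_T by (simp_all add: bij_is_surj surj_f_inv_f bij_is_inj)

lemma continuous_T: "continuous_on A T" and continuous_inv_T: "continuous_on A (inv T)"
  using linear_T orthogonal_transformation_linear[OF orthogonal_inv]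
  by (auto simp: linear_conv_bounded_linear linear_continuous_on)

lemma continuous_\<gamma>: "continuous_on A \<gamma>" and continuous_\<gamma>': "continuous_on A (gradient2 \<gamma>)"
  using C1_gradient_continuous[OF \<gamma>] by auto

definition proj :: "real^3 \<Rightarrow> real \<times> real" where "proj x = (inv T x $ 1, inv T x $ 2)"

lemma continuous_proj: "continuous_on A proj"
  unfolding proj_def by (intro continuous_intros continuous_inv_T)

lemma proj_graph_point [simp]: "proj (graph_point T \<gamma> p) = p"
  by (simp add: proj_def graph_point_tri)

lemma continuous_graph_point: "continuous_on A (graph_point T \<gamma>)"
  unfolding graph_point_tri
  by (intro continuous_on_compose2[OF continuous_T[of UNIV]] continuous_on_compose2[OF continuous_on_tri[of UNIV]]
      continuous_intros continuous_\<gamma>) auto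

lemma measurable_graph_point [measurable]: "graph_point T \<gamma> \<in> borel_measurable borel"
  by (rule borel_measurable_continuous_onI[OF continuous_graph_point])

lemma continuous_area_density: "continuous_on A (area_density \<gamma>)"
  unfolding area_density_gradient2 by (intro continuous_intros continuous_\<gamma>')

lemma measurable_area_density [measurable]: "area_density \<gamma> \<in> borel_measurable borel"
  by (rule borel_measurable_continuous_onI[OF continuous_area_density])

text \<open>A point of \<open>V\<close> strictly below the graph has a neighbourhood that misses
  \<Omega>, a point strictly above lies in the open set \<Omega>, and a point on the graph is a
  limit of points above it.\<close>

lemma frontier_chart_iff:
  assumes "x \<in> V"
  shows "x \<in> frontier \<Omega> \<longleftrightarrow> x = graph_point T \<gamma> (proj x)"
proof -
  have mem: "z \<in> \<Omega> \<longleftrightarrow> \<gamma> (proj z) < inv T z $ 3" if "z \<in> V" for z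
  proof -
    have "z \<in> \<Omega> \<longleftrightarrow> z \<in> T ` {y. \<gamma> (y$1, y$2) < y$3}" using \<Omega>_V that by blast
    also have "\<dots> \<longleftrightarrow> \<gamma> (proj z) < inv T z $ 3"
      unfolding proj_def by (metis (mono_tags, lifting) T_inv image_iff mem_Collect_eq)
    finally show ?thesis .
  qed
  have gp: "x = graph_point T \<gamma> (proj x) \<longleftrightarrow> inv T x $ 3 = \<gamma> (proj x)"
  proof -
    have "x = graph_point T \<gamma> (proj x) \<longleftrightarrow> inv T x = tri (proj x, \<gamma> (proj x))"
      by (metis T_inv graph_point_tri)
    then show ?thesis by (simp add: vec_eq_iff forall_3 proj_def)
  qed
  show ?thesis
  proof
    assume x: "x \<in> frontier \<Omega>"
    then have "x \<notin> \<Omega>" "x \<in> closure \<Omega>" using \<Omega> by (auto simp: frontier_def interior_open)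
    have "\<not> inv T x $ 3 < \<gamma> (proj x)"
    proof
      assume *: "inv T x $ 3 < \<gamma> (proj x)"
      define W where "W = V \<inter> {z. inv T z $ 3 < \<gamma> (proj z)}"
      have "open W"
        unfolding W_def
        by (intro open_Int V open_Collect_less continuous_intros continuous_inv_T
            continuous_on_compose2[OF continuous_\<gamma>[of UNIV] continuous_proj]) auto
      moreover have "W \<inter> \<Omega> = {}" using mem by (auto simp: W_def)
      ultimately have "W \<inter> closure \<Omega> = {}" by (simp add: open_Int_closure_eq_empty)
      then show False using \<open>x \<in> closure \<Omega>\<close> assms * by (auto simp: W_def)
    qed
    with \<open>x \<notin> \<Omega>\<close> mem[OF assms] show "x = graph_point T \<gamma> (proj x)" by (simp add: gp)
  next
    assume x: "x = graph_point T \<gamma> (proj x)"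
    have "x \<notin> \<Omega>" using mem[OF assms] x gp by simp
    moreover have "x \<in> closure \<Omega>"
    proof (rule ccontr)
      assume *: "x \<notin> closure \<Omega>"
      \<comment> \<open>\<open>h t\<close> is the graph point raised by \<open>t\<close>. For small
        positive \<open>t\<close> it would still lie in \<open>V\<close> and off
        \<open>closure \<Omega>\<close>, although it is above the graph.\<close>
      define h where "h t = T (tri (proj x, \<gamma> (proj x) + t))" for t
      have "continuous_on UNIV h"
        unfolding h_def
        by (intro continuous_on_compose2[OF continuous_T[of UNIV]] continuous_on_compose2[OF continuous_on_tri[of UNIV]]
            continuous_intros) auto
      then have "open (h -` (V - closure \<Omega>))" using V by (intro open_vimage) auto
      moreover have "0 \<in> h -` (V - closure \<Omega>)" using x assms * by (simp add: h_def graph_point_tri)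
      ultimately obtain e where "e > 0" "ball 0 e \<subseteq> h -` (V - closure \<Omega>)"
        by (meson open_contains_ball)
      then have he: "h (e/2) \<in> V - closure \<Omega>" by (auto simp: subset_iff dist_real_def)
      moreover have "h (e/2) \<in> \<Omega>"
        using he \<open>e > 0\<close> mem[of "h (e/2)"] by (simp add: h_def proj_def)
      ultimately show False using closure_subset by blast
    qed
    ultimately show "x \<in> frontier \<Omega>" using \<Omega> by (simp add: frontier_def interior_open)
  qed
qed

text \<open>\<open>n\<close> is constrained on the frontier only. Through \<open>proj\<close> this
  formula extends it from the graph to a continuous field on all of space, which supplies
  measurability and continuity.\<close>

definition chart_normal :: "real^3 \<Rightarrow> real^3" where
  "chart_normal x = T (tri (gradient2 \<gamma> (proj x), - 1)) /\<^sub>R area_density \<gamma> (proj x)"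

lemma continuous_chart_normal: "continuous_on A chart_normal"
  unfolding chart_normal_def
  by (intro continuous_intros continuous_on_compose2[OF continuous_T[of UNIV]]
      continuous_on_compose2[OF continuous_on_tri[of UNIV]] continuous_on_compose2[OF continuous_\<gamma>'[of UNIV]]
      continuous_on_compose2[OF continuous_area_density[of UNIV]] continuous_proj)
     (auto simp: area_density_pos less_imp_neq[symmetric])

lemma outward_unit_normal_chart:
  assumes "outward_unit_normal \<Omega> n" "x \<in> V" "x \<in> frontier \<Omega>"
  shows "n x = chart_normal x"
proof -
  have x: "x = graph_point T \<gamma> (proj x)" using frontier_chart_iff assms by blast
  have "n (graph_point T \<gamma> (proj x)) = chart_normal x"
    using assms(1) chart assms(2) x unfolding outward_unit_normal_def chart_normal_def tri_def gradient2_def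
    by (metis fst_conv snd_conv)
  then show ?thesis using x by simp
qed

text \<open>The area formula prescribes measures of subsets of \<open>V\<close>. It passes to
  integrals once two Borel measures are identified: \<open>S\<close> cut down to \<open>V\<close>,
  and the image under \<open>graph_point\<close> of the weighted Lebesgue measure of the
  plane.\<close>

lemma surface_integral_chart:
  fixes h :: "real^3 \<Rightarrow> real"
  assumes S: "surface_measure \<Omega> S" and h: "h \<in> borel_measurable borel" and h0: "\<And>x. x \<notin> V \<Longrightarrow> h x = 0"
  shows "(\<integral>x. h x \<partial>S) = (\<integral>p. area_density \<gamma> p * h (graph_point T \<gamma> p) \<partial>lborel)"
proof -
  have S1: "space S = frontier \<Omega>" and sS: "sets S = sets (restrict_space borel (frontier \<Omega>))"
    and SA: "\<And>A. A \<in> sets S \<Longrightarrow> A \<subseteq> V \<Longrightarrow> emeasure S A =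
          (\<integral>\<^sup>+p. ennreal (area_density \<gamma> p) * indicator {p. graph_point T \<gamma> p \<in> A} p \<partial>lborel)"
    using S chart unfolding surface_measure_def by auto
  have setsS: "A \<inter> frontier \<Omega> \<in> sets S" if "A \<in> sets borel" for A
    unfolding sS using that by (auto simp: sets_restrict_space)
  have [measurable]: "(\<lambda>x. x) \<in> measurable S borel"
    unfolding measurable_cong_sets[OF sS refl] by (intro measurable_restrict_space1) simp
  have [measurable]: "V \<in> sets borel" using V by simp
  note h[measurable]
  define m1 where "m1 = distr (density S (\<lambda>x. ennreal (indicator V x))) borel (\<lambda>x. x)"
  define m2 where "m2 = distr (density lborel (\<lambda>p. ennreal (area_density \<gamma> p * indicator V (graph_point T \<gamma> p)))) borel (graph_point T \<gamma>)"
  have "m1 = m2"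
  proof (rule measure_eqI)
    show "sets m1 = sets m2" by (simp add: m1_def m2_def)
    fix A assume "A \<in> sets m1"
    then have A [measurable]: "A \<in> sets borel" by (simp add: m1_def)
    have B: "A \<inter> V \<inter> frontier \<Omega> \<in> sets S" by (intro setsS) simp
    have "emeasure m1 A = (\<integral>\<^sup>+x. ennreal (indicator V x) * indicator (A \<inter> space S) x \<partial>S)"
      unfolding m1_def by (subst emeasure_distr) (auto simp: emeasure_density S1 setsS intro!: nn_integral_cong)
    also have "\<dots> = (\<integral>\<^sup>+x. indicator (A \<inter> V \<inter> frontier \<Omega>) x \<partial>S)"
      by (intro nn_integral_cong) (auto simp: S1 indicator_def)
    also have "\<dots> = emeasure S (A \<inter> V \<inter> frontier \<Omega>)" using B by simp
    also have "\<dots> = (\<integral>\<^sup>+p. ennreal (area_density \<gamma> p) * indicator {p. graph_point T \<gamma> p \<in> A \<inter> V \<inter> frontier \<Omega>} p \<partial>lborel)"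
      using B by (intro SA) auto
    also have "\<dots> = (\<integral>\<^sup>+p. ennreal (area_density \<gamma> p * indicator V (graph_point T \<gamma> p)) * indicator (graph_point T \<gamma> -` A) p \<partial>lborel)"
      using frontier_chart_iff by (intro nn_integral_cong) (auto simp: indicator_def)
    also have "\<dots> = emeasure m2 A"
      unfolding m2_def using measurable_sets_borel[OF measurable_graph_point A]
      by (subst emeasure_distr) (auto simp: emeasure_density)
    finally show "emeasure m1 A = emeasure m2 A" .
  qed
  have "(\<integral>x. h x \<partial>S) = (\<integral>x. indicator V x *\<^sub>R h x \<partial>S)"
    by (intro Bochner_Integration.integral_cong) (auto simp: indicator_def h0)
  also have "\<dots> = integral\<^sup>L m1 h"
    unfolding m1_def by (subst integral_distr) (simp_all add: integral_density)
  also have "\<dots> = integral\<^sup>L m2 h" by (simp add: \<open>m1 = m2\<close>)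
  also have "\<dots> = (\<integral>p. (area_density \<gamma> p * indicator V (graph_point T \<gamma> p)) *\<^sub>R h (graph_point T \<gamma> p) \<partial>lborel)"
    unfolding m2_def using area_density_pos[of \<gamma>]
    by (subst integral_distr) (simp_all add: integral_density less_imp_le)
  also have "\<dots> = (\<integral>p. area_density \<gamma> p * h (graph_point T \<gamma> p) \<partial>lborel)"
    by (intro Bochner_Integration.integral_cong) (auto simp: indicator_def h0)
  finally show ?thesis .
qed

text \<open>Parameters of points of \<open>K\<close> lie in the compact projection of
  \<open>K\<close>, where the continuous area density is integrable. Finitely many such bounds make
  \<open>S\<close> finite.\<close>

lemma surface_measure_compact_chart:
  assumes S: "surface_measure \<Omega> S" and K: "compact K" "K \<subseteq> V"
  shows "emeasure S (K \<inter> frontier \<Omega>) < \<infinity>"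
proof -
  have sS: "sets S = sets (restrict_space borel (frontier \<Omega>))"
    and SA: "\<And>A. A \<in> sets S \<Longrightarrow> A \<subseteq> V \<Longrightarrow> emeasure S A =
          (\<integral>\<^sup>+p. ennreal (area_density \<gamma> p) * indicator {p. graph_point T \<gamma> p \<in> A} p \<partial>lborel)"
    using S chart unfolding surface_measure_def by auto
  have "K \<inter> frontier \<Omega> \<in> sets S"
    unfolding sS using K by (auto simp: sets_restrict_space compact_imp_closed)
  then have "emeasure S (K \<inter> frontier \<Omega>) =
      (\<integral>\<^sup>+p. ennreal (area_density \<gamma> p) * indicator {p. graph_point T \<gamma> p \<in> K \<inter> frontier \<Omega>} p \<partial>lborel)"
    using K by (intro SA) auto
  also have "\<dots> \<le> (\<integral>\<^sup>+p. ennreal (norm (indicator (proj ` K) p *\<^sub>R area_density \<gamma> p)) \<partial>lborel)"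
  proof (intro nn_integral_mono)
    fix p
    have "p \<in> proj ` K" if "graph_point T \<gamma> p \<in> K"
      using that proj_graph_point by (metis image_eqI)
    then show "ennreal (area_density \<gamma> p) * indicator {p. graph_point T \<gamma> p \<in> K \<inter> frontier \<Omega>} p
      \<le> ennreal (norm (indicator (proj ` K) p *\<^sub>R area_density \<gamma> p))"
      using area_density_pos[of \<gamma> p] by (auto simp: indicator_def)
  qed
  also have "\<dots> < \<infinity>"
    using borel_integrable_compact[of "proj ` K" "area_density \<gamma>"] K
    by (auto simp: integrable_iff_bounded intro!: compact_continuous_image continuous_proj continuous_area_density)
  finally show ?thesis .
qed

end

subsection \<open>The divergence theorem\<close>

lemma integral_lebesgue_on_borel:
  fixes k :: "'a::euclidean_space \<Rightarrow> 'b::euclidean_space"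
  assumes "k \<in> borel_measurable borel" "\<Omega> \<in> sets borel"
  shows "(\<integral>x. k x \<partial>lebesgue_on \<Omega>) = (\<integral>x. indicator \<Omega> x *\<^sub>R k x \<partial>lborel)"
  using assms by (subst integral_restrict_space) (auto simp: integral_completion)

lemma integrable_lebesgue_on_continuous:
  fixes k :: "'a::euclidean_space \<Rightarrow> 'b::euclidean_space"
  assumes "continuous_on UNIV k" "open \<Omega>" "bounded \<Omega>"
  shows "integrable (lebesgue_on \<Omega>) k"
proof -
  have "integrable lborel (\<lambda>x. indicator \<Omega> x *\<^sub>R (indicator (closure \<Omega>) x *\<^sub>R k x))"
    using assms
    by (intro integrable_mult_indicator[OF _ borel_integrable_compact] continuous_on_subset[OF assms(1)]) auto
  moreover have "(\<lambda>x. indicator \<Omega> x *\<^sub>R (indicator (closure \<Omega>) x *\<^sub>R k x)) = (\<lambda>x. indicator \<Omega> x *\<^sub>R k x)"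
    using closure_subset[of \<Omega>] by (auto simp: indicator_def fun_eq_iff)
  moreover have "k \<in> borel_measurable borel" by (rule borel_measurable_continuous_onI[OF assms(1)])
  ultimately show ?thesis
    using assms(2) by (subst integrable_restrict_space) (auto simp: integrable_completion)
qed

lemma has_real_derivative_pos_part_square:
  "((\<lambda>t::real. (max 0 t)\<^sup>2) has_real_derivative 2 * max 0 t) (at t)"
proof (cases t "0::real" rule: linorder_cases)
  case less
  show ?thesis
    by (rule has_field_derivative_transform_within_open[of "\<lambda>_. 0" _ _ "{..<0}"]) (use less in auto)
next
  case greater
  show ?thesis
    by (rule has_field_derivative_transform_within_open[of "\<lambda>t. t\<^sup>2" _ _ "{0<..}"])
       (use greater in \<open>auto intro!: derivative_eq_intros\<close>)
next
  case equal
  have "((\<lambda>h::real. (max 0 h)\<^sup>2 / h) \<longlongrightarrow> 0) (at 0)"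
  proof (rule Lim_null_comparison[of _ "\<lambda>h. \<bar>h\<bar>"])
    show "\<forall>\<^sub>F h in at (0::real). norm ((max 0 h)\<^sup>2 / h) \<le> \<bar>h\<bar>"
      by (rule always_eventually) (auto simp: max_def power2_eq_square)
    show "((\<lambda>h::real. \<bar>h\<bar>) \<longlongrightarrow> 0) (at 0)"
      using tendsto_rabs[OF tendsto_ident_at[of "0::real" UNIV]] by simp
  qed
  then show ?thesis using equal by (simp add: DERIV_def)
qed

text \<open>With m the squared positive part, which is C1, and s the squared distance to
  \<open>a\<close> divided by \<open>r\<^sup>2\<close>, the profile m(4 - s) / (m(4 - s) + m(s - 1))
  is 1 for s at most 1 and 0 for s at least 4, that is, at the radii \<open>r\<close> and
  \<open>2 * r\<close>.\<close>

lemma C1_bump: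
  fixes a :: "'a::euclidean_space"
  assumes "r > 0"
  obtains c c' where "C1_gradient c c'" "\<And>x. x \<in> ball a r \<Longrightarrow> c x = (1::real)"
    "\<And>x. x \<notin> cball a (2 * r) \<Longrightarrow> c x = 0"
proof -
  define m where "m t = (max 0 t)\<^sup>2" for t :: real
  define d where "d s = m (4 - s) + m (s - 1)" for s
  define q where "q s = m (4 - s) / d s" for s
  define d' where "d' s = - (2 * max 0 (4 - s)) + 2 * max 0 (s - 1)" for s :: real
  define q' where "q' s = (- (2 * max 0 (4 - s)) * d s - m (4 - s) * d' s) / (d s * d s)" for s
  \<comment> \<open>\<open>4 - s\<close> and \<open>s - 1\<close> add up to 3, so at least one of
    them is positive.\<close>
  have d0: "d s \<noteq> 0" for s
    by (auto simp: d_def m_def max_def add_nonneg_eq_0_iff)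
  have m1: "((\<lambda>s. m (4 - s)) has_real_derivative - (2 * max 0 (4 - s))) (at s)" for s
  proof -
    have "((\<lambda>s. 4 - s) has_real_derivative -1) (at s)" by (auto intro!: derivative_eq_intros)
    from DERIV_chain2[OF has_real_derivative_pos_part_square this] show ?thesis by (simp add: m_def)
  qed
  have m2: "((\<lambda>s. m (s - 1)) has_real_derivative (2 * max 0 (s - 1))) (at s)" for s
  proof -
    have "((\<lambda>s. s - 1) has_real_derivative 1) (at s)" by (auto intro!: derivative_eq_intros)
    from DERIV_chain2[OF has_real_derivative_pos_part_square this] show ?thesis by (simp add: m_def)
  qed
  have dd: "(d has_real_derivative d' s) (at s)" for s
    unfolding d_def d'_def by (intro DERIV_add m1 m2)
  have qq: "(q has_real_derivative q' s) (at s)" for s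
    unfolding q_def q'_def by (intro DERIV_divide m1 dd d0)
  have cq: "continuous_on UNIV q'"
    unfolding q'_def using d0 unfolding d_def m_def d'_def by (intro continuous_intros) auto
  define k where "k x = ((x - a) \<bullet> (x - a)) * inverse (r\<^sup>2)" for x
  have "C1_gradient (\<lambda>x. (x - a) \<bullet> (x - a)) (\<lambda>x. 2 *\<^sub>R (x - a))"
    unfolding C1_gradient_def by (auto intro!: derivative_eq_intros continuous_intros simp: inner_commute algebra_simps)
  from C1_gradient_compose[OF C1_gradient_mult[OF this C1_gradient_const[of "inverse (r\<^sup>2)"]] qq cq]
  have "C1_gradient (\<lambda>x. q (k x)) (\<lambda>x. q' (k x) *\<^sub>R (inverse (r\<^sup>2) *\<^sub>R 2 *\<^sub>R (x - a)))"
    by (simp add: k_def)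
  moreover have k: "k x = (dist a x / r)\<^sup>2" for x
    by (simp add: k_def dist_norm norm_minus_commute power2_norm_eq_inner[symmetric] power_divide)
       (simp add: divide_inverse)
  moreover have "q (k x) = 1" if "x \<in> ball a r" for x
  proof -
    have "dist a x / r \<le> 1" using that assms by simp
    then have "k x \<le> 1" using assms unfolding k by (intro power_le_one) auto
    then have "m (k x - 1) = 0" by (simp add: m_def)
    then show ?thesis using d0[of "k x"] by (simp add: q_def d_def)
  qed
  moreover have "q (k x) = 0" if "x \<notin> cball a (2 * r)" for x
  proof -
    have "dist a x / r \<ge> 2" using that assms by (simp add: field_simps)
    then have "k x \<ge> 2\<^sup>2" unfolding k by (intro power_mono) auto
    then show ?thesis by (simp add: q_def m_def)
  qed
  ultimately show ?thesis by (intro that[of "\<lambda>x. q (k x)"])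
qed

context C1_boundary_chart begin

text \<open>After rotating by \<open>T\<close>, \<Omega> may be replaced by the whole region above
  the graph: the two agree in \<open>V\<close>, and \<open>f\<close> and \<open>g\<close> vanish
  outside \<open>V\<close>. The area density of the surface integral cancels the normalisation of
  \<open>chart_normal\<close>.\<close>

lemma divergence_in_chart:
  assumes n: "outward_unit_normal \<Omega> n" and S: "surface_measure \<Omega> S"
    and f: "C1_gradient f g" and f0: "\<And>x. x \<notin> cball a r \<Longrightarrow> f x = 0" and aV: "cball a r \<subseteq> V"
  shows "(\<integral>x. g x \<bullet> e \<partial>lebesgue_on \<Omega>) = (\<integral>x. f x * (n x \<bullet> e) \<partial>S)"
proof -
  define e' where "e' = inv T e"
  have g0: "g x = 0" if "x \<notin> V" for x
    by (rule C1_gradient_eq_0[OF f, of "- cball a r"]) (use that f0 aV in auto)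
  have [measurable]: "f \<in> borel_measurable borel" "g \<in> borel_measurable borel" "T \<in> borel_measurable borel"
    "chart_normal \<in> borel_measurable borel"
    by (auto intro!: borel_measurable_continuous_onI C1_gradient_continuous[OF f] continuous_T continuous_chart_normal)
  have [measurable]: "\<Omega> \<in> sets borel" using \<Omega> by simp
  have [measurable]: "{y :: real^3. \<gamma> (y$1, y$2) < y$3} \<in> sets borel"
    by (intro borel_open open_Collect_less continuous_intros continuous_on_compose2[OF continuous_\<gamma>[of UNIV]]) auto
  have "(\<integral>x. g x \<bullet> e \<partial>lebesgue_on \<Omega>) = (\<integral>x. indicator \<Omega> x *\<^sub>R (g x \<bullet> e) \<partial>lborel)"
    by (rule integral_lebesgue_on_borel) auto
  also have "\<dots> = (\<integral>y. indicator \<Omega> (T y) *\<^sub>R (g (T y) \<bullet> e) \<partial>lborel)"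
    by (subst lborel_orthogonal[OF T, symmetric], subst integral_distr) auto
  also have "\<dots> = (\<integral>y. indicator {y. \<gamma> (y$1, y$2) < y$3} y * (adjoint T (g (T y)) \<bullet> e') \<partial>lborel)"
  proof (rule Bochner_Integration.integral_cong[OF refl])
    fix y
    have "T y \<in> \<Omega> \<longleftrightarrow> \<gamma> (y$1, y$2) < y$3" if "T y \<in> V"
    proof -
      have "T y \<in> \<Omega> \<longleftrightarrow> T y \<in> T ` {y. \<gamma> (y$1, y$2) < y$3}" using \<Omega>_V that by blast
      then show ?thesis by (simp add: inj_image_mem_iff[OF bij_is_inj[OF bij_T]])
    qed
    moreover have "adjoint T (g (T y)) \<bullet> e' = g (T y) \<bullet> e"
      using adjoint_works[OF linear_T, of e' "g (T y)"] by (simp add: e'_def inner_commute)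
    ultimately show "indicator \<Omega> (T y) *\<^sub>R (g (T y) \<bullet> e) = indicator {y. \<gamma> (y$1, y$2) < y$3} y * (adjoint T (g (T y)) \<bullet> e')"
      using g0[of "T y"] by (cases "T y \<in> V") (auto simp: indicator_def)
  qed
  also have "\<dots> = (\<integral>p. f (T (tri (p, \<gamma> p))) * (tri (gradient2 \<gamma> p, -1) \<bullet> e') \<partial>lborel)"
  proof (rule divergence_above_graph[OF C1_gradient_linear_compose[OF f linear_T] _ \<gamma>])
    fix y :: "real^3" assume "norm a + r < norm y"
    then have "T y \<notin> cball a r"
      using orthogonal_transformation_norm[OF T, of y] norm_triangle_ineq[of "a" "T y - a"]
      by (auto simp: dist_norm norm_minus_commute)
    then show "f (T y) = 0" by (rule f0)
  qed
  also have "\<dots> = (\<integral>p. area_density \<gamma> p * (f (graph_point T \<gamma> p) * (chart_normal (graph_point T \<gamma> p) \<bullet> e)) \<partial>lborel)"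
  proof (rule Bochner_Integration.integral_cong[OF refl])
    fix p
    have "tri (gradient2 \<gamma> p, -1) \<bullet> e' = T (tri (gradient2 \<gamma> p, -1)) \<bullet> e"
      using T by (metis T_inv(1) e'_def orthogonal_transformation_def)
    then show "f (T (tri (p, \<gamma> p))) * (tri (gradient2 \<gamma> p, -1) \<bullet> e') =
      area_density \<gamma> p * (f (graph_point T \<gamma> p) * (chart_normal (graph_point T \<gamma> p) \<bullet> e))"
      using area_density_pos[of \<gamma> p] by (simp add: chart_normal_def) (simp add: graph_point_tri)
  qed
  also have "\<dots> = (\<integral>x. f x * (chart_normal x \<bullet> e) \<partial>S)"
  proof (rule surface_integral_chart[OF S, symmetric])
    fix x assume "x \<notin> V"
    then have "f x = 0" using f0 aV by blast
    then show "f x * (chart_normal x \<bullet> e) = 0" by simp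
  qed simp
  also have "\<dots> = (\<integral>x. f x * (n x \<bullet> e) \<partial>S)"
  proof (rule Bochner_Integration.integral_cong[OF refl])
    fix x assume "x \<in> space S"
    then have x: "x \<in> frontier \<Omega>" using S by (simp add: surface_measure_def)
    show "f x * (chart_normal x \<bullet> e) = f x * (n x \<bullet> e)"
    proof (cases "x \<in> V")
      case True
      then show ?thesis using outward_unit_normal_chart[OF n _ x] by simp
    next
      case False
      then have "f x = 0" using f0 aV by blast
      then show ?thesis by simp
    qed
  qed
  finally show ?thesis .
qed

end

section \<open>From charts to the whole domain\<close>

locale C1_domain =
  fixes \<Omega> :: "(real^3) set" and n :: "real^3 \<Rightarrow> real^3" and S :: "(real^3) measure"
  assumes domain: "bounded_C1_domain \<Omega>" and normal: "outward_unit_normal \<Omega> n" and surface: "surface_measure \<Omega> S"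
begin

lemma open_\<Omega>: "open \<Omega>" and bounded_\<Omega>: "bounded \<Omega>"
  using domain by (auto simp: bounded_C1_domain_def)

lemma compact_frontier: "compact (frontier \<Omega>)"
  using bounded_\<Omega> by (simp add: compact_frontier_bounded)

lemma space_S: "space S = frontier \<Omega>" and sets_S: "sets S = sets (restrict_space borel (frontier \<Omega>))"
  using surface by (auto simp: surface_measure_def)

text \<open>The factor 2 leaves room for a bump that is 1 on \<open>ball x r\<close> and vanishes
  outside \<open>cball x (2 * r)\<close>.\<close>

lemma chart_at_frontier:
  assumes "x \<in> frontier \<Omega>"
  obtains T \<gamma> V r where "C1_boundary_chart \<Omega> T \<gamma> V" "r > 0" "cball x (2 * r) \<subseteq> V"
proof -
  obtain T \<gamma> V where c: "graph_chart \<Omega> T \<gamma> V" "x \<in> V"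
    using domain assms unfolding bounded_C1_domain_def by blast
  then have "open V" by (simp add: graph_chart_def)
  then obtain e where "e > 0" "cball x e \<subseteq> V" using c(2) open_contains_cball by blast
  then show ?thesis using c open_\<Omega> that[of T \<gamma> V "e/2"] by (simp add: C1_boundary_chart_def)
qed

lemma continuous_normal: "continuous_on (frontier \<Omega>) n"
  unfolding continuous_on_eq_continuous_within
proof
  fix x assume x: "x \<in> frontier \<Omega>"
  then obtain T \<gamma> V r where c: "C1_boundary_chart \<Omega> T \<gamma> V" "r > 0" "cball x (2 * r) \<subseteq> V"
    by (rule chart_at_frontier)
  interpret C1_boundary_chart \<Omega> T \<gamma> V by fact
  have xV: "x \<in> V" using c by auto
  have "continuous (at x within frontier \<Omega>) chart_normal"
    using continuous_chart_normal[of "frontier \<Omega>"] x by (simp add: continuous_on_eq_continuous_within)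
  then have "(chart_normal \<longlongrightarrow> chart_normal x) (at x within frontier \<Omega>)"
    by (simp add: continuous_within)
  moreover have "\<forall>\<^sub>F y in at x within frontier \<Omega>. chart_normal y = n y"
  proof -
    have "\<forall>\<^sub>F y in at x within frontier \<Omega>. y \<in> V"
      by (rule topological_tendstoD[OF tendsto_ident_at V xV])
    moreover have "\<forall>\<^sub>F y in at x within frontier \<Omega>. y \<in> frontier \<Omega>"
      by (simp add: eventually_at_filter)
    ultimately show ?thesis
      by eventually_elim (simp add: outward_unit_normal_chart[OF normal])
  qed
  ultimately have "(n \<longlongrightarrow> chart_normal x) (at x within frontier \<Omega>)"
    using Lim_transform_eventually by blast
  then show "continuous (at x within frontier \<Omega>) n"
    using outward_unit_normal_chart[OF normal xV x] by (simp add: continuous_within)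
qed

text \<open>Compactness of the frontier reduces this to the local bounds in finitely many charts.
  Finiteness of \<open>S\<close> then makes continuous functions on the frontier integrable.\<close>

lemma finite_measure_S: "finite_measure S"
proof
  obtain r where r: "\<And>x. x \<in> frontier \<Omega> \<Longrightarrow> r x > 0 \<and> emeasure S (cball x (r x) \<inter> frontier \<Omega>) < \<infinity>"
  proof -
    have "\<exists>r>0. emeasure S (cball x r \<inter> frontier \<Omega>) < \<infinity>" if x: "x \<in> frontier \<Omega>" for x
    proof -
      obtain T \<gamma> V r where c: "C1_boundary_chart \<Omega> T \<gamma> V" "r > 0" "cball x (2 * r) \<subseteq> V"
        by (rule chart_at_frontier[OF x])
      interpret C1_boundary_chart \<Omega> T \<gamma> V by fact
      show ?thesis using surface_measure_compact_chart[OF surface _ c(3)] c(2)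
        by (intro exI[of _ "2 * r"]) auto
    qed
    then show ?thesis using that by metis
  qed
  have "frontier \<Omega> \<subseteq> (\<Union>x\<in>frontier \<Omega>. ball x (r x))" using r by force
  then obtain I where I: "I \<subseteq> frontier \<Omega>" "finite I" "frontier \<Omega> \<subseteq> (\<Union>x\<in>I. ball x (r x))"
    using compactE_image[OF compact_frontier, of "frontier \<Omega>" "\<lambda>x. ball x (r x)"] by blast
  have sets: "cball x (r x) \<inter> frontier \<Omega> \<in> sets S" for x
    by (auto simp: sets_S sets_restrict_space)
  have "emeasure S (space S) \<le> emeasure S (\<Union>x\<in>I. cball x (r x) \<inter> frontier \<Omega>)"
  proof (rule emeasure_mono)
    show "space S \<subseteq> (\<Union>x\<in>I. cball x (r x) \<inter> frontier \<Omega>)"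
    proof
      fix y assume y: "y \<in> space S"
      then obtain x where "x \<in> I" "y \<in> ball x (r x)" using I(3) space_S by blast
      then show "y \<in> (\<Union>x\<in>I. cball x (r x) \<inter> frontier \<Omega>)"
        using y ball_subset_cball[of x "r x"] space_S by blast
    qed
    show "(\<Union>x\<in>I. cball x (r x) \<inter> frontier \<Omega>) \<in> sets S"
      using I(2) sets by (rule sets.finite_UN)
  qed
  also have "\<dots> \<le> (\<Sum>x\<in>I. emeasure S (cball x (r x) \<inter> frontier \<Omega>))"
    using I sets by (intro emeasure_subadditive_finite) auto
  also have "\<dots> < \<infinity>" using I r by (auto simp: subset_iff)
  finally show "emeasure S (space S) \<noteq> \<infinity>" by simp
qed

lemma continuous_on_frontier_measurable:
  fixes h :: "real^3 \<Rightarrow> 'b::euclidean_space"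
  assumes "continuous_on (frontier \<Omega>) h"
  shows "h \<in> borel_measurable S"
  using borel_measurable_continuous_on_restrict[OF assms] by (simp add: measurable_cong_sets[OF sets_S refl])

lemma continuous_on_frontier_bounded:
  fixes h :: "real^3 \<Rightarrow> 'b::euclidean_space"
  assumes "continuous_on (frontier \<Omega>) h"
  shows "\<exists>B. \<forall>x\<in>space S. norm (h x) \<le> B"
proof -
  have "bounded (h ` frontier \<Omega>)"
    using compact_continuous_image[OF assms compact_frontier] compact_imp_bounded by blast
  then show ?thesis by (auto simp: bounded_iff space_S)
qed

lemma integrable_S_continuous:
  fixes h :: "real^3 \<Rightarrow> 'b::euclidean_space"
  assumes "continuous_on (frontier \<Omega>) h"
  shows "integrable S h"
proof -
  obtain B where "\<forall>x\<in>space S. norm (h x) \<le> B"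
    using continuous_on_frontier_bounded[OF assms] by blast
  then show ?thesis
    using continuous_on_frontier_measurable[OF assms]
    by (intro finite_measure.integrable_const_bound[OF finite_measure_S, of _ B]) auto
qed

lemma integrable_\<Omega>_continuous:
  fixes h :: "real^3 \<Rightarrow> 'b::euclidean_space"
  assumes "continuous_on UNIV h"
  shows "integrable (lebesgue_on \<Omega>) h"
  using integrable_lebesgue_on_continuous[OF assms open_\<Omega> bounded_\<Omega>] .

text \<open>The half-space above height \<open>- R - 1\<close> contains the support, so it can stand
  in for \<Omega>. It is the region above a constant graph on which \<open>f\<close> vanishes, and
  \<open>divergence_above_graph\<close> leaves no boundary term.\<close>

lemma divergence_inside:
  assumes f: "C1_gradient f g" and f0: "\<And>x. x \<notin> cball a r \<Longrightarrow> f x = 0" and a: "cball a r \<subseteq> \<Omega>"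
  shows "(\<integral>x. g x \<bullet> e \<partial>lebesgue_on \<Omega>) = 0"
proof -
  have g0: "g x = 0" if "x \<notin> cball a r" for x
    by (rule C1_gradient_eq_0[OF f, of "- cball a r"]) (use that f0 in auto)
  have [measurable]: "g \<in> borel_measurable borel" "\<Omega> \<in> sets borel"
    using open_\<Omega> by (auto intro!: borel_measurable_continuous_onI C1_gradient_continuous[OF f])
  define R where "R = norm a + r"
  have R: "f y = 0" "g y = 0" if "R < norm y" for y
  proof -
    have "y \<notin> cball a r"
      using that norm_triangle_ineq[of "a" "y - a"] by (auto simp: dist_norm norm_minus_commute R_def)
    then show "f y = 0" "g y = 0" using f0 g0 by auto
  qed
  have below: "f y = 0 \<and> g y = 0" if "y $ 3 \<le> - R - 1" for y
  proof -
    have "R < norm y" using component_le_norm_cart[of y 3] that by linarith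
    then show ?thesis using R by simp
  qed
  have "(\<integral>x. g x \<bullet> e \<partial>lebesgue_on \<Omega>) = (\<integral>x. indicator \<Omega> x *\<^sub>R (g x \<bullet> e) \<partial>lborel)"
    by (rule integral_lebesgue_on_borel) auto
  also have "\<dots> = (\<integral>x. indicator {y. - R - 1 < y$3} x * (g x \<bullet> e) \<partial>lborel)"
  proof (rule Bochner_Integration.integral_cong[OF refl])
    fix x
    have "g x = 0" if "x \<notin> \<Omega>" using g0 a that by blast
    moreover have "g x = 0" if "\<not> - R - 1 < x $ 3" using below[of x] that by simp
    ultimately show "indicator \<Omega> x *\<^sub>R (g x \<bullet> e) = indicator {y. - R - 1 < y$3} x * (g x \<bullet> e)"
      by (cases "x \<in> \<Omega>"; cases "- R - 1 < x $ 3") auto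
  qed
  also have "\<dots> = (\<integral>p. f (tri (p, - R - 1)) * (tri (0, - 1) \<bullet> e) \<partial>lborel)"
    using divergence_above_graph[OF f R(1) C1_gradient_const[of "- R - 1"]] by simp
  also have "\<dots> = 0" using below by simp
  finally show ?thesis .
qed

text \<open>Instead of a partition of unity: induction over a finite cover of \<open>closure \<Omega>\<close> by good balls,
  splitting \<open>f\<close> as \<open>c f + (1 - c) f\<close> with a bump \<open>c\<close> that is 1 on the ball removed.\<close>

theorem divergence_theorem:
  assumes "C1_gradient f g"
  shows "(\<integral>x. g x \<bullet> e \<partial>lebesgue_on \<Omega>) = (\<integral>x. f x * (n x \<bullet> e) \<partial>S)"
proof -
  define ok where "ok f g \<longleftrightarrow> (\<integral>x. g x \<bullet> e \<partial>lebesgue_on \<Omega>) = (\<integral>x. f x * (n x \<bullet> e) \<partial>S)" for f g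
  have "\<forall>x\<in>closure \<Omega>. \<exists>r>0. \<forall>f g. C1_gradient f g \<and> (\<forall>y. y \<notin> cball x (2 * r) \<longrightarrow> f y = 0) \<longrightarrow> ok f g"
  proof
    fix x assume that: "x \<in> closure \<Omega>"
    show "\<exists>r>0. \<forall>f g. C1_gradient f g \<and> (\<forall>y. y \<notin> cball x (2 * r) \<longrightarrow> f y = 0) \<longrightarrow> ok f g"
    proof (cases "x \<in> \<Omega>")
      case True
      then obtain d where d: "d > 0" "cball x d \<subseteq> \<Omega>" using open_\<Omega> open_contains_cball by blast
      show ?thesis
      proof (intro exI[of _ "d/2"] conjI allI impI)
        fix f g assume fg: "C1_gradient f g \<and> (\<forall>y. y \<notin> cball x (2 * (d/2)) \<longrightarrow> f y = 0)"
        have "f y = 0" if "y \<in> frontier \<Omega>" for y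
        proof -
          have "y \<notin> cball x d" using that d open_\<Omega> by (auto simp: frontier_def interior_open)
          then show ?thesis using fg by simp
        qed
        then have "(\<integral>x. f x * (n x \<bullet> e) \<partial>S) = (\<integral>x. 0 \<partial>S)"
          by (intro Bochner_Integration.integral_cong) (auto simp: space_S)
        then show "ok f g"
          using divergence_inside[of f g x d e] fg d by (simp add: ok_def)
      qed (use d in auto)
    next
      case False
      then have x: "x \<in> frontier \<Omega>" using that open_\<Omega> by (simp add: frontier_def interior_open)
      obtain T \<gamma> V r where c: "C1_boundary_chart \<Omega> T \<gamma> V" "r > 0" "cball x (2 * r) \<subseteq> V"
        by (rule chart_at_frontier[OF x])
      interpret C1_boundary_chart \<Omega> T \<gamma> V by fact
      show ?thesis
        using divergence_in_chart[OF normal surface, where a = x and r = "2 * r" and e = e] c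
        unfolding ok_def by (intro exI[of _ r]) blast
    qed
  qed
  from bchoice[OF this] obtain r where r: "\<And>x. x \<in> closure \<Omega> \<Longrightarrow> r x > 0"
    and local: "\<And>x f g. x \<in> closure \<Omega> \<Longrightarrow> C1_gradient f g \<Longrightarrow> (\<And>y. y \<notin> cball x (2 * r x) \<Longrightarrow> f y = 0) \<Longrightarrow> ok f g"
    by blast
  have "compact (closure \<Omega>)" using bounded_\<Omega> by simp
  moreover have "closure \<Omega> \<subseteq> (\<Union>x\<in>closure \<Omega>. ball x (r x))" using r by force
  ultimately obtain I where I: "I \<subseteq> closure \<Omega>" "finite I" "closure \<Omega> \<subseteq> (\<Union>x\<in>I. ball x (r x))"
    using compactE_image[of "closure \<Omega>" "closure \<Omega>" "\<lambda>x. ball x (r x)"] by blast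
  \<comment> \<open>The claim is generalised to functions that vanish on the part of
    \<open>closure \<Omega>\<close> not covered by the balls of \<open>I\<close>: for the full cover
    this is no restriction, and for empty \<open>I\<close> both integrals are 0.\<close>
  have "ok f g" if "C1_gradient f g" "\<And>y. y \<in> closure \<Omega> - (\<Union>x\<in>I. ball x (r x)) \<Longrightarrow> f y = 0" for f g
    using I(2,1) that
  proof (induction I arbitrary: f g rule: finite_induct)
    case empty
    have "g x = 0" if "x \<in> \<Omega>" for x
      using empty that closure_subset[of \<Omega>] by (intro C1_gradient_eq_0[OF empty(2) open_\<Omega> that]) auto
    then have "(\<integral>x. g x \<bullet> e \<partial>lebesgue_on \<Omega>) = (\<integral>x. 0 \<partial>lebesgue_on \<Omega>)"
      using open_\<Omega> by (intro Bochner_Integration.integral_cong) (auto simp: space_restrict_space)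
    moreover have "(\<integral>x. f x * (n x \<bullet> e) \<partial>S) = (\<integral>x. 0 \<partial>S)"
      using empty(3) by (intro Bochner_Integration.integral_cong) (auto simp: space_S frontier_def)
    ultimately show ?case by (simp add: ok_def)
  next
    case (insert i I)
    have i: "i \<in> closure \<Omega>" using insert by auto
    obtain c c' where c: "C1_gradient c c'" "\<And>x. x \<in> ball i (r i) \<Longrightarrow> c x = 1" "\<And>x. x \<notin> cball i (2 * r i) \<Longrightarrow> c x = 0"
      using C1_bump[OF r[OF i], of i] by blast
    define f1 g1 where "f1 x = c x * f x" and "g1 x = c x *\<^sub>R g x + f x *\<^sub>R c' x" for x
    have 1: "C1_gradient f1 g1"
      unfolding f1_def g1_def by (rule C1_gradient_mult[OF c(1) insert.prems(2)])
    have 2: "C1_gradient (\<lambda>x. f x - f1 x) (\<lambda>x. g x - g1 x)"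
      by (rule C1_gradient_diff[OF insert.prems(2) 1])
    have ok1: "ok f1 g1"
      using local[OF i 1] c(3) by (auto simp: f1_def)
    have ok2: "ok (\<lambda>x. f x - f1 x) (\<lambda>x. g x - g1 x)"
    proof (rule insert.IH[OF _ 2])
      show "I \<subseteq> closure \<Omega>" using insert by auto
      \<comment> \<open>Inside the removed ball \<open>c\<close> is 1 and the difference vanishes;
        outside it, \<open>y\<close> is uncovered by the larger family as well and
        \<open>f y\<close> is already 0.\<close>
      fix y assume y: "y \<in> closure \<Omega> - (\<Union>x\<in>I. ball x (r x))"
      show "f y - f1 y = 0"
      proof (cases "y \<in> ball i (r i)")
        case True
        then show ?thesis using c(2) by (simp add: f1_def)
      next
        case False
        then have "f y = 0" using y insert.prems(3)[of y] by auto
        then show ?thesis by (simp add: f1_def)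
      qed
    qed
    have i\<Omega>: "integrable (lebesgue_on \<Omega>) (\<lambda>x. g x \<bullet> e)" "integrable (lebesgue_on \<Omega>) (\<lambda>x. g1 x \<bullet> e)"
      by (intro integrable_\<Omega>_continuous continuous_intros C1_gradient_continuous(2)[OF insert.prems(2)]
          C1_gradient_continuous(2)[OF 1])+
    have iS: "integrable S (\<lambda>x. f x * (n x \<bullet> e))" "integrable S (\<lambda>x. f1 x * (n x \<bullet> e))"
      by (intro integrable_S_continuous continuous_intros C1_gradient_continuous(1)[OF insert.prems(2)]
          C1_gradient_continuous(1)[OF 1] continuous_normal)+
    show ?case
      using ok1 ok2 i\<Omega> iS by (simp add: ok_def inner_diff_left left_diff_distrib)
  qed
  from this[OF assms] have "ok f g" using I(3) by blast
  then show ?thesis by (simp add: ok_def)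
qed

end

subsection \<open>Square integrable functions\<close>

lemma L2_measurable: "L2 M f \<Longrightarrow> f \<in> borel_measurable M"
  by (simp add: L2_def)

lemma L2_diff:
  assumes "L2 M f" "L2 M g"
  shows "L2 M (\<lambda>x. f x - g x)"
proof -
  have [measurable]: "f \<in> borel_measurable M" "g \<in> borel_measurable M"
    and i: "integrable M (\<lambda>x. (norm (f x))\<^sup>2)" "integrable M (\<lambda>x. (norm (g x))\<^sup>2)"
    using assms by (auto simp: L2_def)
  have "integrable M (\<lambda>x. (norm (f x - g x))\<^sup>2)"
  proof (rule Bochner_Integration.integrable_bound)
    show "integrable M (\<lambda>x. 2 * (norm (f x))\<^sup>2 + 2 * (norm (g x))\<^sup>2)" using i by simp
    have "(norm (f x - g x))\<^sup>2 \<le> 2 * (norm (f x))\<^sup>2 + 2 * (norm (g x))\<^sup>2" for x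
    proof -
      have "(norm (f x - g x))\<^sup>2 \<le> (norm (f x) + norm (g x))\<^sup>2"
        by (intro power_mono norm_triangle_ineq4) simp
      also have "\<dots> \<le> 2 * (norm (f x))\<^sup>2 + 2 * (norm (g x))\<^sup>2"
        using sum_squares_bound[of "norm (f x)" "norm (g x)"] by (simp add: power2_sum)
      finally show ?thesis .
    qed
    then show "AE x in M. norm ((norm (f x - g x))\<^sup>2) \<le> norm (2 * (norm (f x))\<^sup>2 + 2 * (norm (g x))\<^sup>2)"
      by auto
  qed simp
  then show ?thesis by (simp add: L2_def)
qed

lemma L2_integrable_inner:
  assumes "L2 M f" "L2 M g"
  shows "integrable M (\<lambda>x. f x \<bullet> g x)" "integrable M (\<lambda>x. norm (f x) * norm (g x))"
proof -
  have [measurable]: "f \<in> borel_measurable M" "g \<in> borel_measurable M"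
    and i: "integrable M (\<lambda>x. (norm (f x))\<^sup>2)" "integrable M (\<lambda>x. (norm (g x))\<^sup>2)"
    using assms by (auto simp: L2_def)
  show 1: "integrable M (\<lambda>x. norm (f x) * norm (g x))"
  proof (rule Bochner_Integration.integrable_bound)
    show "integrable M (\<lambda>x. (norm (f x))\<^sup>2 + (norm (g x))\<^sup>2)" using i by simp
    have "norm (f x) * norm (g x) \<le> (norm (f x))\<^sup>2 + (norm (g x))\<^sup>2" for x
      using sum_squares_bound[of "norm (f x)" "norm (g x)"] by (simp add: mult_nonneg_nonneg order_trans[rotated])
    then show "AE x in M. norm (norm (f x) * norm (g x)) \<le> norm ((norm (f x))\<^sup>2 + (norm (g x))\<^sup>2)"
      by auto
  qed simp
  show "integrable M (\<lambda>x. f x \<bullet> g x)"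
    by (rule Bochner_Integration.integrable_bound[OF 1]) (auto simp: Cauchy_Schwarz_ineq2)
qed

lemma L2_Cauchy_Schwarz:
  assumes "L2 M f" "L2 M g"
  shows "\<bar>\<integral>x. f x \<bullet> g x \<partial>M\<bar> \<le> sqrt (\<integral>x. (norm (f x))\<^sup>2 \<partial>M) * sqrt (\<integral>x. (norm (g x))\<^sup>2 \<partial>M)"
proof -
  have [measurable]: "f \<in> borel_measurable M" "g \<in> borel_measurable M"
    and i: "integrable M (\<lambda>x. (norm (f x))\<^sup>2)" "integrable M (\<lambda>x. (norm (g x))\<^sup>2)"
    using assms by (auto simp: L2_def)
  note fg = L2_integrable_inner[OF assms]
  define I where "I = (\<integral>x. norm (f x) * norm (g x) \<partial>M)"
  define A where "A = (\<integral>x. (norm (f x))\<^sup>2 \<partial>M)"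
  define B where "B = (\<integral>x. (norm (g x))\<^sup>2 \<partial>M)"
  have I0: "I \<ge> 0" and A0: "A \<ge> 0" and B0: "B \<ge> 0" unfolding I_def A_def B_def by (auto intro!: integral_nonneg_AE)
  have "ennreal (I\<^sup>2) = (\<integral>\<^sup>+x. ennreal (norm (f x)) * ennreal (norm (g x)) \<partial>M)\<^sup>2"
    using nn_integral_eq_integral[OF fg(2)] I0
    by (simp add: I_def ennreal_mult'[symmetric] ennreal_power)
  also have "\<dots> \<le> (\<integral>\<^sup>+x. ennreal (norm (f x)) ^ 2 \<partial>M) * (\<integral>\<^sup>+x. ennreal (norm (g x)) ^ 2 \<partial>M)"
    by (rule Cauchy_Schwarz_nn_integral) simp_all
  also have "\<dots> = ennreal (A * B)"
    using nn_integral_eq_integral[OF i(1)] nn_integral_eq_integral[OF i(2)] A0 B0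
    by (simp add: A_def B_def ennreal_power ennreal_mult)
  finally have "I\<^sup>2 \<le> A * B" using A0 B0 by (simp add: ennreal_le_iff)
  then have "I \<le> sqrt (A * B)" by (rule real_le_rsqrt)
  moreover have "\<bar>\<integral>x. f x \<bullet> g x \<partial>M\<bar> \<le> I"
    unfolding I_def using integral_norm_bound[of M "\<lambda>x. f x \<bullet> g x"]
    by (simp, intro order_trans[OF _ integral_mono[OF integrable_norm[OF fg(1)] fg(2)]])
       (auto simp: Cauchy_Schwarz_ineq2)
  ultimately show ?thesis by (simp add: A_def B_def real_sqrt_mult)
qed

text \<open>By Cauchy-Schwarz the error is at most the L2 norm of \<open>b\<close> times the L2
  distance from \<open>f k\<close> to \<open>g\<close>. The limits in \<open>has_trace\<close> are
  taken through this pairing.\<close>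

lemma L2_tendsto_inner:
  assumes f: "L2_tendsto M f g" and b: "L2 M b"
  shows "(\<lambda>k. \<integral>x. b x \<bullet> f k x \<partial>M) \<longlonglongrightarrow> (\<integral>x. b x \<bullet> g x \<partial>M)"
proof -
  have fk: "L2 M (f k)" and g: "L2 M g" for k using f by (auto simp: L2_tendsto_def)
  have lim0: "(\<lambda>k. sqrt (\<integral>x. (norm (b x))\<^sup>2 \<partial>M) * sqrt (\<integral>x. (norm (f k x - g x))\<^sup>2 \<partial>M))
    \<longlonglongrightarrow> sqrt (\<integral>x. (norm (b x))\<^sup>2 \<partial>M) * sqrt 0"
    using f by (intro tendsto_intros) (auto simp: L2_tendsto_def)
  have "(\<lambda>k. (\<integral>x. b x \<bullet> f k x \<partial>M) - (\<integral>x. b x \<bullet> g x \<partial>M)) \<longlonglongrightarrow> 0"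
  proof (rule Lim_null_comparison[OF _ lim0[unfolded real_sqrt_zero mult_zero_right]])
    show "\<forall>\<^sub>F k in sequentially. norm ((\<integral>x. b x \<bullet> f k x \<partial>M) - (\<integral>x. b x \<bullet> g x \<partial>M))
        \<le> sqrt (\<integral>x. (norm (b x))\<^sup>2 \<partial>M) * sqrt (\<integral>x. (norm (f k x - g x))\<^sup>2 \<partial>M)"
    proof (rule always_eventually, rule allI)
      fix k
      have "(\<integral>x. b x \<bullet> f k x \<partial>M) - (\<integral>x. b x \<bullet> g x \<partial>M) = (\<integral>x. b x \<bullet> (f k x - g x) \<partial>M)"
        using L2_integrable_inner[OF b fk[of k]] L2_integrable_inner[OF b g] by (simp add: inner_diff_right)
      then show "norm ((\<integral>x. b x \<bullet> f k x \<partial>M) - (\<integral>x. b x \<bullet> g x \<partial>M))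
        \<le> sqrt (\<integral>x. (norm (b x))\<^sup>2 \<partial>M) * sqrt (\<integral>x. (norm (f k x - g x))\<^sup>2 \<partial>M)"
        using L2_Cauchy_Schwarz[OF b L2_diff[OF fk[of k] g]] by simp
    qed
  qed
  then show ?thesis by (rule LIM_zero_cancel)
qed

lemma L2_component:
  assumes "L2 M f"
  shows "L2 M (\<lambda>x. f x \<bullet> e)"
proof -
  have [measurable]: "f \<in> borel_measurable M" and i: "integrable M (\<lambda>x. (norm (f x))\<^sup>2)"
    using assms by (auto simp: L2_def)
  have "integrable M (\<lambda>x. (norm (f x \<bullet> e))\<^sup>2)"
  proof (rule Bochner_Integration.integrable_bound)
    show "integrable M (\<lambda>x. (norm e)\<^sup>2 * (norm (f x))\<^sup>2)" using i by simp
    have "(f x \<bullet> e)\<^sup>2 \<le> (norm e)\<^sup>2 * (norm (f x))\<^sup>2" for x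
      using Cauchy_Schwarz_ineq[of "f x" e] by (simp add: power2_norm_eq_inner mult.commute)
    then show "AE x in M. norm ((norm (f x \<bullet> e))\<^sup>2) \<le> norm ((norm e)\<^sup>2 * (norm (f x))\<^sup>2)" by auto
  qed simp
  then show ?thesis by (simp add: L2_def)
qed

lemma L2_tendsto_component:
  assumes "L2_tendsto M f g"
  shows "L2_tendsto M (\<lambda>k x. f k x \<bullet> e) (\<lambda>x. g x \<bullet> e)"
proof -
  have fk: "L2 M (f k)" and g: "L2 M g" for k using assms by (auto simp: L2_tendsto_def)
  have lim0: "(\<lambda>k. (norm e)\<^sup>2 * (\<integral>x. (norm (f k x - g x))\<^sup>2 \<partial>M)) \<longlonglongrightarrow> (norm e)\<^sup>2 * 0"
    using assms by (intro tendsto_intros) (auto simp: L2_tendsto_def)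
  have "(\<lambda>k. \<integral>x. (norm (f k x \<bullet> e - g x \<bullet> e))\<^sup>2 \<partial>M) \<longlonglongrightarrow> 0"
  proof (rule Lim_null_comparison[OF _ lim0[unfolded real_sqrt_zero mult_zero_right]])
    show "\<forall>\<^sub>F k in sequentially. norm (\<integral>x. (norm (f k x \<bullet> e - g x \<bullet> e))\<^sup>2 \<partial>M) \<le> (norm e)\<^sup>2 * (\<integral>x. (norm (f k x - g x))\<^sup>2 \<partial>M)"
    proof (rule always_eventually, rule allI)
      fix k
      have d: "L2 M (\<lambda>x. f k x - g x)" by (rule L2_diff[OF fk g])
      have "(\<integral>x. (norm ((f k x - g x) \<bullet> e))\<^sup>2 \<partial>M) \<le> (\<integral>x. (norm e)\<^sup>2 * (norm (f k x - g x))\<^sup>2 \<partial>M)"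
      proof (rule integral_mono)
        show "integrable M (\<lambda>x. (norm ((f k x - g x) \<bullet> e))\<^sup>2)" using L2_component[OF d] by (simp add: L2_def)
        show "integrable M (\<lambda>x. (norm e)\<^sup>2 * (norm (f k x - g x))\<^sup>2)" using d by (simp add: L2_def)
        fix x show "(norm ((f k x - g x) \<bullet> e))\<^sup>2 \<le> (norm e)\<^sup>2 * (norm (f k x - g x))\<^sup>2"
          using Cauchy_Schwarz_ineq[of "f k x - g x" e] by (simp add: power2_norm_eq_inner mult.commute)
      qed
      then show "norm (\<integral>x. (norm (f k x \<bullet> e - g x \<bullet> e))\<^sup>2 \<partial>M) \<le> (norm e)\<^sup>2 * (\<integral>x. (norm (f k x - g x))\<^sup>2 \<partial>M)"
        by (simp add: inner_diff_left)
    qed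
  qed
  then show ?thesis
    using L2_component[OF fk] L2_component[OF g] by (simp add: L2_tendsto_def)
qed

lemma L2_tendsto_diff:
  assumes "L2_tendsto M f g" "L2 M h"
  shows "L2_tendsto M (\<lambda>k x. f k x - h x) (\<lambda>x. g x - h x)"
  using assms by (auto simp: L2_tendsto_def intro: L2_diff)

lemma L2_tendsto_const: "L2 M f \<Longrightarrow> L2_tendsto M (\<lambda>k. f) f"
  by (simp add: L2_tendsto_def)

lemma L2_tendsto_integral_mult:
  fixes b :: "'a \<Rightarrow> real"
  assumes "L2_tendsto M f g" "L2 M b"
  shows "(\<lambda>k. \<integral>x. b x * (f k x \<bullet> e) \<partial>M) \<longlonglongrightarrow> (\<integral>x. b x * (g x \<bullet> e) \<partial>M)"
  using L2_tendsto_inner[OF L2_tendsto_component[OF assms(1), of e] assms(2)] by simp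

lemma L2_integrable_mult:
  fixes b :: "'a \<Rightarrow> real"
  assumes "L2 M f" "L2 M b"
  shows "integrable M (\<lambda>x. b x * (f x \<bullet> e))"
  using L2_integrable_inner(1)[OF assms(2) L2_component[OF assms(1), of e]] by simp

section \<open>Integration by parts for functions with a trace\<close>

context C1_domain begin

lemma L2_\<Omega>_continuous:
  fixes h :: "real^3 \<Rightarrow> 'b::euclidean_space"
  assumes "continuous_on UNIV h"
  shows "L2 (lebesgue_on \<Omega>) h"
  unfolding L2_def using assms
  by (auto intro!: borel_measurable_integrable integrable_\<Omega>_continuous continuous_intros)

lemma L2_S_continuous:
  fixes h :: "real^3 \<Rightarrow> 'b::euclidean_space"
  assumes "continuous_on (frontier \<Omega>) h"
  shows "L2 S h"
  unfolding L2_def using assms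
  by (auto intro!: continuous_on_frontier_measurable integrable_S_continuous continuous_intros)

text \<open>For the C1 approximations this is the divergence theorem for the product of
  \<open>\<zeta>\<close> and a component. Every term pairs an L2-convergent sequence with a fixed L2
  factor, so the identity survives the limits in \<open>has_trace\<close>.\<close>

lemma trace_divergence:
  assumes tr: "has_trace \<Omega> S u G t" and \<zeta>: "C1_gradient \<zeta> \<zeta>'"
  shows "(\<integral>x. \<zeta> x * (G x $ i \<bullet> e) \<partial>lebesgue_on \<Omega>) + (\<integral>x. (\<zeta>' x \<bullet> e) * u x $ i \<partial>lebesgue_on \<Omega>) =
     (\<integral>x. (\<zeta> x * (n x \<bullet> e)) * t x $ i \<partial>S)"
proof -
  obtain \<phi> :: "nat \<Rightarrow> real^3 \<Rightarrow> real^3" where \<phi>: "\<And>k. C_k 1 (\<phi> k)" 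
      and l1: "L2_tendsto (lebesgue_on \<Omega>) \<phi> u"
      and l2: "L2_tendsto (lebesgue_on \<Omega>) (\<lambda>k x. jacobian (\<phi> k) (at x)) G"
      and l3: "L2_tendsto S \<phi> t"
    using tr unfolding has_trace_def by blast
  have c\<zeta>: "continuous_on A \<zeta>" "continuous_on A \<zeta>'" for A
    by (rule C1_gradient_continuous[OF \<zeta>])+
  have L: "L2 (lebesgue_on \<Omega>) \<zeta>" "L2 (lebesgue_on \<Omega>) (\<lambda>x. \<zeta>' x \<bullet> e)" "L2 S (\<lambda>x. \<zeta> x * (n x \<bullet> e))"
    by (intro L2_\<Omega>_continuous L2_S_continuous continuous_intros c\<zeta> continuous_normal)+
  \<comment> \<open>Rows and entries become inner products with fixed matrices and vectors, the form
    in which the L2 pairing lemmas apply.\<close>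
  have row: "A $ i \<bullet> e = A \<bullet> axis i e" for A :: "real^3^3" by (simp add: inner_axis)
  have entry: "a $ i = a \<bullet> axis i 1" for a :: "real^3" by (simp add: inner_axis)
  have eq: "(\<integral>x. \<zeta> x * (jacobian (\<phi> k) (at x) $ i \<bullet> e) \<partial>lebesgue_on \<Omega>) + (\<integral>x. (\<zeta>' x \<bullet> e) * \<phi> k x $ i \<partial>lebesgue_on \<Omega>) =
     (\<integral>x. (\<zeta> x * (n x \<bullet> e)) * \<phi> k x $ i \<partial>S)" for k
  proof -
    have c: "C1_gradient (\<lambda>x. \<phi> k x $ i) (\<lambda>x. jacobian (\<phi> k) (at x) $ i)"
      by (rule C1_gradient_component[OF \<phi>])
    have ints: "integrable (lebesgue_on \<Omega>) (\<lambda>x. \<zeta> x * (jacobian (\<phi> k) (at x) $ i \<bullet> e))"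
      "integrable (lebesgue_on \<Omega>) (\<lambda>x. (\<zeta>' x \<bullet> e) * \<phi> k x $ i)"
      by (intro integrable_\<Omega>_continuous continuous_intros c\<zeta> C1_gradient_continuous[OF c])+
    show ?thesis
      using divergence_theorem[OF C1_gradient_mult[OF \<zeta> c], of e] ints
      by (simp add: inner_add_left mult_ac)
  qed
  show ?thesis
  proof (rule LIMSEQ_unique)
    show "(\<lambda>k. (\<integral>x. \<zeta> x * (jacobian (\<phi> k) (at x) $ i \<bullet> e) \<partial>lebesgue_on \<Omega>) + (\<integral>x. (\<zeta>' x \<bullet> e) * \<phi> k x $ i \<partial>lebesgue_on \<Omega>))
      \<longlonglongrightarrow> (\<integral>x. \<zeta> x * (G x $ i \<bullet> e) \<partial>lebesgue_on \<Omega>) + (\<integral>x. (\<zeta>' x \<bullet> e) * u x $ i \<partial>lebesgue_on \<Omega>)"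
      unfolding row entry
      by (intro tendsto_add L2_tendsto_integral_mult[OF l2] L2_tendsto_integral_mult[OF l1] L)
    show "(\<lambda>k. (\<integral>x. \<zeta> x * (jacobian (\<phi> k) (at x) $ i \<bullet> e) \<partial>lebesgue_on \<Omega>) + (\<integral>x. (\<zeta>' x \<bullet> e) * \<phi> k x $ i \<partial>lebesgue_on \<Omega>))
      \<longlonglongrightarrow> (\<integral>x. (\<zeta> x * (n x \<bullet> e)) * t x $ i \<partial>S)"
      unfolding eq unfolding entry by (intro L2_tendsto_integral_mult[OF l3] L)
  qed
qed

text \<open>If \<open>m\<close> is orthogonal to \<open>a\<close>, the field \<open>x \<mapsto> d (a \<bullet> x) m\<close> is divergence free in the sense of
  distributions, even if \<open>d\<close> is only continuous; difference quotients of an antiderivative of \<open>d\<close>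
  supply the \<open>C\<^sup>1\<close> approximations.\<close>

lemma trace_divergence_free:
  assumes tr: "has_trace \<Omega> S u G t" and v: "v C1_differentiable_on UNIV" and am: "a \<bullet> m = 0"
  shows "integrable (lebesgue_on \<Omega>) (\<lambda>x. deriv v (a \<bullet> x) * (G x $ i \<bullet> m))" (is ?i1)
    and "integrable S (\<lambda>x. deriv v (a \<bullet> x) * ((n x \<bullet> m) * t x $ i))" (is ?i2)
    and "(\<integral>x. deriv v (a \<bullet> x) * (G x $ i \<bullet> m) \<partial>lebesgue_on \<Omega>) =
     (\<integral>x. deriv v (a \<bullet> x) * ((n x \<bullet> m) * t x $ i) \<partial>S)" (is ?eq)
proof -
  have v': "(v has_real_derivative deriv v s) (at s)" for s
    using v by (auto simp: C1_differentiable_on_eq field_derivative_eq_vector_derivative[symmetric] 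
        DERIV_deriv_iff_real_differentiable)
  have cv': "continuous_on A (deriv v)" for A
  proof -
    have "continuous_on UNIV (deriv v)"
      using v by (simp add: C1_differentiable_on_eq field_derivative_eq_vector_derivative)
    then show ?thesis by (rule continuous_on_subset) simp
  qed
  have cv: "continuous_on A v" for A
    using v' by (meson DERIV_isCont continuous_at_imp_continuous_on)
  have LG: "L2 (lebesgue_on \<Omega>) G" and Lt: "L2 S t" using tr by (auto simp: has_trace_def L2_tendsto_def)
  have row: "A $ i \<bullet> m = A \<bullet> axis i m" for A :: "real^3^3" by (simp add: inner_axis)
  have entry: "a $ i = a \<bullet> axis i 1" for a :: "real^3" by (simp add: inner_axis)
  show ?i1
    unfolding row by (intro L2_integrable_mult[OF LG] L2_\<Omega>_continuous continuous_on_compose2[OF cv'[of UNIV]] continuous_intros) auto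
  have i2': "integrable S (\<lambda>x. (deriv v (a \<bullet> x) * (n x \<bullet> m)) * t x $ i)"
    unfolding entry by (intro L2_integrable_mult[OF Lt] L2_S_continuous continuous_on_compose2[OF cv'[of UNIV]] continuous_intros continuous_normal) auto
  then show ?i2 by (simp add: mult.assoc)
  define q where "q k s = of_nat (Suc k) * (v (s + 1 / of_nat (Suc k)) - v s)" for k :: nat and s :: real
  define q' where "q' k s = of_nat (Suc k) * (deriv v (s + 1 / of_nat (Suc k)) - deriv v s)" for k :: nat and s :: real
  have qd: "(q k has_real_derivative q' k s) (at s)" for k s
  proof -
    have "((\<lambda>s. v (s + 1 / of_nat (Suc k))) has_real_derivative deriv v (s + 1 / of_nat (Suc k))) (at s)"
      using v'[of "s + 1 / of_nat (Suc k)"] by (simp only: DERIV_shift)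
    then show ?thesis
      unfolding q_def q'_def by (intro DERIV_cmult DERIV_diff v')
  qed
  have cq': "continuous_on UNIV (q' k)" for k
    unfolding q'_def by (intro continuous_intros continuous_on_compose2[OF cv'[of UNIV]] cv') auto
  have cq: "continuous_on A (q k)" for k A
    unfolding q_def by (intro continuous_intros continuous_on_compose2[OF cv[of UNIV]] cv) auto
  \<comment> \<open>Every \<open>q k s\<close> is a value of \<open>deriv v\<close> less than 1 to
    the right of \<open>s\<close>. Hence the bound \<open>B\<close> of \<open>deriv v\<close> on the
    interval from \<open>- (R + 1)\<close> to \<open>R + 1\<close> dominates all difference
    quotients at once.\<close>
  have mvt: "\<exists>z. s < z \<and> z < s + 1 \<and> q k s = deriv v z" for k s
  proof -
    have "s < s + 1 / of_nat (Suc k)" by simp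
    from MVT2[OF this v'] obtain z where "s < z" "z < s + 1 / of_nat (Suc k)"
      "v (s + 1 / of_nat (Suc k)) - v s = 1 / of_nat (Suc k) * deriv v z" by auto
    moreover have "1 / of_nat (Suc k) \<le> (1::real)" by simp
    then have "z < s + 1" using calculation(2) by linarith
    ultimately show ?thesis by (intro exI[of _ z]) (auto simp: q_def)
  qed
  have lim: "(\<lambda>k. q k s) \<longlonglongrightarrow> deriv v s" for s
  proof -
    have "((\<lambda>h. (v (s + h) - v s) / h) \<longlongrightarrow> deriv v s) (at 0)" using v'[of s] by (simp add: DERIV_def)
    moreover have "filterlim (\<lambda>k. 1 / of_nat (Suc k) :: real) (at 0) sequentially"
      using LIMSEQ_inverse_real_of_nat by (auto simp: filterlim_at inverse_eq_divide)
    ultimately have "(\<lambda>k. (v (s + 1 / of_nat (Suc k)) - v s) / (1 / of_nat (Suc k))) \<longlonglongrightarrow> deriv v s"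
      by (rule filterlim_compose)
    then show ?thesis by (simp add: q_def mult.commute)
  qed
  obtain R where R: "\<And>x. x \<in> closure \<Omega> \<Longrightarrow> \<bar>a \<bullet> x\<bar> \<le> R"
  proof -
    have "bounded ((\<lambda>x. a \<bullet> x) ` closure \<Omega>)"
      using bounded_\<Omega> by (intro compact_imp_bounded compact_continuous_image continuous_intros) auto
    then obtain R where "\<forall>x\<in>closure \<Omega>. \<bar>a \<bullet> x\<bar> \<le> R" by (auto simp: bounded_iff)
    then show ?thesis using that by blast
  qed
  obtain B where B: "\<And>s. \<bar>s\<bar> \<le> R + 1 \<Longrightarrow> \<bar>deriv v s\<bar> \<le> B"
  proof -
    have "bounded (deriv v ` {- (R + 1)..R + 1})"
      by (intro compact_imp_bounded compact_continuous_image cv') auto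
    then obtain B where "\<forall>s\<in>{- (R + 1)..R + 1}. \<bar>deriv v s\<bar> \<le> B" by (auto simp: bounded_iff)
    then show ?thesis by (intro that[of B]) (auto simp: abs_le_iff)
  qed
  have qB: "\<bar>q k (a \<bullet> x)\<bar> \<le> B" if "x \<in> closure \<Omega>" for k x
  proof -
    obtain z where "a \<bullet> x < z" "z < a \<bullet> x + 1" "q k (a \<bullet> x) = deriv v z" using mvt by blast
    then show ?thesis using B[of z] R[OF that] by (auto simp: abs_le_iff)
  qed
  \<comment> \<open>Stated for a general measure because it serves the volume integral and the
    surface integral alike.\<close>
  have conv: "(\<lambda>k. \<integral>x. q k (a \<bullet> x) * h x \<partial>M) \<longlonglongrightarrow> (\<integral>x. deriv v (a \<bullet> x) * h x \<partial>M)"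
    if M: "\<And>h :: real^3 \<Rightarrow> real. continuous_on UNIV h \<Longrightarrow> h \<in> borel_measurable M" "space M \<subseteq> closure \<Omega>"
      and h: "integrable M h" for M :: "(real^3) measure" and h
  proof (rule integral_dominated_convergence)
    have [measurable]: "h \<in> borel_measurable M" using h by simp
    have [measurable]: "(\<lambda>x. deriv v (a \<bullet> x)) \<in> borel_measurable M"
      by (intro M continuous_on_compose2[OF cv'[of UNIV]] continuous_intros) auto
    have [measurable]: "(\<lambda>x. q k (a \<bullet> x)) \<in> borel_measurable M" for k
      by (intro M continuous_on_compose2[OF cq[of UNIV]] continuous_intros) auto
    show "(\<lambda>x. deriv v (a \<bullet> x) * h x) \<in> borel_measurable M" "\<And>k. (\<lambda>x. q k (a \<bullet> x) * h x) \<in> borel_measurable M"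
      by measurable
    show "integrable M (\<lambda>x. B * norm (h x))" using h by simp
    show "AE x in M. (\<lambda>k. q k (a \<bullet> x) * h x) \<longlonglongrightarrow> deriv v (a \<bullet> x) * h x"
      by (intro AE_I2 tendsto_intros lim)
    show "AE x in M. norm (q k (a \<bullet> x) * h x) \<le> B * norm (h x)" for k
    proof (rule AE_I2)
      fix x assume "x \<in> space M"
      then show "norm (q k (a \<bullet> x) * h x) \<le> B * norm (h x)"
        using qB[of x k] M(2) by (auto simp: abs_mult intro!: mult_right_mono)
    qed
  qed
  \<comment> \<open>The gradient of \<open>q k (a \<bullet> x)\<close> is a multiple of
    \<open>a\<close>, hence orthogonal to \<open>m\<close>, and the term that contains
    \<open>u\<close> drops out.\<close>
  have eq: "(\<integral>x. q k (a \<bullet> x) * (G x $ i \<bullet> m) \<partial>lebesgue_on \<Omega>) = (\<integral>x. q k (a \<bullet> x) * ((n x \<bullet> m) * t x $ i) \<partial>S)" for k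
    using trace_divergence[OF tr C1_gradient_compose[OF C1_gradient_inner[of a] qd cq'], of k i m] am
    by (simp add: mult.assoc)
  show ?eq
  proof (rule LIMSEQ_unique)
    show "(\<lambda>k. \<integral>x. q k (a \<bullet> x) * (G x $ i \<bullet> m) \<partial>lebesgue_on \<Omega>) \<longlonglongrightarrow> (\<integral>x. deriv v (a \<bullet> x) * (G x $ i \<bullet> m) \<partial>lebesgue_on \<Omega>)"
    proof (rule conv)
      show "integrable (lebesgue_on \<Omega>) (\<lambda>x. G x $ i \<bullet> m)"
        using L2_integrable_mult[OF LG L2_\<Omega>_continuous[OF continuous_on_const[of _ 1]], of "axis i m"]
        by (simp add: inner_axis)
    qed (use closure_subset[of \<Omega>] in \<open>auto simp: space_restrict_space intro: L2_measurable L2_\<Omega>_continuous\<close>)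
    show "(\<lambda>k. \<integral>x. q k (a \<bullet> x) * (G x $ i \<bullet> m) \<partial>lebesgue_on \<Omega>) \<longlonglongrightarrow> (\<integral>x. deriv v (a \<bullet> x) * ((n x \<bullet> m) * t x $ i) \<partial>S)"
      unfolding eq
    proof (rule conv)
      show "integrable S (\<lambda>x. (n x \<bullet> m) * t x $ i)"
        unfolding entry by (intro L2_integrable_mult[OF Lt] L2_S_continuous continuous_intros continuous_normal)
    qed (auto simp: space_S frontier_def intro!: continuous_on_frontier_measurable intro: continuous_on_subset)
  qed
qed

end

subsection \<open>Nonnegativity on rank-one matrices\<close>

text \<open>Multiplied by \<open>a\<close>, the form is a square plus the determinant times
  \<open>z\<^sup>2\<close>; if \<open>a\<close> is 0, the hypothesis forces \<open>b\<close> to be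
  0.\<close>

lemma binary_quadratic_form_nonneg:
  fixes a b c x z :: real
  assumes "a \<ge> 0" "c \<ge> 0" "b\<^sup>2 \<le> a * c"
  shows "a * x\<^sup>2 - 2 * b * x * z + c * z\<^sup>2 \<ge> 0"
proof (cases "a = 0")
  case True
  then show ?thesis using assms by simp
next
  case False
  have "a * (a * x\<^sup>2 - 2 * b * x * z + c * z\<^sup>2) = (a * x - b * z)\<^sup>2 + (a * c - b\<^sup>2) * z\<^sup>2"
    by (simp add: power2_eq_square algebra_simps)
  also have "\<dots> \<ge> 0" using assms by simp
  finally show ?thesis using False assms by (simp add: zero_le_mult_iff)
qed

text \<open>This is the inequality of arithmetic and geometric means, since the three terms on the
  left have product (ABC)^3. The proof reads the difference as a quadratic in \<open>C\<close>: if
  \<open>A\<close> is at least \<open>3 * B\<close>, its coefficients are nonnegative; otherwise the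
  square is completed, and the remainder factors as
  \<open>A * (A - B)\<^sup>2 * (4 * B - A)\<close>.\<close>

lemma cyclic_cubic_nonneg:
  fixes A B C :: real
  assumes "A \<ge> 0" "B \<ge> 0" "C \<ge> 0"
  shows "A\<^sup>2 * C + A * B\<^sup>2 + B * C\<^sup>2 \<ge> 3 * A * B * C"
proof (cases "A < 3 * B")
  case False
  then have "3 * B * (A * C) \<le> A * (A * C)" using assms by (intro mult_right_mono) auto
  moreover have "0 \<le> A * B\<^sup>2 + B * C\<^sup>2" using assms by simp
  ultimately show ?thesis by (simp add: power2_eq_square algebra_simps)
next
  case True
  have "4 * B * (A\<^sup>2 * C + A * B\<^sup>2 + B * C\<^sup>2 - 3 * A * B * C) =
      (2 * B * C + A\<^sup>2 - 3 * A * B)\<^sup>2 + A * (A - B)\<^sup>2 * (4 * B - A)"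
    by (simp add: power2_eq_square algebra_simps)
  also have "\<dots> \<ge> 0" using assms True by simp
  finally show ?thesis using assms True by (simp add: zero_le_mult_iff)
qed

text \<open>On rank-one matrices \<open>Q\<close> is quadratic in \<open>x1\<close> with leading
  coefficient \<open>p\<close>. Completing the square there, after multiplication by
  \<open>p\<close>, leaves a binary form in \<open>x2\<close> and \<open>x3\<close> with
  coefficients \<open>\<alpha>\<close>, \<open>\<beta>\<close>, \<open>\<gamma>\<close>. Its
  determinant is \<open>p\<close> times the cyclic cubic expression in the squares of the
  \<open>y\<close>'s. If \<open>p\<close> is 0, only squares remain.\<close>

lemma Q_rank_one_nonneg:
  assumes "\<And>i j. \<xi> $ i $ j = a $ i * b $ j"
  shows "Q \<xi> \<ge> 0"
proof -
  define x1 x2 x3 y1 y2 y3 where xy: "x1 = a$1" "x2 = a$2" "x3 = a$3" "y1 = b$1" "y2 = b$2" "y3 = b$3"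
  define p where "p = y1\<^sup>2 + y2\<^sup>2"
  define \<alpha> where "\<alpha> = y1\<^sup>2 * y3\<^sup>2 + (y2\<^sup>2)\<^sup>2 + y2\<^sup>2 * y3\<^sup>2"
  define \<beta> where "\<beta> = y2 * y3 * (2 * y1\<^sup>2 + y2\<^sup>2)"
  define \<gamma> where "\<gamma> = (y1\<^sup>2)\<^sup>2 + y2\<^sup>2 * y3\<^sup>2 + y1\<^sup>2 * y2\<^sup>2"
  have Q: "Q \<xi> = x1\<^sup>2 * y1\<^sup>2 + x2\<^sup>2 * y2\<^sup>2 + x3\<^sup>2 * y3\<^sup>2 - 2 * x1 * y1 * x2 * y2 - 2 * x2 * y2 * x3 * y3
    - 2 * x3 * y3 * x1 * y1 + x1\<^sup>2 * y2\<^sup>2 + x2\<^sup>2 * y3\<^sup>2 + x3\<^sup>2 * y1\<^sup>2"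
    by (simp add: Q_def assms xy power_mult_distrib)
  show ?thesis
  proof (cases "p = 0")
    case True
    then have "y1 = 0" "y2 = 0" by (auto simp: p_def sum_power2_eq_zero_iff)
    then show ?thesis by (simp add: Q)
  next
    case False
    have "0 \<le> p * ((y1\<^sup>2)\<^sup>2 * y3\<^sup>2 + y1\<^sup>2 * (y2\<^sup>2)\<^sup>2 + y2\<^sup>2 * (y3\<^sup>2)\<^sup>2 - 3 * y1\<^sup>2 * y2\<^sup>2 * y3\<^sup>2)"
      using cyclic_cubic_nonneg[of "y1\<^sup>2" "y2\<^sup>2" "y3\<^sup>2"] by (simp add: p_def)
    also have "\<dots> = \<alpha> * \<gamma> - \<beta>\<^sup>2"
      by (simp add: p_def \<alpha>_def \<beta>_def \<gamma>_def power2_eq_square algebra_simps)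
    finally have "\<alpha> * x2\<^sup>2 - 2 * \<beta> * x2 * x3 + \<gamma> * x3\<^sup>2 \<ge> 0"
      by (intro binary_quadratic_form_nonneg) (auto simp: \<alpha>_def \<gamma>_def)
    then have "0 \<le> (p * x1 - y1 * (y2 * x2 + y3 * x3))\<^sup>2 + (\<alpha> * x2\<^sup>2 - 2 * \<beta> * x2 * x3 + \<gamma> * x3\<^sup>2)"
      by simp
    also have "\<dots> = p * Q \<xi>"
      by (simp add: Q p_def \<alpha>_def \<beta>_def \<gamma>_def power2_eq_square algebra_simps)
    finally have "0 \<le> p * Q \<xi>" .
    moreover have "p > 0" using False by (simp add: p_def less_le)
    ultimately show ?thesis by (simp add: zero_le_mult_iff)
  qed
qed

subsection \<open>Gaussian averages of Fourier coefficients\<close>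

lemma integrable_product:
  fixes f :: "'a \<Rightarrow> 'c::{real_normed_field,banach,second_countable_topology}" and g :: "'b \<Rightarrow> 'c"
  assumes f: "integrable M f" and g: "integrable N g" and s: "sigma_finite_measure M" "sigma_finite_measure N"
  shows "integrable (M \<Otimes>\<^sub>M N) (\<lambda>z. f (fst z) * g (snd z))"
    and "(\<integral>z. f (fst z) * g (snd z) \<partial>(M \<Otimes>\<^sub>M N)) = (\<integral>x. f x \<partial>M) * (\<integral>y. g y \<partial>N)"
proof -
  interpret pair_sigma_finite M N using s by (simp add: pair_sigma_finite_def)
  have [measurable]: "f \<in> borel_measurable M" "g \<in> borel_measurable N" using f g by auto
  show i: "integrable (M \<Otimes>\<^sub>M N) (\<lambda>z. f (fst z) * g (snd z))"
    using f g by (intro Fubini_integrable) (auto simp: norm_mult)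
  show "(\<integral>z. f (fst z) * g (snd z) \<partial>(M \<Otimes>\<^sub>M N)) = (\<integral>x. f x \<partial>M) * (\<integral>y. g y \<partial>N)"
    using integral_fst'[OF i] by simp
qed

text \<open>The standard Gaussian law on frequencies, built as a product so that its characteristic
  function factorises; \<open>tri\<close> turns a sample into a vector.\<close>

definition gauss3 :: "((real \<times> real) \<times> real) measure" where
  "gauss3 = (std_normal_distribution \<Otimes>\<^sub>M std_normal_distribution) \<Otimes>\<^sub>M std_normal_distribution"

lemma prob_space_std_normal: "prob_space std_normal_distribution"
  using real_dist_normal_dist by (simp add: real_distribution_def)

lemma prob_space_gauss3: "prob_space gauss3"
proof -
  interpret N: prob_space std_normal_distribution by (rule prob_space_std_normal)
  interpret N2: pair_prob_space std_normal_distribution std_normal_distribution ..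
  interpret N3: pair_prob_space "std_normal_distribution \<Otimes>\<^sub>M std_normal_distribution" std_normal_distribution ..
  show ?thesis unfolding gauss3_def by (rule N3.prob_space_axioms)
qed

lemma sets_gauss3: "sets gauss3 = sets borel"
proof -
  have "sets gauss3 = sets ((borel \<Otimes>\<^sub>M borel) \<Otimes>\<^sub>M borel :: ((real \<times> real) \<times> real) measure)"
    unfolding gauss3_def by (intro sets_pair_measure_cong) auto
  then show ?thesis by (simp only: borel_prod)
qed

text \<open>The real part of the characteristic function, which is the product of three
  one-dimensional Gaussian characteristic functions.\<close>

lemma gauss3_cos: "(\<integral>\<kappa>. cos (tri \<kappa> \<bullet> z) \<partial>gauss3) = exp (- (z \<bullet> z) / 2)"
proof -
  interpret N: prob_space std_normal_distribution by (rule prob_space_std_normal)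
  interpret N2: pair_prob_space std_normal_distribution std_normal_distribution ..
  have ch: "(\<integral>x. iexp (t * x) \<partial>std_normal_distribution) = complex_of_real (exp (- (t\<^sup>2) / 2))" for t
    using char_std_normal_distribution by (simp add: char_def fun_eq_iff)
  have i: "integrable std_normal_distribution (\<lambda>x. iexp (t * x))" for t
    by (rule N.integrable_const_bound[of _ 1]) auto
  define F where "F p = iexp (z$1 * fst p) * iexp (z$2 * snd p)" for p :: "real \<times> real"
  note F = integrable_product[OF i i N.sigma_finite_measure_axioms N.sigma_finite_measure_axioms, of "z$1" "z$2", folded F_def]
  note G = integrable_product[OF F(1) i N2.sigma_finite_measure_axioms N.sigma_finite_measure_axioms, of "z$3"]
  have e: "F (fst \<kappa>) * iexp (z$3 * snd \<kappa>) = iexp (tri \<kappa> \<bullet> z)" for \<kappa>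
    by (simp add: F_def inner_commute[of _ z] inner_tri exp_add[symmetric] algebra_simps)
  have "(\<integral>\<kappa>. Re (iexp (tri \<kappa> \<bullet> z)) \<partial>gauss3) = Re (\<integral>\<kappa>. iexp (tri \<kappa> \<bullet> z) \<partial>gauss3)"
    using G(1) unfolding e gauss3_def[symmetric] by (rule integral_Re)
  also have "\<dots> = exp (- ((z$1)\<^sup>2) / 2) * exp (- ((z$2)\<^sup>2) / 2) * exp (- ((z$3)\<^sup>2) / 2)"
    using G(2) unfolding e gauss3_def[symmetric] F(2) ch by simp
  also have "\<dots> = exp (- (z \<bullet> z) / 2)"
    by (simp add: exp_add[symmetric] inner_vec_def sum_3 power2_eq_square add_divide_distrib)
  finally show ?thesis by (simp add: Re_exp)
qed

text \<open>Real and imaginary parts (up to sign) of the Fourier coefficient are kept apart, because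
  \<open>Q\<close> acts on real matrices and both parts are of rank one for the gradients in
  question.\<close>

definition fourier_cos :: "(real^3) measure \<Rightarrow> (real^3 \<Rightarrow> real) \<Rightarrow> real^3 \<Rightarrow> real" where
  "fourier_cos M f k = (\<integral>x. f x * cos (k \<bullet> x) \<partial>M)"

definition fourier_sin :: "(real^3) measure \<Rightarrow> (real^3 \<Rightarrow> real) \<Rightarrow> real^3 \<Rightarrow> real" where
  "fourier_sin M f k = (\<integral>x. f x * sin (k \<bullet> x) \<partial>M)"

text \<open>The addition formula turns the product of coefficients into a double integral of cos(k .
  (x - y)). Fubini then moves the average over frequencies inside, where \<open>gauss3_cos\<close>
  evaluates it. Boundedness of the cosine provides all the integrability.\<close>

lemma gauss3_fourier:
  assumes M: "sigma_finite_measure M" and id: "(\<lambda>x. x) \<in> borel_measurable M"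
    and f: "integrable M f" and g: "integrable M g"
  defines "F \<equiv> \<lambda>k. fourier_cos M f k * fourier_cos M g k + fourier_sin M f k * fourier_sin M g k"
  shows "integrable gauss3 (\<lambda>\<kappa>. F (s *\<^sub>R tri \<kappa>))"
    and "(\<integral>\<kappa>. F (s *\<^sub>R tri \<kappa>) \<partial>gauss3) =
      (\<integral>z. f (fst z) * g (snd z) * exp (- (s\<^sup>2 * ((fst z - snd z) \<bullet> (fst z - snd z))) / 2) \<partial>(M \<Otimes>\<^sub>M M))"
proof -
  note [measurable] = id
  have [measurable]: "f \<in> borel_measurable M" "g \<in> borel_measurable M" using f g by auto
  interpret M: sigma_finite_measure M by fact
  interpret MM: pair_sigma_finite M M ..
  interpret G: prob_space gauss3 by (rule prob_space_gauss3)
  interpret GM: pair_sigma_finite gauss3 "M \<Otimes>\<^sub>M M" ..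
  have [measurable]: "tri \<in> borel_measurable gauss3"
    using measurable_tri by (simp add: measurable_cong_sets[OF sets_gauss3 refl])
  note fg = integrable_product[OF f g M M]
  have bound: "integrable M (\<lambda>x. h x * c x)"
    if h: "integrable M h" and [measurable]: "c \<in> borel_measurable M" and c: "\<And>x. \<bar>c x\<bar> \<le> 1" for h c :: "real^3 \<Rightarrow> real"
  proof (rule Bochner_Integration.integrable_bound[OF h])
    show "(\<lambda>x. h x * c x) \<in> borel_measurable M" using h by measurable
    show "AE x in M. norm (h x * c x) \<le> norm (h x)"
      using c by (intro AE_I2) (simp add: abs_mult mult_left_le)
  qed
  define P where "P \<kappa> z = f (fst z) * g (snd z) * cos (s *\<^sub>R tri \<kappa> \<bullet> (fst z - snd z))" for \<kappa> z
  have FP: "F (s *\<^sub>R tri \<kappa>) = (\<integral>z. P \<kappa> z \<partial>(M \<Otimes>\<^sub>M M))" for \<kappa>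
  proof -
    let ?k = "s *\<^sub>R tri \<kappa>"
    have i: "integrable M (\<lambda>x. f x * cos (?k \<bullet> x))" "integrable M (\<lambda>x. f x * sin (?k \<bullet> x))"
      "integrable M (\<lambda>x. g x * cos (?k \<bullet> x))" "integrable M (\<lambda>x. g x * sin (?k \<bullet> x))"
      by (intro bound f g; simp)+
    have "F ?k = (\<integral>z. (f (fst z) * cos (?k \<bullet> fst z)) * (g (snd z) * cos (?k \<bullet> snd z)) \<partial>(M \<Otimes>\<^sub>M M))
        + (\<integral>z. (f (fst z) * sin (?k \<bullet> fst z)) * (g (snd z) * sin (?k \<bullet> snd z)) \<partial>(M \<Otimes>\<^sub>M M))"
      by (simp only: integrable_product(2)[OF i(1) i(3) M M] integrable_product(2)[OF i(2) i(4) M M] F_def fourier_cos_def fourier_sin_def)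
    also have "\<dots> = (\<integral>z. P \<kappa> z \<partial>(M \<Otimes>\<^sub>M M))"
      unfolding Bochner_Integration.integral_add[OF integrable_product(1)[OF i(1) i(3) M M] integrable_product(1)[OF i(2) i(4) M M], symmetric]
      by (intro Bochner_Integration.integral_cong refl) (simp add: P_def inner_diff_right cos_diff right_diff_distrib algebra_simps)
    finally show ?thesis .
  qed
  have P: "integrable (gauss3 \<Otimes>\<^sub>M (M \<Otimes>\<^sub>M M)) (\<lambda>y. P (fst y) (snd y))"
  proof (rule Bochner_Integration.integrable_bound)
    show "integrable (gauss3 \<Otimes>\<^sub>M (M \<Otimes>\<^sub>M M)) (\<lambda>y. 1 * (f (fst (snd y)) * g (snd (snd y))))"
      by (rule integrable_product(1)[OF _ fg(1) G.sigma_finite_measure_axioms MM.sigma_finite_measure_axioms]) simp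
    show "(\<lambda>y. P (fst y) (snd y)) \<in> borel_measurable (gauss3 \<Otimes>\<^sub>M (M \<Otimes>\<^sub>M M))"
      unfolding P_def by measurable
    show "AE y in gauss3 \<Otimes>\<^sub>M (M \<Otimes>\<^sub>M M). norm (P (fst y) (snd y)) \<le> norm (1 * (f (fst (snd y)) * g (snd (snd y))))"
      unfolding P_def by (intro AE_I2) (simp add: abs_mult mult_left_le)
  qed
  show "integrable gauss3 (\<lambda>\<kappa>. F (s *\<^sub>R tri \<kappa>))"
    using GM.integrable_fst'[OF P] by (simp add: FP)
  have "(\<integral>\<kappa>. F (s *\<^sub>R tri \<kappa>) \<partial>gauss3) = (\<integral>z. (\<integral>\<kappa>. P \<kappa> z \<partial>gauss3) \<partial>(M \<Otimes>\<^sub>M M))"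
    unfolding FP using GM.Fubini_integral[of P] P by (simp add: case_prod_beta')
  also have "(\<lambda>z. \<integral>\<kappa>. P \<kappa> z \<partial>gauss3) = (\<lambda>z. f (fst z) * g (snd z) * exp (- (s\<^sup>2 * ((fst z - snd z) \<bullet> (fst z - snd z))) / 2))"
  proof
    fix z :: "(real^3) \<times> (real^3)"
    show "(\<integral>\<kappa>. P \<kappa> z \<partial>gauss3) = f (fst z) * g (snd z) * exp (- (s\<^sup>2 * ((fst z - snd z) \<bullet> (fst z - snd z))) / 2)"
      using gauss3_cos[of "s *\<^sub>R (fst z - snd z)"] by (simp add: P_def power2_eq_square mult.assoc)
  qed
  finally show "(\<integral>\<kappa>. F (s *\<^sub>R tri \<kappa>) \<partial>gauss3) =
      (\<integral>z. f (fst z) * g (snd z) * exp (- (s\<^sup>2 * ((fst z - snd z) \<bullet> (fst z - snd z))) / 2) \<partial>(M \<Otimes>\<^sub>M M))" .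
qed

subsection \<open>The Gaussian approximate identity\<close>

definition gauss_density :: "real^3 \<Rightarrow> real" where
  "gauss_density z = exp (- (z \<bullet> z) / 2) / (sqrt (2 * pi)) ^ 3"

text \<open>The Gaussian probability density of width 1/m. Frequencies on scale \<open>m\<close>
  average to exactly this kernel up to its normalisation.\<close>

definition gauss_kernel :: "real \<Rightarrow> real^3 \<Rightarrow> real" where
  "gauss_kernel m z = m ^ 3 * gauss_density (m *\<^sub>R z)"

lemma gauss_density_nonneg: "0 \<le> gauss_density z" and gauss_density_minus: "gauss_density (- z) = gauss_density z"
  by (simp_all add: gauss_density_def)

lemma continuous_gauss_density: "continuous_on A gauss_density"
  unfolding gauss_density_def by (intro continuous_intros) auto

lemma measurable_gauss_density [measurable]: "gauss_density \<in> borel_measurable borel"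
  by (rule borel_measurable_continuous_onI[OF continuous_gauss_density])

lemma measurable_gauss_kernel [measurable]: "gauss_kernel m \<in> borel_measurable borel"
  unfolding gauss_kernel_def by measurable

lemma integral_gauss_density: "integrable lborel gauss_density" "(\<integral>z. gauss_density z \<partial>lborel) = 1"
proof -
  define N where "N = std_normal_density"
  have N: "integrable lborel N" "(\<integral>x. N x \<partial>lborel) = 1"
    unfolding N_def by (simp_all add: integrable_normal_density integral_normal_density)
  have s: "sigma_finite_measure (lborel :: 'a::euclidean_space measure)" by (rule sigma_finite_lborel)
  note F = integrable_product[OF N(1) N(1) s s, unfolded lborel_prod]
  note G = integrable_product[OF F(1) N(1) s s, unfolded lborel_prod]
  have e: "N (fst (fst y)) * N (snd (fst y)) * N (snd y) = gauss_density (tri y)" for y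
    by (simp add: N_def gauss_density_def std_normal_density_def inner_tri power3_eq_cube exp_add[symmetric] field_simps)
       (simp add: power2_eq_square)
  show "integrable lborel gauss_density"
    using G(1) unfolding e by (subst lborel_tri) (simp add: integrable_distr_eq)
  show "(\<integral>z. gauss_density z \<partial>lborel) = 1"
    using G(2) unfolding e F(2) N(2) by (subst lborel_tri) (simp add: integral_distr)
qed

text \<open>The substitution y = x - z/m has Jacobian 1/m^3, which cancels the factor in the kernel.
  Afterwards the weight is independent of \<open>m\<close>, as dominated convergence wants
  it.\<close>

lemma integral_scaled:
  fixes h :: "real^3 \<Rightarrow> real"
  assumes m: "m > 0" and h [measurable]: "h \<in> borel_measurable borel"
  shows "(\<integral>y. h y * gauss_kernel m (x - y) \<partial>lborel) = (\<integral>z. h (x - z /\<^sub>R m) * gauss_density z \<partial>lborel)"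
    and "integrable lborel (\<lambda>z. h (x - z /\<^sub>R m) * gauss_density z) \<Longrightarrow> integrable lborel (\<lambda>y. h y * gauss_kernel m (x - y))"
proof -
  have aff: "(lborel :: (real^3) measure) = density (distr lborel borel (\<lambda>z. x + (- (1/m)) *\<^sub>R z)) (\<lambda>_. ennreal ((1/m) ^ 3))"
    using lborel_affine[of "- (1/m)" x] m by (simp add: ennreal_power)
  have mm: "(1/m) ^ 3 * m ^ 3 = 1" using m by (simp add: power_mult_distrib[symmetric])
  have e: "(1/m) ^ 3 * (h (x + (- (1/m)) *\<^sub>R z) * gauss_kernel m (x - (x + (- (1/m)) *\<^sub>R z))) = h (x - z /\<^sub>R m) * gauss_density z" for z
    using m mm by (simp add: gauss_kernel_def divide_inverse_commute)
  show "(\<integral>y. h y * gauss_kernel m (x - y) \<partial>lborel) = (\<integral>z. h (x - z /\<^sub>R m) * gauss_density z \<partial>lborel)"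
    using m by (subst aff) (simp add: integral_density integral_distr e[symmetric] del: integral_mult_right_zero)
  show "integrable lborel (\<lambda>y. h y * gauss_kernel m (x - y))" if i: "integrable lborel (\<lambda>z. h (x - z /\<^sub>R m) * gauss_density z)"
  proof (subst aff, subst integrable_density)
    show "integrable (distr lborel borel (\<lambda>z. x + (- (1/m)) *\<^sub>R z)) (\<lambda>y. (1/m)^3 *\<^sub>R (h y * gauss_kernel m (x - y)))"
      by (subst integrable_distr_eq) (use i e in simp_all)
  qed (use m in auto)
qed

lemma gauss_kernel_nonneg: "m > 0 \<Longrightarrow> 0 \<le> gauss_kernel m z"
  by (simp add: gauss_kernel_def gauss_density_nonneg)

lemma gauss_kernel_minus: "gauss_kernel m (x - y) = gauss_kernel m (y - x)"
  unfolding gauss_kernel_def using gauss_density_minus[of "m *\<^sub>R (x - y)"] by (simp add: scaleR_diff_right)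

lemma gauss_kernel_le:
  assumes "m > 0"
  shows "\<bar>gauss_kernel m z\<bar> \<le> m ^ 3"
proof -
  have "1 \<le> sqrt (2 * pi)" using pi_gt3 by simp
  then have 1: "1 \<le> sqrt (2 * pi) ^ 3" by (rule one_le_power)
  have exp_le: "exp (- (w \<bullet> w) / 2) \<le> 1" for w :: "real^3" by simp
  then have "gauss_density w \<le> 1" for w using 1 unfolding gauss_density_def using order_trans[OF exp_le 1] by simp
  then show ?thesis using assms gauss_density_nonneg[of "m *\<^sub>R z"] by (simp add: gauss_kernel_def abs_mult mult_left_le)
qed

lemma gauss_kernel_integral:
  assumes "m > 0"
  shows "integrable lborel (\<lambda>y. gauss_kernel m (x - y))" "(\<integral>y. gauss_kernel m (x - y) \<partial>lborel) = 1"
  using integral_scaled[OF assms, of "\<lambda>_. 1" x] integral_gauss_density by simp_all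

section \<open>The smoothed pairing and its limit\<close>

locale bounded_open_set =
  fixes \<Omega> :: "(real^3) set"
  assumes op: "open \<Omega>" and bd: "bounded \<Omega>"
begin

abbreviation "M \<equiv> lebesgue_on \<Omega>"

lemma measurable_\<Omega> [measurable]: "\<Omega> \<in> sets borel" using op by simp

lemma finite_M: "finite_measure M"
  using bd op by (intro finite_measure_lebesgue_on bounded_set_imp_lmeasurable) auto

lemma id_M [measurable]: "(\<lambda>x. x) \<in> borel_measurable M"
  by (intro measurable_restrict_space1 measurable_completion) simp

lemma sigma_M: "sigma_finite_measure M"
  using finite_M by (simp add: finite_measure_def)

sublocale MM: pair_sigma_finite M M
  using sigma_M by (simp add: pair_sigma_finite_def)

text \<open>The pairing of \<open>f\<close> with the Gaussian convolution of \<open>g\<close>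
  extended by 0. The double integral makes it bilinear and matches the Gaussian frequency average
  term by term.\<close>

definition smoothed :: "real \<Rightarrow> (real^3 \<Rightarrow> real) \<Rightarrow> (real^3 \<Rightarrow> real) \<Rightarrow> real" where
  "smoothed m f g = (\<integral>z. f (fst z) * g (snd z) * gauss_kernel m (fst z - snd z) \<partial>(M \<Otimes>\<^sub>M M))"

lemma integrable_gauss_kernel:
  assumes f: "integrable M f" and g: "integrable M g" and m: "m > 0"
  shows "integrable (M \<Otimes>\<^sub>M M) (\<lambda>z. f (fst z) * g (snd z) * gauss_kernel m (fst z - snd z))"
proof (rule Bochner_Integration.integrable_bound)
  have [measurable]: "f \<in> borel_measurable M" "g \<in> borel_measurable M" using f g by auto
  show "integrable (M \<Otimes>\<^sub>M M) (\<lambda>z. m ^ 3 * (f (fst z) * g (snd z)))"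
    using integrable_product(1)[OF f g sigma_M sigma_M] by simp
  show "(\<lambda>z. f (fst z) * g (snd z) * gauss_kernel m (fst z - snd z)) \<in> borel_measurable (M \<Otimes>\<^sub>M M)"
    by measurable
  show "AE z in M \<Otimes>\<^sub>M M. norm (f (fst z) * g (snd z) * gauss_kernel m (fst z - snd z)) \<le> norm (m ^ 3 * (f (fst z) * g (snd z)))"
    using gauss_kernel_le[OF m] m by (intro AE_I2) (auto simp: abs_mult mult.commute intro!: mult_right_mono)
qed

lemma integral_gauss_kernel_le_1:
  assumes m: "m > 0"
  shows "(\<integral>y. gauss_kernel m (x - y) \<partial>M) \<le> 1"
proof -
  have "(\<integral>y. gauss_kernel m (x - y) \<partial>M) = (\<integral>y. indicator \<Omega> y *\<^sub>R gauss_kernel m (x - y) \<partial>lborel)"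
    by (rule integral_lebesgue_on_borel) auto
  also have "\<dots> \<le> (\<integral>y. gauss_kernel m (x - y) \<partial>lborel)"
    using gauss_kernel_nonneg[OF m] gauss_kernel_integral(1)[OF m, of x]
    by (intro integral_mono integrable_mult_indicator) (auto simp: indicator_def)
  finally show ?thesis using gauss_kernel_integral(2)[OF m] by simp
qed

lemma L2_integrable_M:
  assumes "L2 M f" shows "integrable M (f :: real^3 \<Rightarrow> real)"
proof -
  interpret finite_measure M by (rule finite_M)
  have "L2 M (\<lambda>x. 1::real)" by (simp add: L2_def)
  from L2_integrable_inner(1)[OF assms this] show ?thesis by simp
qed

text \<open>Schur's test: the kernel is shared as square roots between the two factors of
  Cauchy-Schwarz, and in each factor the free variable integrates to at most 1. What matters is that
  the bound does not depend on \<open>m\<close>.\<close>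

lemma smoothed_bound:
  assumes f: "L2 M f" and g: "L2 M g" and m: "m > 0"
  shows "\<bar>smoothed m f g\<bar> \<le> sqrt (\<integral>x. (f x)\<^sup>2 \<partial>M) * sqrt (\<integral>x. (g x)\<^sup>2 \<partial>M)"
proof -
  interpret finite_measure M by (rule finite_M)
  have [measurable]: "f \<in> borel_measurable M" "g \<in> borel_measurable M"
    and f2: "integrable M (\<lambda>x. (f x)\<^sup>2)" and g2: "integrable M (\<lambda>x. (g x)\<^sup>2)"
    using f g by (auto simp: L2_def)
  define K where "K z = gauss_kernel m (fst z - snd z)" for z :: "(real^3) \<times> (real^3)"
  have K0: "K z \<ge> 0" for z by (simp add: K_def gauss_kernel_nonneg m)
  have [measurable]: "K \<in> borel_measurable (M \<Otimes>\<^sub>M M)" unfolding K_def by measurable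
  have 1: "integrable (M \<Otimes>\<^sub>M M) (\<lambda>z. (f (fst z))\<^sup>2 * K z)"
    using integrable_gauss_kernel[OF f2 _ m, of "\<lambda>_. 1"] by (simp add: K_def)
  have 2: "integrable (M \<Otimes>\<^sub>M M) (\<lambda>z. (g (snd z))\<^sup>2 * K z)"
    using integrable_gauss_kernel[OF _ g2 m, of "\<lambda>_. 1"] by (simp add: K_def)
  have "L2 (M \<Otimes>\<^sub>M M) (\<lambda>z. f (fst z) * sqrt (K z))" "L2 (M \<Otimes>\<^sub>M M) (\<lambda>z. g (snd z) * sqrt (K z))"
    using 1 2 K0 by (simp_all add: L2_def power_mult_distrib)
  note CS = L2_Cauchy_Schwarz[OF this]
  have eq: "f (fst z) * sqrt (K z) * (g (snd z) * sqrt (K z)) = f (fst z) * g (snd z) * K z" for z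
    using K0[of z] by (metis (no_types, opaque_lifting) mult.assoc mult.left_commute real_sqrt_mult_self abs_of_nonneg)
  have A1: "(\<integral>z. (f (fst z))\<^sup>2 * K z \<partial>(M \<Otimes>\<^sub>M M)) \<le> (\<integral>x. (f x)\<^sup>2 \<partial>M)"
  proof -
    have "(\<integral>z. (f (fst z))\<^sup>2 * K z \<partial>(M \<Otimes>\<^sub>M M)) = (\<integral>x. (f x)\<^sup>2 * (\<integral>y. gauss_kernel m (x - y) \<partial>M) \<partial>M)"
      using MM.integral_fst'[OF 1] by (simp add: K_def)
    also have "\<dots> \<le> (\<integral>x. (f x)\<^sup>2 \<partial>M)"
      using f2 MM.integrable_fst'[OF 1] integral_gauss_kernel_le_1[OF m]
      by (intro integral_mono) (auto simp: K_def mult_left_le)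
    finally show ?thesis .
  qed
  have A2: "(\<integral>z. (g (snd z))\<^sup>2 * K z \<partial>(M \<Otimes>\<^sub>M M)) \<le> (\<integral>x. (g x)\<^sup>2 \<partial>M)"
  proof -
    have 2: "integrable (M \<Otimes>\<^sub>M M) (\<lambda>(x, y). (g y)\<^sup>2 * gauss_kernel m (y - x))"
      using 2 gauss_kernel_minus[of m] by (simp add: K_def case_prod_beta')
    have "(\<integral>z. (g (snd z))\<^sup>2 * K z \<partial>(M \<Otimes>\<^sub>M M)) = (\<integral>y. (g y)\<^sup>2 * (\<integral>x. gauss_kernel m (y - x) \<partial>M) \<partial>M)"
      using MM.integral_snd[OF 2] gauss_kernel_minus[of m] by (simp add: K_def case_prod_beta')
    also have "\<dots> \<le> (\<integral>y. (g y)\<^sup>2 \<partial>M)"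
      using g2 MM.integrable_snd[OF 2] integral_gauss_kernel_le_1[OF m]
      by (intro integral_mono) (auto simp: mult_left_le)
    finally show ?thesis .
  qed
  have "\<bar>smoothed m f g\<bar> \<le> sqrt (\<integral>z. (f (fst z))\<^sup>2 * K z \<partial>(M \<Otimes>\<^sub>M M)) * sqrt (\<integral>z. (g (snd z))\<^sup>2 * K z \<partial>(M \<Otimes>\<^sub>M M))"
    using CS K0 unfolding smoothed_def by (simp add: eq power_mult_distrib) (simp add: K_def)
  also have "\<dots> \<le> sqrt (\<integral>x. (f x)\<^sup>2 \<partial>M) * sqrt (\<integral>x. (g x)\<^sup>2 \<partial>M)"
    using A1 A2 by (intro mult_mono real_sqrt_le_mono) (auto intro!: integral_nonneg_AE simp: K0)
  finally show ?thesis .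
qed

text \<open>After scaling, the inner integral averages \<open>g\<close> at x - z/m over a fixed
  Gaussian in z. As \<Omega> is open, these points eventually lie in \<Omega> for each z, so the
  cut-off tends to 1. A bound of \<open>g\<close> on \<Omega> allows dominated convergence in z and
  then in x.\<close>

lemma smoothed_continuous_tendsto:
  assumes f: "continuous_on UNIV f" and g: "continuous_on UNIV g"
  shows "(\<lambda>j. smoothed (real (Suc j)) f g) \<longlonglongrightarrow> (\<integral>x. f x * g x \<partial>M)"
proof -
  interpret finite_measure M by (rule finite_M)
  have [measurable]: "f \<in> borel_measurable borel" "g \<in> borel_measurable borel"
    using f g borel_measurable_continuous_onI by auto
  have [measurable]: "f \<in> borel_measurable M" "g \<in> borel_measurable M"
    using measurable_compose[OF id_M] by auto
  have fi: "integrable M f" and gi: "integrable M g"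
    using integrable_lebesgue_on_continuous[OF _ op bd] f g by auto
  obtain B where B: "\<forall>x\<in>\<Omega>. \<bar>g x\<bar> \<le> B"
  proof -
    have "bounded (g ` closure \<Omega>)"
      using bd by (intro compact_imp_bounded compact_continuous_image continuous_on_subset[OF g]) auto
    then obtain B where "\<forall>x\<in>closure \<Omega>. \<bar>g x\<bar> \<le> B" by (auto simp: bounded_iff)
    then show ?thesis using that[of B] closure_subset[of \<Omega>] by blast
  qed
  define h where "h j x z = indicator \<Omega> (x - z /\<^sub>R real (Suc j)) * g (x - z /\<^sub>R real (Suc j)) * gauss_density z" for j x and z :: "real^3"
  have [measurable]: "h j x \<in> borel_measurable borel" for j x unfolding h_def by measurable
  have hB: "norm (h j x z) \<le> \<bar>B\<bar> * gauss_density z" for j x z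
    using B gauss_density_nonneg[of z] by (auto simp: h_def indicator_def abs_mult intro!: mult_right_mono)
  have iB: "integrable lborel (\<lambda>z. \<bar>B\<bar> * gauss_density z)" using integral_gauss_density(1) by simp
  have inner: "(\<integral>y. g y * gauss_kernel (real (Suc j)) (x - y) \<partial>M) = (\<integral>z. h j x z \<partial>lborel)" for j x
  proof -
    have "(\<integral>y. g y * gauss_kernel (real (Suc j)) (x - y) \<partial>M) = (\<integral>y. indicator \<Omega> y *\<^sub>R (g y * gauss_kernel (real (Suc j)) (x - y)) \<partial>lborel)"
      by (rule integral_lebesgue_on_borel) auto
    also have "\<dots> = (\<integral>y. (indicator \<Omega> y * g y) * gauss_kernel (real (Suc j)) (x - y) \<partial>lborel)"
      by (simp add: mult.assoc)
    also have "\<dots> = (\<integral>z. h j x z \<partial>lborel)"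
      unfolding h_def by (rule integral_scaled) auto
    finally show ?thesis .
  qed
  have lim: "(\<lambda>j. \<integral>z. h j x z \<partial>lborel) \<longlonglongrightarrow> g x" if x: "x \<in> \<Omega>" for x
  proof -
    have "(\<lambda>j. \<integral>z. h j x z \<partial>lborel) \<longlonglongrightarrow> (\<integral>z. g x * gauss_density z \<partial>lborel)"
    proof (rule integral_dominated_convergence[OF _ _ iB])
      show "AE z in lborel. (\<lambda>j. h j x z) \<longlonglongrightarrow> g x * gauss_density z"
      proof (rule AE_I2)
        fix z
        have "(\<lambda>j. x - z /\<^sub>R real (Suc j)) \<longlonglongrightarrow> x - 0 *\<^sub>R z"
          using LIMSEQ_inverse_real_of_nat by (intro tendsto_intros)
        then have l: "(\<lambda>j. x - z /\<^sub>R real (Suc j)) \<longlonglongrightarrow> x" by simp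
        have "(\<lambda>j. g (x - z /\<^sub>R real (Suc j))) \<longlonglongrightarrow> g x"
          using g l by (intro isCont_tendsto_compose[OF _ l]) (simp add: continuous_on_eq_continuous_at)
        moreover have "\<forall>\<^sub>F j in sequentially. x - z /\<^sub>R real (Suc j) \<in> \<Omega>"
          by (rule topological_tendstoD[OF l op x])
        then have "(\<lambda>j. indicator \<Omega> (x - z /\<^sub>R real (Suc j)) :: real) \<longlonglongrightarrow> 1"
          by (intro tendsto_eventually) (auto elim: eventually_mono)
        ultimately have "(\<lambda>j. h j x z) \<longlonglongrightarrow> 1 * g x * gauss_density z"
          unfolding h_def by (intro tendsto_intros)
        then show "(\<lambda>j. h j x z) \<longlonglongrightarrow> g x * gauss_density z" by simp
      qed
      show "AE z in lborel. norm (h j x z) \<le> \<bar>B\<bar> * gauss_density z" for j using hB by simp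
    qed auto
    then show ?thesis using integral_gauss_density(2) by simp
  qed
  have "smoothed (real (Suc j)) f g = (\<integral>x. f x * (\<integral>z. h j x z \<partial>lborel) \<partial>M)" for j
    using MM.integral_fst'[OF integrable_gauss_kernel[OF fi gi, of "real (Suc j)"]]
    by (simp add: smoothed_def inner[symmetric] mult.assoc)
  moreover have "(\<lambda>j. \<integral>x. f x * (\<integral>z. h j x z \<partial>lborel) \<partial>M) \<longlonglongrightarrow> (\<integral>x. f x * g x \<partial>M)"
  proof (rule integral_dominated_convergence)
    show "integrable M (\<lambda>x. \<bar>B\<bar> * \<bar>f x\<bar>)" using fi by simp
    show "AE x in M. (\<lambda>j. f x * (\<integral>z. h j x z \<partial>lborel)) \<longlonglongrightarrow> f x * g x"
      using lim by (intro AE_I2 tendsto_intros) (simp add: space_restrict_space)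
    show "AE x in M. norm (f x * (\<integral>z. h j x z \<partial>lborel)) \<le> \<bar>B\<bar> * \<bar>f x\<bar>" for j
    proof (rule AE_I2)
      fix x
      have ih: "integrable lborel (h j x)"
        using order_trans[OF hB abs_ge_self]
        by (intro Bochner_Integration.integrable_bound[OF iB]) (auto intro!: AE_I2)
      have "\<bar>\<integral>z. h j x z \<partial>lborel\<bar> \<le> (\<integral>z. norm (h j x z) \<partial>lborel)" using integral_norm_bound[of lborel "h j x"] by simp
      also have "\<dots> \<le> (\<integral>z. \<bar>B\<bar> * gauss_density z \<partial>lborel)"
        using ih iB hB by (intro integral_mono) auto
      also have "\<dots> = \<bar>B\<bar>" using integral_gauss_density(2) by simp
      finally show "norm (f x * (\<integral>z. h j x z \<partial>lborel)) \<le> \<bar>B\<bar> * \<bar>f x\<bar>"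
        by (simp add: abs_mult mult.commute[of "\<bar>B\<bar>"] mult_left_mono)
    qed
    show "(\<lambda>x. f x * (\<integral>z. h j x z \<partial>lborel)) \<in> borel_measurable M" for j
      unfolding inner[symmetric] by measurable
  qed measurable
  ultimately show ?thesis by simp
qed

text \<open>In this arrangement every error term has a difference as one factor and either
  \<open>f\<close>, \<open>g\<close> or another difference as the other, so the approximants
  themselves never have to be estimated.\<close>

lemma smoothed_diff:
  assumes f: "L2 M f" "L2 M f'" and g: "L2 M g" "L2 M g'" and m: "m > 0"
  shows "smoothed m f g = smoothed m (\<lambda>x. f x - f' x) g + smoothed m f (\<lambda>x. g x - g' x)
    - smoothed m (\<lambda>x. f x - f' x) (\<lambda>x. g x - g' x) + smoothed m f' g'"
proof -
  note i = integrable_gauss_kernel[OF L2_integrable_M L2_integrable_M m]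
  have "smoothed m (\<lambda>x. a x - a' x) b = smoothed m a b - smoothed m a' b" if "L2 M a" "L2 M a'" "L2 M b" for a a' b
    unfolding smoothed_def
    using Bochner_Integration.integral_diff[OF i[OF that(1) that(3)] i[OF that(2) that(3)]]
    by (simp add: left_diff_distrib right_diff_distrib)
  moreover have "smoothed m a (\<lambda>x. b x - b' x) = smoothed m a b - smoothed m a b'" if "L2 M a" "L2 M b" "L2 M b'" for a b b'
    unfolding smoothed_def
    using Bochner_Integration.integral_diff[OF i[OF that(1) that(2)] i[OF that(1) that(3)]]
    by (simp add: left_diff_distrib right_diff_distrib)
  ultimately show ?thesis using f g by (simp add: L2_diff)
qed

lemma integral_mult_diff:
  assumes f: "L2 M f" "L2 M f'" and g: "L2 M g" "L2 M g'"
  shows "(\<integral>x. f x * g x \<partial>M) = (\<integral>x. (f x - f' x) * g x \<partial>M) + (\<integral>x. f x * (g x - g' x) \<partial>M)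
    - (\<integral>x. (f x - f' x) * (g x - g' x) \<partial>M) + (\<integral>x. f' x * (g' x :: real) \<partial>M)"
proof -
  have i: "integrable M (\<lambda>x. a x * b x)" if "L2 M a" "L2 M b" for a b :: "real^3 \<Rightarrow> real"
    using L2_integrable_inner(1)[OF that] by simp
  show ?thesis
    using i[OF f(1) g(1)] i[OF f(1) g(2)] i[OF f(2) g(1)] i[OF f(2) g(2)]
    by (simp add: left_diff_distrib right_diff_distrib)
qed

text \<open>The error is controlled uniformly in the smoothing scale by the L2 distances to
  continuous approximants, so one pair of approximants can be fixed before the scale tends to
  infinity.\<close>

lemma smoothed_tendsto:
  fixes f g :: "real^3 \<Rightarrow> real"
  assumes p: "L2_tendsto M p f" "\<And>k. continuous_on UNIV (p k)"
    and q: "L2_tendsto M q g" "\<And>k. continuous_on UNIV (q k)"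
  shows "(\<lambda>j. smoothed (real (Suc j)) f g) \<longlonglongrightarrow> (\<integral>x. f x * g x \<partial>M)"
proof (rule LIMSEQ_I)
  fix e :: real assume e: "e > 0"
  have L: "L2 M f" "L2 M g" "\<And>k. L2 M (p k)" "\<And>k. L2 M (q k)"
    using p q by (auto simp: L2_tendsto_def)
  define nf where "nf a = sqrt (\<integral>x. (a x)\<^sup>2 \<partial>M)" for a :: "real^3 \<Rightarrow> real"
  define D where "D j a b = smoothed (real (Suc j)) a b - (\<integral>x. a x * b x \<partial>M)" for j a b
  \<comment> \<open>One copy of \<open>nf a * nf b\<close> bounds the smoothed pairing, the other
    bounds the limiting pairing by Cauchy-Schwarz.\<close>
  have D: "\<bar>D j a b\<bar> \<le> 2 * (nf a * nf b)" if "L2 M a" "L2 M b" for j a b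
    using smoothed_bound[OF that, of "real (Suc j)"] L2_Cauchy_Schwarz[OF that] by (simp add: D_def nf_def)
  define \<delta> where "\<delta> k = nf (\<lambda>x. f x - p k x)" for k
  define \<eta> where "\<eta> k = nf (\<lambda>x. g x - q k x)" for k
  have "(\<lambda>k. sqrt (\<integral>x. (norm (p k x - f x))\<^sup>2 \<partial>M)) \<longlonglongrightarrow> sqrt 0"
    using p(1) by (intro tendsto_intros) (simp add: L2_tendsto_def)
  then have \<delta>: "\<delta> \<longlonglongrightarrow> 0" by (simp add: \<delta>_def[abs_def] nf_def power2_commute)
  have "(\<lambda>k. sqrt (\<integral>x. (norm (q k x - g x))\<^sup>2 \<partial>M)) \<longlonglongrightarrow> sqrt 0"
    using q(1) by (intro tendsto_intros) (simp add: L2_tendsto_def)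
  then have \<eta>: "\<eta> \<longlonglongrightarrow> 0" by (simp add: \<eta>_def[abs_def] nf_def power2_commute)
  have "(\<lambda>k. 2 * (\<delta> k * nf g) + 2 * (nf f * \<eta> k) + 2 * (\<delta> k * \<eta> k)) \<longlonglongrightarrow> 2 * (0 * nf g) + 2 * (nf f * 0) + 2 * (0 * 0)"
    by (intro tendsto_intros \<delta> \<eta>)
  then have "\<forall>\<^sub>F k in sequentially. 2 * (\<delta> k * nf g) + 2 * (nf f * \<eta> k) + 2 * (\<delta> k * \<eta> k) < e / 2"
    using e by (intro order_tendstoD) auto
  then obtain k where k: "2 * (\<delta> k * nf g) + 2 * (nf f * \<eta> k) + 2 * (\<delta> k * \<eta> k) < e / 2"
    by (auto simp: eventually_sequentially)
  have "(\<lambda>j. D j (p k) (q k)) \<longlonglongrightarrow> 0"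
    unfolding D_def by (intro LIM_zero smoothed_continuous_tendsto p q)
  then obtain j0 where j0: "\<And>j. j \<ge> j0 \<Longrightarrow> \<bar>D j (p k) (q k)\<bar> < e / 2"
    using LIMSEQ_D[of _ 0 "e/2"] e by fastforce
  show "\<exists>no. \<forall>j\<ge>no. norm (smoothed (real (Suc j)) f g - (\<integral>x. f x * g x \<partial>M)) < e"
  proof (intro exI[of _ j0] allI impI)
    fix j assume j: "j \<ge> j0"
    have "D j f g = D j (\<lambda>x. f x - p k x) g + D j f (\<lambda>x. g x - q k x) - D j (\<lambda>x. f x - p k x) (\<lambda>x. g x - q k x) + D j (p k) (q k)"
      unfolding D_def
      using smoothed_diff[OF L(1) L(3)[of k] L(2) L(4)[of k], of "real (Suc j)"] integral_mult_diff[OF L(1) L(3)[of k] L(2) L(4)[of k]]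
      by simp
    moreover have "\<bar>D j (\<lambda>x. f x - p k x) g\<bar> \<le> 2 * (\<delta> k * nf g)" "\<bar>D j f (\<lambda>x. g x - q k x)\<bar> \<le> 2 * (nf f * \<eta> k)"
      "\<bar>D j (\<lambda>x. f x - p k x) (\<lambda>x. g x - q k x)\<bar> \<le> 2 * (\<delta> k * \<eta> k)"
      unfolding \<delta>_def \<eta>_def by (intro D L2_diff L)+
    ultimately have "\<bar>D j f g\<bar> < e" using k j0[OF j] by linarith
    then show "norm (smoothed (real (Suc j)) f g - (\<integral>x. f x * g x \<partial>M)) < e" by (simp add: D_def)
  qed
qed

text \<open>The factor in front is the normalisation of the kernel. It is positive, so signs found
  in frequency space carry over to the smoothed pairing.\<close>

lemma gauss3_fourier_smoothed:
  assumes f: "integrable M f" and g: "integrable M g" and m: "m > 0"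
  shows "smoothed m f g = m ^ 3 / sqrt (2 * pi) ^ 3 *
    (\<integral>\<kappa>. fourier_cos M f (m *\<^sub>R tri \<kappa>) * fourier_cos M g (m *\<^sub>R tri \<kappa>) +
      fourier_sin M f (m *\<^sub>R tri \<kappa>) * fourier_sin M g (m *\<^sub>R tri \<kappa>) \<partial>gauss3)"
  unfolding gauss3_fourier(2)[OF sigma_M id_M f g] smoothed_def integral_mult_right_zero[symmetric]
  by (intro Bochner_Integration.integral_cong refl) (simp add: gauss_kernel_def gauss_density_def power2_eq_square mult_ac)

end

subsection \<open>Nonnegativity for zero trace\<close>

sublocale C1_domain \<subseteq> bounded_open_set \<Omega>
  by unfold_locales (rule open_\<Omega> bounded_\<Omega>)+

lemma continuous_jacobian:
  fixes \<phi> :: "real^3 \<Rightarrow> real^3"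
  assumes "C_k 1 \<phi>"
  shows "continuous_on A (\<lambda>x. jacobian \<phi> (at x))"
proof -
  have "continuous_on A (\<lambda>x. \<chi> i. jacobian \<phi> (at x) $ i)"
    by (intro continuous_on_vec_lambda C1_gradient_continuous(2)[OF C1_gradient_component[OF assms]])
  then show ?thesis by simp
qed

lemma continuous_C_k_1: "C_k 1 \<phi> \<Longrightarrow> continuous_on A (\<phi> :: 'a::euclidean_space \<Rightarrow> 'b::real_normed_vector)"
  unfolding C_k_1_iff by (meson continuous_at_imp_continuous_on differentiable_imp_continuous_within)

context C1_domain begin

lemma has_trace_C1:
  assumes "C_k 1 \<phi>"
  shows "has_trace \<Omega> S \<phi> (\<lambda>x. jacobian \<phi> (at x)) \<phi>"
  unfolding has_trace_def using assms
  by (intro exI[of _ "\<lambda>k. \<phi>"] conjI allI L2_tendsto_const L2_\<Omega>_continuous L2_S_continuous continuous_jacobian continuous_C_k_1)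

text \<open>A test function vanishes on the frontier, so the surface term of
  \<open>trace_divergence\<close> disappears.\<close>

lemma sobolev_C1:
  assumes \<phi>: "C_k 1 \<phi>"
  shows "sobolev_W12 \<Omega> \<phi> (\<lambda>x. jacobian \<phi> (at x))"
  unfolding sobolev_W12_def
proof (intro conjI allI impI)
  show "L2 (lebesgue_on \<Omega>) \<phi>" "L2 (lebesgue_on \<Omega>) (\<lambda>x. jacobian \<phi> (at x))"
    using \<phi> by (intro L2_\<Omega>_continuous continuous_jacobian continuous_C_k_1; simp)+
  fix \<zeta> i j assume t: "test_function \<Omega> \<zeta>"
  have c\<zeta>: "C_k 1 \<zeta>" using t unfolding test_function_def by blast
  define \<zeta>' where "\<zeta>' x = (\<Sum>b\<in>Basis. frechet_derivative \<zeta> (at x) b *\<^sub>R b)" for x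
  have \<zeta>: "C1_gradient \<zeta> \<zeta>'" unfolding \<zeta>'_def by (rule C1_gradient_of_C_k[OF c\<zeta>])
  have e: "frechet_derivative \<zeta> (at x) (axis j 1) = \<zeta>' x \<bullet> axis j 1" for x
    using frechet_derivative_at[OF C1_gradient_has_derivative[OF \<zeta>, of x UNIV]] by metis
  have z: "\<zeta> x = 0" if "x \<in> frontier \<Omega>" for x
  proof -
    have "x \<notin> closure {x. \<zeta> x \<noteq> 0}" using t that open_\<Omega> unfolding test_function_def
      by (auto simp: frontier_def interior_open)
    then show ?thesis using closure_subset[of "{x. \<zeta> x \<noteq> 0}"] by blast
  qed
  have "(\<integral>x. \<zeta> x * (n x \<bullet> axis j 1) * \<phi> x $ i \<partial>S) = (\<integral>x. 0 \<partial>S)"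
    using z by (intro Bochner_Integration.integral_cong) (auto simp: space_S)
  then show "(\<integral>x. \<phi> x $ i * frechet_derivative \<zeta> (at x) (axis j 1) \<partial>lebesgue_on \<Omega>) =
        - (\<integral>x. jacobian \<phi> (at x) $ i $ j * \<zeta> x \<partial>lebesgue_on \<Omega>)"
    using trace_divergence[OF has_trace_C1[OF \<phi>] \<zeta>, of i "axis j 1"]
    by (simp add: e) (simp add: inner_axis mult.commute)
qed

lemma L2_entry:
  assumes "L2 N (H :: real^3 \<Rightarrow> real^3^3)"
  shows "L2 N (\<lambda>x. H x $ i $ j)"
  using L2_component[OF assms, of "axis i (axis j 1)"] by (simp add: inner_axis)

lemma integrable_entries:
  assumes "L2 N (H :: real^3 \<Rightarrow> real^3^3)" "L2 N (K :: real^3 \<Rightarrow> real^3^3)"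
  shows "integrable N (\<lambda>x. H x $ i $ j * K x $ k $ l)"
  using L2_integrable_inner(1)[OF L2_entry[OF assms(1), of i j] L2_entry[OF assms(2), of k l]] by simp

text \<open>Since the trace vanishes, integration by parts shows that the Fourier coefficients of the
  gradient are rank-one matrices, on which \<open>Q\<close> is nonnegative.\<close>

lemma integral_Q_nonneg:
  assumes \<phi>: "\<And>k. C_k 1 (\<phi> k)" and \<psi>: "C_k 1 \<psi>"
    and H: "L2_tendsto M (\<lambda>k x. jacobian (\<phi> k) (at x)) G"
    and parts: "\<And>\<zeta> \<zeta>' i j. C1_gradient \<zeta> \<zeta>' \<Longrightarrow>
      (\<integral>x. (G x - jacobian \<psi> (at x)) $ i $ j * \<zeta> x \<partial>M) = - (\<integral>x. (\<zeta>' x $ j) * (w x $ i) \<partial>M)"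
  shows "0 \<le> (\<integral>x. Q (G x - jacobian \<psi> (at x)) \<partial>M)"
proof -
  define H where "H x = G x - jacobian \<psi> (at x)" for x
  have LG: "L2 M G" using H by (simp add: L2_tendsto_def)
  have L\<psi>: "L2 M (\<lambda>x. jacobian \<psi> (at x))" by (intro L2_\<Omega>_continuous continuous_jacobian \<psi>)
  have LH: "L2 M H" unfolding H_def by (rule L2_diff[OF LG L\<psi>])
  have HL: "L2_tendsto M (\<lambda>k x. (jacobian (\<phi> k) (at x) - jacobian \<psi> (at x)) $ i $ j) (\<lambda>x. H x $ i $ j)" for i j
    using L2_tendsto_component[OF L2_tendsto_diff[OF H L\<psi>], of "axis i (axis j 1)"] by (simp add: inner_axis H_def)
  have cH: "continuous_on UNIV (\<lambda>x. (jacobian (\<phi> k) (at x) - jacobian \<psi> (at x)) $ i $ j)" for k i j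
    by (intro continuous_intros continuous_jacobian \<phi> \<psi>)
  have Hi: "integrable M (\<lambda>x. H x $ i $ j)" for i j
    by (rule L2_integrable_M[OF L2_entry[OF LH]])
  define C where "C k = (\<chi> i j. fourier_cos M (\<lambda>x. H x $ i $ j) k)" for k
  define D where "D k = (\<chi> i j. fourier_sin M (\<lambda>x. H x $ i $ j) k)" for k
  \<comment> \<open>Testing with the cosine gives the vector of sine integrals of \<open>w\<close>
    times \<open>k\<close>. Testing with the sine gives the cosine integrals with the opposite sign.
    So the two parts of the Fourier coefficient are of rank one separately.\<close>
  have "0 \<le> Q (C k)" for k
  proof (rule Q_rank_one_nonneg)
    fix i j
    have "C1_gradient (\<lambda>x. cos (k \<bullet> x)) (\<lambda>x. (- sin (k \<bullet> x)) *\<^sub>R k)"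
      by (rule C1_gradient_compose[OF C1_gradient_inner]) (auto intro!: derivative_eq_intros continuous_intros)
    from parts[OF this, of i j] show "C k $ i $ j = (\<chi> i. \<integral>x. sin (k \<bullet> x) * w x $ i \<partial>M) $ i * k $ j"
      by (simp add: C_def fourier_cos_def H_def mult_ac)
  qed
  moreover have "0 \<le> Q (D k)" for k
  proof (rule Q_rank_one_nonneg)
    fix i j
    have "C1_gradient (\<lambda>x. sin (k \<bullet> x)) (\<lambda>x. cos (k \<bullet> x) *\<^sub>R k)"
      by (rule C1_gradient_compose[OF C1_gradient_inner]) (auto intro!: derivative_eq_intros continuous_intros)
    from parts[OF this, of i j] show "D k $ i $ j = (\<chi> i. - (\<integral>x. cos (k \<bullet> x) * w x $ i \<partial>M)) $ i * k $ j"
      by (simp add: D_def fourier_sin_def H_def mult_ac)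
  qed
  ultimately have QCD: "0 \<le> Q (C k) + Q (D k)" for k by (simp add: add_nonneg_nonneg)
  define P where "P i j k l m \<kappa> = C (m *\<^sub>R tri \<kappa>) $ i $ j * C (m *\<^sub>R tri \<kappa>) $ k $ l + D (m *\<^sub>R tri \<kappa>) $ i $ j * D (m *\<^sub>R tri \<kappa>) $ k $ l" for i j k l m \<kappa>
  have Pi: "integrable gauss3 (P i j k l m)" for i j k l m
    using gauss3_fourier(1)[OF sigma_M id_M Hi[of i j] Hi[of k l], of m] by (simp add: P_def[abs_def] C_def D_def)
  define E where "E i j k l m = smoothed m (\<lambda>x. H x $ i $ j) (\<lambda>x. H x $ k $ l)" for i j k l m
  have E: "E i j k l m = m ^ 3 / sqrt (2 * pi) ^ 3 * (\<integral>\<kappa>. P i j k l m \<kappa> \<partial>gauss3)" if "m > 0" for i j k l m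
    using gauss3_fourier_smoothed[OF Hi[of i j] Hi[of k l] that] by (simp add: P_def[abs_def] C_def D_def E_def)
  \<comment> \<open>The coefficients are those of \<open>Q\<close>, with each product of two entries
    replaced by the smoothed pairing of these entries of \<open>H\<close>. Thus \<open>QE\<close>
    inherits its sign from \<open>Q\<close> on the frequencies, while its limit is the integral of
    \<open>Q (H x)\<close>.\<close>
  define QE where "QE m = E 1 1 1 1 m + E 2 2 2 2 m + E 3 3 3 3 m - 2 * E 1 1 2 2 m - 2 * E 2 2 3 3 m - 2 * E 3 3 1 1 m
    + E 1 2 1 2 m + E 2 3 2 3 m + E 3 1 3 1 m" for m
  have "0 \<le> QE m" if "m > 0" for m
  proof -
    have "0 \<le> (\<integral>\<kappa>. Q (C (m *\<^sub>R tri \<kappa>)) + Q (D (m *\<^sub>R tri \<kappa>)) \<partial>gauss3)"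
      by (intro integral_nonneg_AE AE_I2 QCD)
    also have "\<dots> = (\<integral>\<kappa>. P 1 1 1 1 m \<kappa> + P 2 2 2 2 m \<kappa> + P 3 3 3 3 m \<kappa> - 2 * P 1 1 2 2 m \<kappa> - 2 * P 2 2 3 3 m \<kappa> - 2 * P 3 3 1 1 m \<kappa>
      + P 1 2 1 2 m \<kappa> + P 2 3 2 3 m \<kappa> + P 3 1 3 1 m \<kappa> \<partial>gauss3)"
      by (intro Bochner_Integration.integral_cong refl) (simp add: P_def Q_def power2_eq_square algebra_simps)
    finally have "0 \<le> m ^ 3 / sqrt (2 * pi) ^ 3 * \<dots>" using that by simp
    also have "\<dots> = QE m"
      using Pi by (simp add: QE_def E that algebra_simps)
    finally show ?thesis .
  qed
  then have nonneg: "0 \<le> QE (real (Suc j))" for j by simp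
  define I where "I i j k l = (\<integral>x. H x $ i $ j * H x $ k $ l \<partial>M)" for i j k l
  have EI: "(\<lambda>r. E i j k l (real (Suc r))) \<longlonglongrightarrow> I i j k l" for i j k l
    unfolding E_def I_def by (rule smoothed_tendsto[OF HL cH HL cH])
  have "(\<lambda>r. QE (real (Suc r))) \<longlonglongrightarrow> I 1 1 1 1 + I 2 2 2 2 + I 3 3 3 3 - 2 * I 1 1 2 2 - 2 * I 2 2 3 3 - 2 * I 3 3 1 1
    + I 1 2 1 2 + I 2 3 2 3 + I 3 1 3 1"
    unfolding QE_def by (intro tendsto_intros EI)
  moreover have "I 1 1 1 1 + I 2 2 2 2 + I 3 3 3 3 - 2 * I 1 1 2 2 - 2 * I 2 2 3 3 - 2 * I 3 3 1 1
    + I 1 2 1 2 + I 2 3 2 3 + I 3 1 3 1 = (\<integral>x. Q (H x) \<partial>M)"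
    using integrable_entries[OF LH LH] by (simp add: I_def Q_def power2_eq_square mult.assoc)
  ultimately have "(\<lambda>r. QE (real (Suc r))) \<longlonglongrightarrow> (\<integral>x. Q (H x) \<partial>M)" by simp
  then show ?thesis unfolding H_def[symmetric] by (rule LIMSEQ_le_const) (use nonneg in auto)
qed

end

subsection \<open>The special fields\<close>

locale special_field = C1_domain +
  fixes v0 v1 v2 v3 :: "real \<Rightarrow> real"
  assumes v: "v0 C1_differentiable_on UNIV" "v1 C1_differentiable_on UNIV"
    "v2 C1_differentiable_on UNIV" "v3 C1_differentiable_on UNIV"
begin

abbreviation "u0 \<equiv> u_special v0 v1 v2 v3"
abbreviation "J \<equiv> J_special v0 v1 v2 v3"

definition "a0 = (vector [1, 1, 1] :: real^3)"
definition "a1 = (vector [-1, 1, 1] :: real^3)"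
definition "a2 = (vector [1, -1, 1] :: real^3)"
definition "a3 = (vector [1, 1, -1] :: real^3)"

text \<open>Row i weights the directions by their own i-th entries: the amplitude of every wave
  equals its direction, so this is the sum of the rank-one matrices v_l' a_l \<otimes> a_l.\<close>

definition "grad_u0 x =
  (vector [deriv v0 (a0 \<bullet> x) *\<^sub>R a0 - deriv v1 (a1 \<bullet> x) *\<^sub>R a1 + deriv v2 (a2 \<bullet> x) *\<^sub>R a2 + deriv v3 (a3 \<bullet> x) *\<^sub>R a3,
    deriv v0 (a0 \<bullet> x) *\<^sub>R a0 + deriv v1 (a1 \<bullet> x) *\<^sub>R a1 - deriv v2 (a2 \<bullet> x) *\<^sub>R a2 + deriv v3 (a3 \<bullet> x) *\<^sub>R a3,
    deriv v0 (a0 \<bullet> x) *\<^sub>R a0 + deriv v1 (a1 \<bullet> x) *\<^sub>R a1 + deriv v2 (a2 \<bullet> x) *\<^sub>R a2 - deriv v3 (a3 \<bullet> x) *\<^sub>R a3] :: real^3^3)"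

lemma inner_a: "a0 \<bullet> x = x$1 + x$2 + x$3" "a1 \<bullet> x = - x$1 + x$2 + x$3"
    "a2 \<bullet> x = x$1 - x$2 + x$3" "a3 \<bullet> x = x$1 + x$2 - x$3"
  by (simp_all add: inner_vec_def sum_3 a0_def a1_def a2_def a3_def)

lemma C1_gradient_plane_wave:
  assumes "w C1_differentiable_on UNIV"
  shows "C1_gradient (\<lambda>x. w (a \<bullet> x)) (\<lambda>x. deriv w (a \<bullet> x) *\<^sub>R a)"
proof (rule C1_gradient_compose[OF C1_gradient_inner])
  show "(w has_real_derivative deriv w t) (at t)" for t
    using assms by (auto simp: C1_differentiable_on_eq DERIV_deriv_iff_real_differentiable)
  show "continuous_on UNIV (deriv w)"
    using assms by (simp add: C1_differentiable_on_eq field_derivative_eq_vector_derivative)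
qed

lemmas waves = v[THEN C1_gradient_plane_wave]

lemma C1_gradient_u0: "C1_gradient (\<lambda>x. u0 x $ i) (\<lambda>x. grad_u0 x $ i)"
proof -
  have "C1_gradient (\<lambda>x. u0 x $ 1) (\<lambda>x. grad_u0 x $ 1)"
    using C1_gradient_add[OF C1_gradient_add[OF C1_gradient_diff[OF waves(1)[of a0] waves(2)[of a1]] waves(3)[of a2]] waves(4)[of a3]]
    by (simp add: u_special_def Let_def grad_u0_def vector_3 inner_a)
  moreover have "C1_gradient (\<lambda>x. u0 x $ 2) (\<lambda>x. grad_u0 x $ 2)"
    using C1_gradient_add[OF C1_gradient_diff[OF C1_gradient_add[OF waves(1)[of a0] waves(2)[of a1]] waves(3)[of a2]] waves(4)[of a3]]
    by (simp add: u_special_def Let_def grad_u0_def vector_3 inner_a)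
  moreover have "C1_gradient (\<lambda>x. u0 x $ 3) (\<lambda>x. grad_u0 x $ 3)"
    using C1_gradient_diff[OF C1_gradient_add[OF C1_gradient_add[OF waves(1)[of a0] waves(2)[of a1]] waves(3)[of a2]] waves(4)[of a3]]
    by (simp add: u_special_def Let_def grad_u0_def vector_3 inner_a)
  ultimately show ?thesis using exhaust_3[of i] by auto
qed

lemma has_derivative_u0: "(u0 has_derivative (*v) (grad_u0 x)) (at x)"
proof (subst has_derivative_componentwise_within, rule ballI)
  fix b :: "real^3" assume "b \<in> Basis"
  then obtain i where b: "b = axis i 1" by (auto simp: Basis_vec_def)
  show "((\<lambda>x. u0 x \<bullet> b) has_derivative (\<lambda>h. (grad_u0 x *v h) \<bullet> b)) (at x)"
    using C1_gradient_has_derivative[OF C1_gradient_u0[of i], of x UNIV]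
    by (simp add: b inner_axis matrix_vector_mul_component)
qed

lemma jacobian_u0: "jacobian u0 (at x) = grad_u0 x"
  unfolding jacobian_def frechet_derivative_at[OF has_derivative_u0[of x], symmetric]
  by (rule matrix_of_matrix_vector_mul)

lemma C_k_1_u0: "C_k 1 u0"
  unfolding C_k_1_iff
proof (intro conjI allI)
  show "u0 differentiable at x" for x using has_derivative_u0 by (auto simp: differentiable_def)
  have "continuous_on UNIV (\<lambda>x. \<chi> i. grad_u0 x $ i \<bullet> h)" for h
    by (intro continuous_intros C1_gradient_continuous(2)[OF C1_gradient_u0])
  then show "continuous_on UNIV (\<lambda>x. frechet_derivative u0 (at x) h)" for h
    unfolding frechet_derivative_at[OF has_derivative_u0, symmetric]
    by (simp add: matrix_vector_mult_def inner_vec_def)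
qed

text \<open>The Frobenius inner product. With \<open>J x\<close> as first argument it is the polar
  form of \<open>Q\<close> at \<open>grad_u0 x\<close>.\<close>

definition QB :: "real^3^3 \<Rightarrow> real^3^3 \<Rightarrow> real" where
  "QB A B = A$1 \<bullet> B$1 + A$2 \<bullet> B$2 + A$3 \<bullet> B$3"

text \<open>The second-order Taylor expansion, exact for a quadratic form. The constant term
  \<open>Q (grad_u0 x)\<close> appears as \<open>QB (J x) (grad_u0 x)\<close> by Euler's
  identity.\<close>

lemma Q_expand: "Q (grad_u0 x + K) = QB (J x) (grad_u0 x) + 2 * QB (J x) K + Q K"
  by (simp only: QB_def J_special_def Let_def grad_u0_def inner_a)
     (simp add: Q_def vector_3 a0_def a1_def a2_def a3_def inner_vec_def sum_3 power2_eq_square algebra_simps)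

text \<open>Sorted by waves and rows, \<open>QB (J x) (G x)\<close> is a sum of twelve terms. Each
  is a function of a_l . x times a row of \<open>G\<close> paired with a constant vector orthogonal
  to a_l, so \<open>trace_divergence_free\<close> applies to all of them.\<close>

lemma integral_J_trace:
  assumes tr: "has_trace \<Omega> S u G t"
  shows "integrable M (\<lambda>x. QB (J x) (G x))"
    and "(\<integral>x. QB (J x) (G x) \<partial>M) = (\<integral>x. t x \<bullet> (J x *v n x) \<partial>S)"
proof -
  define p where "p w a i m x = deriv w (a \<bullet> x) * (G x $ i \<bullet> m)" for w :: "real \<Rightarrow> real" and a m x :: "real^3" and i :: 3
  define q where "q w a i m x = deriv w (a \<bullet> x) * ((n x \<bullet> m) * t x $ i)" for w :: "real \<Rightarrow> real" and a m x :: "real^3" and i :: 3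
  note divf = trace_divergence_free[OF tr, folded p_def q_def]
  \<comment> \<open>The vectors are the rows of the constant matrices M_l, three for each
    direction.\<close>
  have orth:
    "a0 \<bullet> (vector [-1,1,0] :: real^3) = 0"
    "a0 \<bullet> (vector [0,-1,1] :: real^3) = 0"
    "a0 \<bullet> (vector [1,0,-1] :: real^3) = 0"
    "a1 \<bullet> (vector [-1,-1,0] :: real^3) = 0"
    "a1 \<bullet> (vector [0,-1,1] :: real^3) = 0"
    "a1 \<bullet> (vector [-1,0,-1] :: real^3) = 0"
    "a2 \<bullet> (vector [-1,-1,0] :: real^3) = 0"
    "a2 \<bullet> (vector [0,-1,-1] :: real^3) = 0"
    "a2 \<bullet> (vector [1,0,-1] :: real^3) = 0"
    "a3 \<bullet> (vector [-1,1,0] :: real^3) = 0"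
    "a3 \<bullet> (vector [0,-1,-1] :: real^3) = 0"
    "a3 \<bullet> (vector [-1,0,-1] :: real^3) = 0"
    by (simp_all add: a0_def a1_def a2_def a3_def inner_vec_def sum_3 vector_3)
  note facts = divf[OF v(1) orth(1)] divf[OF v(1) orth(2)] divf[OF v(1) orth(3)] divf[OF v(2) orth(4)] divf[OF v(2) orth(5)] divf[OF v(2) orth(6)] divf[OF v(3) orth(7)] divf[OF v(3) orth(8)] divf[OF v(3) orth(9)] divf[OF v(4) orth(10)] divf[OF v(4) orth(11)] divf[OF v(4) orth(12)]
  have P: "QB (J x) (G x) = p v0 a0 1 (vector [-1,1,0]) x + p v0 a0 2 (vector [0,-1,1]) x + p v0 a0 3 (vector [1,0,-1]) x + p v1 a1 1 (vector [-1,-1,0]) x + p v1 a1 2 (vector [0,-1,1]) x + p v1 a1 3 (vector [-1,0,-1]) x + p v2 a2 1 (vector [-1,-1,0]) x + p v2 a2 2 (vector [0,-1,-1]) x + p v2 a2 3 (vector [1,0,-1]) x + p v3 a3 1 (vector [-1,1,0]) x + p v3 a3 2 (vector [0,-1,-1]) x + p v3 a3 3 (vector [-1,0,-1]) x" for x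
    by (simp only: p_def QB_def J_special_def Let_def inner_a) (simp add: vector_3 inner_vec_def sum_3 algebra_simps)
  have Q: "t x \<bullet> (J x *v n x) = q v0 a0 1 (vector [-1,1,0]) x + q v0 a0 2 (vector [0,-1,1]) x + q v0 a0 3 (vector [1,0,-1]) x + q v1 a1 1 (vector [-1,-1,0]) x + q v1 a1 2 (vector [0,-1,1]) x + q v1 a1 3 (vector [-1,0,-1]) x + q v2 a2 1 (vector [-1,-1,0]) x + q v2 a2 2 (vector [0,-1,-1]) x + q v2 a2 3 (vector [1,0,-1]) x + q v3 a3 1 (vector [-1,1,0]) x + q v3 a3 2 (vector [0,-1,-1]) x + q v3 a3 3 (vector [-1,0,-1]) x" for x
    by (simp only: q_def J_special_def Let_def inner_a)
       (simp add: vector_3 inner_vec_def matrix_vector_mult_def sum_3 algebra_simps)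
  show "integrable M (\<lambda>x. QB (J x) (G x))"
    unfolding P by (intro Bochner_Integration.integrable_add facts)
  show "(\<integral>x. QB (J x) (G x) \<partial>M) = (\<integral>x. t x \<bullet> (J x *v n x) \<partial>S)"
    unfolding P Q by (simp add: facts)
qed

theorem main_inequality:
  assumes tr: "has_trace \<Omega> S u G u0"
  shows "(\<integral>x. u0 x \<bullet> (J x *v n x) \<partial>S) \<le> (\<integral>x. Q (G x) \<partial>M)"
    and "(AE x in M. G x = grad_u0 x) \<Longrightarrow> (\<integral>x. Q (G x) \<partial>M) = (\<integral>x. u0 x \<bullet> (J x *v n x) \<partial>S)"
proof -
  have tr0: "has_trace \<Omega> S u0 grad_u0 u0"
    using has_trace_C1[OF C_k_1_u0] by (simp add: jacobian_u0)
  have LG: "L2 M G" and L0: "L2 M grad_u0" using tr tr0 by (auto simp: has_trace_def L2_tendsto_def)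
  define H where "H x = G x - grad_u0 x" for x
  have LH: "L2 M H" unfolding H_def by (rule L2_diff[OF LG L0])
  have iQ: "integrable M (\<lambda>x. Q (K x))" if "L2 M K" for K
    using integrable_entries[OF that that] by (simp add: Q_def power2_eq_square mult.assoc)
  have JH: "QB (J x) (H x) = QB (J x) (G x) - QB (J x) (grad_u0 x)" for x
    by (simp add: QB_def H_def inner_diff_right)
  have QG: "Q (G x) = QB (J x) (grad_u0 x) + 2 * QB (J x) (H x) + Q (H x)" for x
    using Q_expand[of x "H x"] by (simp add: H_def)
  \<comment> \<open>\<open>u\<close> and \<open>u0\<close> have the same trace, so the integrals of
    \<open>QB (J x) (G x)\<close> and \<open>QB (J x) (grad_u0 x)\<close> are the same surface
    integral. The mixed term cancels, and one copy of the surface integral remains.\<close>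
  have eq: "(\<integral>x. Q (G x) \<partial>M) = (\<integral>x. u0 x \<bullet> (J x *v n x) \<partial>S) + (\<integral>x. Q (H x) \<partial>M)"
    unfolding QG JH using integral_J_trace[OF tr] integral_J_trace[OF tr0] iQ[OF LH] by simp
  obtain \<phi> :: "nat \<Rightarrow> real^3 \<Rightarrow> real^3" where \<phi>: "\<And>k. C_k 1 (\<phi> k)"
      and l2: "L2_tendsto M (\<lambda>k x. jacobian (\<phi> k) (at x)) G"
    using tr unfolding has_trace_def by blast
  have "0 \<le> (\<integral>x. Q (G x - jacobian u0 (at x)) \<partial>M)"
  proof (rule integral_Q_nonneg[OF \<phi> C_k_1_u0 l2, where w = "\<lambda>x. u x - u0 x"])
    fix \<zeta> :: "real^3 \<Rightarrow> real" and \<zeta>' i j assume \<zeta>: "C1_gradient \<zeta> \<zeta>'"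
    have c\<zeta>: "L2 M \<zeta>" "L2 M (\<lambda>x. \<zeta>' x \<bullet> axis j 1)"
      by (intro L2_\<Omega>_continuous continuous_intros C1_gradient_continuous[OF \<zeta>])+
    have Lu: "L2 M u" "L2 M u0" using tr tr0 by (auto simp: has_trace_def L2_tendsto_def)
    \<comment> \<open>Both sides equal the same surface integral; subtracting them gives integration
      by parts for \<open>u - u0\<close> without a boundary term.\<close>
    have "(\<integral>x. \<zeta> x * (G x $ i \<bullet> axis j 1) \<partial>M) + (\<integral>x. (\<zeta>' x \<bullet> axis j 1) * u x $ i \<partial>M) =
        (\<integral>x. \<zeta> x * (grad_u0 x $ i \<bullet> axis j 1) \<partial>M) + (\<integral>x. (\<zeta>' x \<bullet> axis j 1) * u0 x $ i \<partial>M)"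
      using trace_divergence[OF tr \<zeta>, of i "axis j 1"] trace_divergence[OF tr0 \<zeta>, of i "axis j 1"] by simp
    then show "(\<integral>x. (G x - jacobian u0 (at x)) $ i $ j * \<zeta> x \<partial>M) = - (\<integral>x. \<zeta>' x $ j * (u x - u0 x) $ i \<partial>M)"
      using L2_integrable_mult[OF LG c\<zeta>(1), of "axis i (axis j 1)"] L2_integrable_mult[OF L0 c\<zeta>(1), of "axis i (axis j 1)"]
        L2_integrable_mult[OF Lu(1) c\<zeta>(2), of "axis i 1"] L2_integrable_mult[OF Lu(2) c\<zeta>(2), of "axis i 1"]
      by (simp add: jacobian_u0 inner_axis algebra_simps)
  qed
  then have "0 \<le> (\<integral>x. Q (H x) \<partial>M)" by (simp add: H_def jacobian_u0)
  then show "(\<integral>x. u0 x \<bullet> (J x *v n x) \<partial>S) \<le> (\<integral>x. Q (G x) \<partial>M)" by (simp add: eq)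
  assume "AE x in M. G x = grad_u0 x"
  then have "AE x in M. Q (H x) = 0" by eventually_elim (simp add: H_def Q_def)
  then have "(\<integral>x. Q (H x) \<partial>M) = 0" by (rule integral_eq_zero_AE)
  then show "(\<integral>x. Q (G x) \<partial>M) = (\<integral>x. u0 x \<bullet> (J x *v n x) \<partial>S)" by (simp add: eq)
qed

end

text \<open>The last two conjuncts make \<open>u0\<close>, with its Jacobian, an admissible
  competitor, so the equality case is attained and the bound is sharp.\<close>

theorem mainTheorem4:
  fixes \<Omega> :: "(real^3) set" and n :: "real^3 \<Rightarrow> real^3" and S :: "(real^3) measure"
    and v0 v1 v2 v3 :: "real \<Rightarrow> real"
  assumes "bounded_C1_domain \<Omega>"
    and "outward_unit_normal \<Omega> n"
    and "surface_measure \<Omega> S"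
    and "v0 C1_differentiable_on UNIV" and "v1 C1_differentiable_on UNIV"
    and "v2 C1_differentiable_on UNIV" and "v3 C1_differentiable_on UNIV"
  defines "u0 \<equiv> u_special v0 v1 v2 v3" and "J \<equiv> J_special v0 v1 v2 v3"
  shows "(\<forall>u G. sobolev_W12 \<Omega> u G \<and> has_trace \<Omega> S u G u0 \<longrightarrow>
            (\<integral>x. Q (G x) \<partial>lebesgue_on \<Omega>) \<ge> (\<integral>x. u0 x \<bullet> (J x *v n x) \<partial>S) \<and>
            ((AE x in lebesgue_on \<Omega>. G x = jacobian u0 (at x)) \<longrightarrow>
              (\<integral>x. Q (G x) \<partial>lebesgue_on \<Omega>) = (\<integral>x. u0 x \<bullet> (J x *v n x) \<partial>S))) \<and>
         sobolev_W12 \<Omega> u0 (\<lambda>x. jacobian u0 (at x)) \<and>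
         has_trace \<Omega> S u0 (\<lambda>x. jacobian u0 (at x)) u0"
proof -
  interpret F: special_field \<Omega> n S v0 v1 v2 v3
    using assms(1-7) by unfold_locales
  show ?thesis
    unfolding u0_def J_def
    using F.main_inequality F.sobolev_C1[OF F.C_k_1_u0] F.has_trace_C1[OF F.C_k_1_u0]
    by (auto simp: F.jacobian_u0)
qed

end
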